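(* Let $M^n$, $O^{n+1}$ be smooth manifolds and $T>0$. Let $g^O(t)$, $t\in(0,T]$, be a smooth family of Riemannian metrics on $O^{n+1}$ and $F_t:M^n\to O^{n+1}$, $t\in(0,T]$, a smooth family of immersions with $M_t=F_t(M^n)$, solving the mean curvature flow in a Ricci flow background $$\frac{\partial}{\partial t}F_t=-H\nu,\qquad \frac{\partial}{\partial t}g^O=-2\,\mathrm{Ric}_{g^O}.$$ Suppose that $g^O(t)$ has uniformly bounded curvature and that $M_t$ has uniformly bounded second fundamental form. For large $N>0$ let $\check g=\check g_N$ be the metric on $O^{n+1}\times(0,T]$ given by $$\check g=\frac{g^O(t)}{t}+\left(\frac{N}{2t^3}+\frac{R_{g^O}}{t}+\frac{n+1}{2t^2}\right)dt^2,$$ let $\check f(y,t)=-\frac{N}{2t}$, and let $\check\Sigma=\{(x,t):x\in M_t,\ t\in(0,T]\}$ be the space-time track of $M_t$, viewed as an immersed hypersurface of $(O^{n+1}\times(0,T],\check g)$. Then $\check\Sigma$ is an approximate soliton of the mean curvature flow, i.e. the quantity $$\check E_N=H^{\check\Sigma}-\nu^{\check\Sigma}\check f$$ is such that $N|\check E_N|$ is bounded uniformly locally on $\check\Sigma$, independently of $N$. Here $H^{\check\Sigma}$ and $\nu^{\check\Sigma}$ are the mean curvature and the unit normal of $\check\Sigma$ with respect to $\check g$, and $\nu^{\check\Sigma}\check f$ is the derivative of $\check f$ in direction $\nu^{\check\Sigma}$.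
   Context: Conventions. $\nu$ is a smooth choice of unit normal on $M_t$ with respect to $g^O(t)$; the second fundamental form of $M_t$ is $h(X,Y)=-g^O({}^{g^O}\nabla_XY,\nu)$ for tangential $X,Y$, and $H$ is its trace with respect to the induced metric $g$ on $M_t$ (so that $\partial_tF_t=-H\nu$ is the usual mean curvature flow). $\mathrm{Ric}_{g^O}$ and $R_{g^O}$ are the Ricci tensor and scalar curvature of $g^O(t)$, with the usual sign (positive on round spheres). The parameter $N$ is always taken large enough that $\check g_N$ is a Riemannian metric (possible because the curvature is uniformly bounded). The product $O^{n+1}\times(0,T]$ carries no mixed space-time components in $\check g$. The track $\check\Sigma$ is the immersion $F^{\check\Sigma}:M^n\times(0,T]\to O^{n+1}\times(0,T]$, $F^{\check\Sigma}(x,t)=(F_t(x),t)$. Its unit normal $\nu^{\check\Sigma}$ is chosen on the same side as $\nu$, i.e. $\check g(\nu^{\check\Sigma},\nu)>0$; its second fundamental form is $h^{\check\Sigma}(X,Y)=-\check g(\check\nabla_XY,\nu^{\check\Sigma})$ with $\check\nabla$ the Levi-Civita connection of $\check g$, and $H^{\check\Sigma}$ is the trace of $h^{\check\Sigma}$ with respect to the metric induced by $\check g$. "$N|\check E_N|$ is bounded uniformly locally on $\check\Sigma$, independently of $N$" means: there is $N_0>0$ such that for every compact $K\subset M^n\times(0,T]$ there is a constant $C$, not depending on $N$, with $N|\check E_N|\le C$ on $K$ for all $N\ge N_0$ (functions on $\check\Sigma$ being regarded as functions on $M^n\times(0,T]$). *)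

theory Defs
  imports "HOL-Analysis.Analysis"
begin

section \<open>Smooth maps\<close>

text \<open>The sets \<open>S\<close> used below are either open or relatively open in \<open>E \<times> {0<..T}\<close>. On such sets
  the derivative within \<open>S\<close> is unique; at points with \<open>t = T\<close> it is one-sided in \<open>t\<close>, so that
  smoothness there means smoothness up to the boundary.\<close>

fun Ck_on :: "nat \<Rightarrow> 'a::euclidean_space set \<Rightarrow> ('a \<Rightarrow> 'b::real_normed_vector) \<Rightarrow> bool" where
  "Ck_on 0 S f \<longleftrightarrow> continuous_on S f"
| "Ck_on (Suc k) S f \<longleftrightarrow>
     f differentiable_on S \<and> (\<forall>v. Ck_on k S (\<lambda>x. frechet_derivative f (at x within S) v))"

definition smooth_on :: "'a::euclidean_space set \<Rightarrow> ('a \<Rightarrow> 'b::real_normed_vector) \<Rightarrow> bool" where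
  "smooth_on S f \<longleftrightarrow> (\<forall>k. Ck_on k S f)"

section \<open>Smooth manifolds\<close>

text \<open>A chart is a domain together with a coordinate map; only the values of the coordinate map on
  the domain matter. The dimension of a manifold is \<open>DIM('e)\<close>. An atlas need not be maximal.\<close>

type_synonym ('p, 'e) chart = "'p set \<times> ('p \<Rightarrow> 'e)"

definition chart_dom :: "('p, 'e) chart \<Rightarrow> 'p set" where
  "chart_dom c = fst c"

definition chart_map :: "('p, 'e) chart \<Rightarrow> 'p \<Rightarrow> 'e" where
  "chart_map c = snd c"

definition chart_img :: "('p, 'e) chart \<Rightarrow> 'e set" where
  "chart_img c = chart_map c ` chart_dom c"

definition chart_inv :: "('p, 'e) chart \<Rightarrow> 'e \<Rightarrow> 'p" where
  "chart_inv c = inv_into (chart_dom c) (chart_map c)"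

definition transition :: "('p, 'e) chart \<Rightarrow> ('p, 'e) chart \<Rightarrow> 'e \<Rightarrow> 'e" where
  "transition c c' = chart_map c' \<circ> chart_inv c"

definition overlap :: "('p, 'e) chart \<Rightarrow> ('p, 'e) chart \<Rightarrow> 'e set" where
  "overlap c c' = chart_map c ` (chart_dom c \<inter> chart_dom c')"

definition smooth_manifold :: "'p topology \<Rightarrow> ('p, 'e::euclidean_space) chart set \<Rightarrow> bool" where
  "smooth_manifold X \<A> \<longleftrightarrow>
     Hausdorff_space X \<and> second_countable X \<and>
     (\<Union>c\<in>\<A>. chart_dom c) = topspace X \<and>
     (\<forall>c\<in>\<A>. openin X (chart_dom c) \<and> open (chart_img c) \<and>
        homeomorphic_map (subtopology X (chart_dom c)) (top_of_set (chart_img c)) (chart_map c)) \<and>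
     (\<forall>c\<in>\<A>. \<forall>c'\<in>\<A>. smooth_on (overlap c c') (transition c c'))"

section \<open>Riemannian geometry in a coordinate domain\<close>

text \<open>A metric in a coordinate domain \<open>D\<close> is a map \<open>G\<close> with \<open>G x u v\<close> the value of the metric at
  \<open>x \<in> D\<close> on the vectors with components \<open>u\<close>, \<open>v\<close>.\<close>

definition inner_product :: "('a::real_vector \<Rightarrow> 'a \<Rightarrow> real) \<Rightarrow> bool" where
  "inner_product B \<longleftrightarrow> bilinear B \<and> (\<forall>u v. B u v = B v u) \<and> (\<forall>u. u \<noteq> 0 \<longrightarrow> B u u > 0)"

text \<open>The vector dual to the linear form \<open>l\<close>, and the trace of a bilinear form \<open>h\<close>, with respect
  to the inner product \<open>B\<close>; the latter is the trace of the endomorphism \<open>b \<mapsto> riesz B (h b)\<close>.\<close>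

definition riesz :: "('a \<Rightarrow> 'a \<Rightarrow> real) \<Rightarrow> ('a \<Rightarrow> real) \<Rightarrow> 'a" where
  "riesz B l = (THE w. \<forall>z. B w z = l z)"

definition metric_trace ::
  "('a::euclidean_space \<Rightarrow> 'a \<Rightarrow> real) \<Rightarrow> ('a \<Rightarrow> 'a \<Rightarrow> real) \<Rightarrow> real" where
  "metric_trace B h = (\<Sum>b\<in>Basis. riesz B (h b) \<bullet> b)"

text \<open>The Christoffel symbols: \<open>christoffel D G x u v\<close> is the Levi-Civita covariant derivative at
  \<open>x\<close>, in direction \<open>u\<close>, of the vector field with constant components \<open>v\<close> (Koszul formula).\<close>

definition christoffel ::
  "'a::euclidean_space set \<Rightarrow> ('a \<Rightarrow> 'a \<Rightarrow> 'a \<Rightarrow> real) \<Rightarrow> 'a \<Rightarrow> 'a \<Rightarrow> 'a \<Rightarrow> 'a" where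
  "christoffel D G x u v = riesz (G x) (\<lambda>z.
     (frechet_derivative (\<lambda>y. G y v z) (at x within D) u
      + frechet_derivative (\<lambda>y. G y u z) (at x within D) v
      - frechet_derivative (\<lambda>y. G y u v) (at x within D) z) / 2)"

text \<open>Sign: \<open>R(u,v)w = \<nabla>\<^sub>u\<nabla>\<^sub>v w - \<nabla>\<^sub>v\<nabla>\<^sub>u w\<close> for fields with constant components, and the Ricci tensor is
  the trace over \<open>u\<close>, hence positive on round spheres.\<close>

definition riemann ::
  "'a::euclidean_space set \<Rightarrow> ('a \<Rightarrow> 'a \<Rightarrow> 'a \<Rightarrow> real) \<Rightarrow> 'a \<Rightarrow> 'a \<Rightarrow> 'a \<Rightarrow> 'a \<Rightarrow> 'a" where
  "riemann D G x u v w =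
     frechet_derivative (\<lambda>y. christoffel D G y v w) (at x within D) u
     + christoffel D G x u (christoffel D G x v w)
     - frechet_derivative (\<lambda>y. christoffel D G y u w) (at x within D) v
     - christoffel D G x v (christoffel D G x u w)"

definition ricci ::
  "'a::euclidean_space set \<Rightarrow> ('a \<Rightarrow> 'a \<Rightarrow> 'a \<Rightarrow> real) \<Rightarrow> 'a \<Rightarrow> 'a \<Rightarrow> 'a \<Rightarrow> real" where
  "ricci D G x v w = (\<Sum>b\<in>Basis. riemann D G x b v w \<bullet> b)"

definition scalar_curvature ::
  "'a::euclidean_space set \<Rightarrow> ('a \<Rightarrow> 'a \<Rightarrow> 'a \<Rightarrow> real) \<Rightarrow> 'a \<Rightarrow> real" where
  "scalar_curvature D G x = metric_trace (G x) (ricci D G x)"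

text \<open>Hypersurface geometry of an immersion \<open>f\<close>, defined on \<open>S\<close>, into \<open>(D, G)\<close>, at \<open>x \<in> S\<close>, with
  unit normal \<open>n\<close> at \<open>f x\<close>. \<open>cov_deriv_along\<close> is the covariant derivative in direction \<open>u\<close> of the
  vector field \<open>df(v)\<close> along \<open>f\<close>.\<close>

definition cov_deriv_along ::
  "'b::euclidean_space set \<Rightarrow> ('b \<Rightarrow> 'b \<Rightarrow> 'b \<Rightarrow> real) \<Rightarrow> 'a::euclidean_space set \<Rightarrow> ('a \<Rightarrow> 'b)
     \<Rightarrow> 'a \<Rightarrow> 'a \<Rightarrow> 'a \<Rightarrow> 'b" where
  "cov_deriv_along D G S f x u v =
     frechet_derivative (\<lambda>y. frechet_derivative f (at y within S) v) (at x within S) u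
     + christoffel D G (f x) (frechet_derivative f (at x within S) u)
                             (frechet_derivative f (at x within S) v)"

definition induced_metric ::
  "('b \<Rightarrow> 'b \<Rightarrow> 'b \<Rightarrow> real) \<Rightarrow> 'a::euclidean_space set \<Rightarrow> ('a \<Rightarrow> 'b::euclidean_space)
     \<Rightarrow> 'a \<Rightarrow> 'a \<Rightarrow> 'a \<Rightarrow> real" where
  "induced_metric G S f x u v =
     G (f x) (frechet_derivative f (at x within S) u) (frechet_derivative f (at x within S) v)"

definition second_fundamental_form ::
  "'b::euclidean_space set \<Rightarrow> ('b \<Rightarrow> 'b \<Rightarrow> 'b \<Rightarrow> real) \<Rightarrow> 'a::euclidean_space set \<Rightarrow> ('a \<Rightarrow> 'b)
     \<Rightarrow> 'b \<Rightarrow> 'a \<Rightarrow> 'a \<Rightarrow> 'a \<Rightarrow> real" where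
  "second_fundamental_form D G S f n x u v = - G (f x) (cov_deriv_along D G S f x u v) n"

definition mean_curvature ::
  "'b::euclidean_space set \<Rightarrow> ('b \<Rightarrow> 'b \<Rightarrow> 'b \<Rightarrow> real) \<Rightarrow> 'a::euclidean_space set \<Rightarrow> ('a \<Rightarrow> 'b)
     \<Rightarrow> 'b \<Rightarrow> 'a \<Rightarrow> real" where
  "mean_curvature D G S f n x =
     metric_trace (induced_metric G S f x) (second_fundamental_form D G S f n x)"

definition unit_normal_at ::
  "('b \<Rightarrow> 'b \<Rightarrow> 'b \<Rightarrow> real) \<Rightarrow> 'a::euclidean_space set \<Rightarrow> ('a \<Rightarrow> 'b::euclidean_space)
     \<Rightarrow> 'a \<Rightarrow> 'b \<Rightarrow> bool" where
  "unit_normal_at G S f x n \<longleftrightarrow>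
     G (f x) n n = 1 \<and> (\<forall>u. G (f x) (frechet_derivative f (at x within S) u) n = 0)"

section \<open>Families of metrics, immersions and normals on manifolds\<close>

text \<open>Tensors are given by their components in the charts of the atlas, subject to the
  transformation law. For a family of metrics, \<open>g c t y u v\<close> is the value of \<open>g(t)\<close>, at the point
  with coordinates \<open>y\<close> in the chart \<open>c\<close>, on the vectors with components \<open>u\<close>, \<open>v\<close> in that chart.\<close>

type_synonym ('q, 'e) metric_family = "('q, 'e) chart \<Rightarrow> real \<Rightarrow> 'e \<Rightarrow> 'e \<Rightarrow> 'e \<Rightarrow> real"

definition smooth_metric_family ::
  "('q, 'e::euclidean_space) chart set \<Rightarrow> real \<Rightarrow> ('q, 'e) metric_family \<Rightarrow> bool" where
  "smooth_metric_family \<B> T g \<longleftrightarrow>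
     (\<forall>c\<in>\<B>. \<forall>t\<in>{0<..T}. \<forall>y\<in>chart_img c. inner_product (g c t y)) \<and>
     (\<forall>c\<in>\<B>. \<forall>u v. smooth_on (chart_img c \<times> {0<..T}) (\<lambda>(y, t). g c t y u v)) \<and>
     (\<forall>c\<in>\<B>. \<forall>c'\<in>\<B>. \<forall>t\<in>{0<..T}. \<forall>y\<in>overlap c c'. \<forall>u v.
        g c t y u v =
        g c' t (transition c c' y)
          (frechet_derivative (transition c c') (at y) u)
          (frechet_derivative (transition c c') (at y) v))"

definition ricci_flow ::
  "('q, 'e::euclidean_space) chart set \<Rightarrow> real \<Rightarrow> ('q, 'e) metric_family \<Rightarrow> bool" where
  "ricci_flow \<B> T g \<longleftrightarrow>
     (\<forall>c\<in>\<B>. \<forall>t\<in>{0<..T}. \<forall>y\<in>chart_img c. \<forall>u v.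
        ((\<lambda>s. g c s y u v) has_real_derivative - 2 * ricci (chart_img c) (g c t) y u v)
          (at t within {0<..T}))"

text \<open>The norms of the Riemann tensor, and below of the second fundamental form, are their norms as
  multilinear forms; up to constants depending on the dimension these are the usual tensor norms.\<close>

definition uniformly_bounded_curvature ::
  "('q, 'e::euclidean_space) chart set \<Rightarrow> real \<Rightarrow> ('q, 'e) metric_family \<Rightarrow> bool" where
  "uniformly_bounded_curvature \<B> T g \<longleftrightarrow>
     (\<exists>C. \<forall>c\<in>\<B>. \<forall>t\<in>{0<..T}. \<forall>y\<in>chart_img c. \<forall>u v w z.
        \<bar>g c t y (riemann (chart_img c) (g c t) y u v w) z\<bar>
        \<le> C * sqrt (g c t y u u) * sqrt (g c t y v v) * sqrt (g c t y w w) * sqrt (g c t y z z))"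

definition slice_dom ::
  "('p, 'd) chart \<Rightarrow> ('q, 'e) chart \<Rightarrow> ('p \<Rightarrow> 'q) \<Rightarrow> 'd set" where
  "slice_dom a c \<phi> = {\<xi>\<in>chart_img a. \<phi> (chart_inv a \<xi>) \<in> chart_dom c}"

definition slice_rep ::
  "('p, 'd) chart \<Rightarrow> ('q, 'e) chart \<Rightarrow> ('p \<Rightarrow> 'q) \<Rightarrow> 'd \<Rightarrow> 'e" where
  "slice_rep a c \<phi> \<xi> = chart_map c (\<phi> (chart_inv a \<xi>))"

definition track_dom ::
  "real \<Rightarrow> ('p, 'd) chart \<Rightarrow> ('q, 'e) chart \<Rightarrow> (real \<Rightarrow> 'p \<Rightarrow> 'q) \<Rightarrow> ('d \<times> real) set" where
  "track_dom T a c F = {(\<xi>, t). t \<in> {0<..T} \<and> \<xi> \<in> slice_dom a c (F t)}"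

definition track_rep ::
  "('p, 'd) chart \<Rightarrow> ('q, 'e) chart \<Rightarrow> (real \<Rightarrow> 'p \<Rightarrow> 'q) \<Rightarrow> 'd \<times> real \<Rightarrow> 'e \<times> real" where
  "track_rep a c F = (\<lambda>(\<xi>, t). (slice_rep a c (F t) \<xi>, t))"

definition smooth_immersion_family ::
  "'p topology \<Rightarrow> ('p, 'd::euclidean_space) chart set \<Rightarrow>
   'q topology \<Rightarrow> ('q, 'e::euclidean_space) chart set \<Rightarrow> real \<Rightarrow> (real \<Rightarrow> 'p \<Rightarrow> 'q) \<Rightarrow> bool" where
  "smooth_immersion_family X \<A> Y \<B> T F \<longleftrightarrow>
     continuous_map (prod_topology X (top_of_set {0<..T})) Y (\<lambda>(x, t). F t x) \<and>
     (\<forall>a\<in>\<A>. \<forall>c\<in>\<B>. smooth_on (track_dom T a c F) (\<lambda>(\<xi>, t). slice_rep a c (F t) \<xi>)) \<and>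
     (\<forall>a\<in>\<A>. \<forall>c\<in>\<B>. \<forall>t\<in>{0<..T}. \<forall>\<xi>\<in>slice_dom a c (F t).
        inj (frechet_derivative (slice_rep a c (F t)) (at \<xi>)))"

text \<open>\<open>\<nu> c t x\<close> are the components, in the chart \<open>c\<close> of the ambient manifold, of a vector
  attached to the point \<open>F t x\<close>.\<close>

type_synonym ('p, 'q, 'e) vector_family = "('q, 'e) chart \<Rightarrow> real \<Rightarrow> 'p \<Rightarrow> 'e"

definition smooth_unit_normal_family ::
  "('p, 'd::euclidean_space) chart set \<Rightarrow> ('q, 'e::euclidean_space) chart set \<Rightarrow> real \<Rightarrow>
   ('q, 'e) metric_family \<Rightarrow> (real \<Rightarrow> 'p \<Rightarrow> 'q) \<Rightarrow> ('p, 'q, 'e) vector_family \<Rightarrow> bool" where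
  "smooth_unit_normal_family \<A> \<B> T g F \<nu> \<longleftrightarrow>
     (\<forall>a\<in>\<A>. \<forall>c\<in>\<B>. \<forall>t\<in>{0<..T}. \<forall>\<xi>\<in>slice_dom a c (F t).
        unit_normal_at (g c t) (slice_dom a c (F t)) (slice_rep a c (F t)) \<xi>
          (\<nu> c t (chart_inv a \<xi>))) \<and>
     (\<forall>a\<in>\<A>. \<forall>c\<in>\<B>. smooth_on (track_dom T a c F) (\<lambda>(\<xi>, t). \<nu> c t (chart_inv a \<xi>))) \<and>
     (\<forall>a\<in>\<A>. \<forall>c\<in>\<B>. \<forall>c'\<in>\<B>. \<forall>t\<in>{0<..T}. \<forall>x\<in>chart_dom a.
        F t x \<in> chart_dom c \<inter> chart_dom c' \<longrightarrow>
        \<nu> c' t x = frechet_derivative (transition c c') (at (chart_map c (F t x))) (\<nu> c t x))"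

definition uniformly_bounded_second_fundamental_form ::
  "('p, 'd::euclidean_space) chart set \<Rightarrow> ('q, 'e::euclidean_space) chart set \<Rightarrow> real \<Rightarrow>
   ('q, 'e) metric_family \<Rightarrow> (real \<Rightarrow> 'p \<Rightarrow> 'q) \<Rightarrow> ('p, 'q, 'e) vector_family \<Rightarrow> bool" where
  "uniformly_bounded_second_fundamental_form \<A> \<B> T g F \<nu> \<longleftrightarrow>
     (\<exists>C. \<forall>a\<in>\<A>. \<forall>c\<in>\<B>. \<forall>t\<in>{0<..T}. \<forall>\<xi>\<in>slice_dom a c (F t). \<forall>u v.
        \<bar>second_fundamental_form (chart_img c) (g c t) (slice_dom a c (F t)) (slice_rep a c (F t))
           (\<nu> c t (chart_inv a \<xi>)) \<xi> u v\<bar>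
        \<le> C * sqrt (induced_metric (g c t) (slice_dom a c (F t)) (slice_rep a c (F t)) \<xi> u u)
            * sqrt (induced_metric (g c t) (slice_dom a c (F t)) (slice_rep a c (F t)) \<xi> v v))"

definition mean_curvature_flow ::
  "('p, 'd::euclidean_space) chart set \<Rightarrow> ('q, 'e::euclidean_space) chart set \<Rightarrow> real \<Rightarrow>
   ('q, 'e) metric_family \<Rightarrow> (real \<Rightarrow> 'p \<Rightarrow> 'q) \<Rightarrow> ('p, 'q, 'e) vector_family \<Rightarrow> bool" where
  "mean_curvature_flow \<A> \<B> T g F \<nu> \<longleftrightarrow>
     (\<forall>a\<in>\<A>. \<forall>c\<in>\<B>. \<forall>t\<in>{0<..T}. \<forall>\<xi>\<in>slice_dom a c (F t).
        ((\<lambda>s. slice_rep a c (F s) \<xi>) has_vector_derivative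
           - mean_curvature (chart_img c) (g c t) (slice_dom a c (F t)) (slice_rep a c (F t))
               (\<nu> c t (chart_inv a \<xi>)) \<xi> *\<^sub>R \<nu> c t (chart_inv a \<xi>))
          (at t within {0<..T}))"

section \<open>The space-time metric and the space-time track\<close>

text \<open>Everything is expressed in the charts \<open>c \<times> id\<close> of \<open>O \<times> (0,T]\<close> and \<open>a \<times> id\<close> of
  \<open>M \<times> (0,T]\<close>.\<close>

definition spacetime_dom :: "real \<Rightarrow> ('q, 'e) chart \<Rightarrow> ('e \<times> real) set" where
  "spacetime_dom T c = chart_img c \<times> {0<..T}"

definition spacetime_metric ::
  "('q, 'e::euclidean_space) metric_family \<Rightarrow> real \<Rightarrow> ('q, 'e) chart
     \<Rightarrow> 'e \<times> real \<Rightarrow> 'e \<times> real \<Rightarrow> 'e \<times> real \<Rightarrow> real" where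
  "spacetime_metric g N c = (\<lambda>(y, t) (u, \<alpha>) (v, \<beta>).
     g c t y u v / t
     + (N / (2 * t^3) + scalar_curvature (chart_img c) (g c t) y / t + DIM('e) / (2 * t^2))
         * (\<alpha> * \<beta>))"

definition spacetime_potential :: "real \<Rightarrow> 'e \<times> real \<Rightarrow> real" where
  "spacetime_potential N = (\<lambda>(y, t). - N / (2 * t))"

text \<open>The unit normal of the track on the same side as \<open>\<nu>\<close>, the latter regarded as the space-time
  vector \<open>(\<nu>, 0)\<close>.\<close>

definition track_normal ::
  "real \<Rightarrow> ('q, 'e::euclidean_space) metric_family \<Rightarrow> (real \<Rightarrow> 'p \<Rightarrow> 'q) \<Rightarrow>
   ('p, 'q, 'e) vector_family \<Rightarrow> real \<Rightarrow>
   ('p, 'd::euclidean_space) chart \<Rightarrow> ('q, 'e) chart \<Rightarrow> 'd \<times> real \<Rightarrow> 'e \<times> real" where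
  "track_normal T g F \<nu> N a c = (\<lambda>(\<xi>, t). THE n.
     unit_normal_at (spacetime_metric g N c) (track_dom T a c F) (track_rep a c F) (\<xi>, t) n \<and>
     spacetime_metric g N c (track_rep a c F (\<xi>, t)) n (\<nu> c t (chart_inv a \<xi>), 0) > 0)"

definition soliton_defect ::
  "real \<Rightarrow> ('q, 'e::euclidean_space) metric_family \<Rightarrow> (real \<Rightarrow> 'p \<Rightarrow> 'q) \<Rightarrow>
   ('p, 'q, 'e) vector_family \<Rightarrow> real \<Rightarrow>
   ('p, 'd::euclidean_space) chart \<Rightarrow> ('q, 'e) chart \<Rightarrow> 'd \<times> real \<Rightarrow> real" where
  "soliton_defect T g F \<nu> N a c p =
     (let n = track_normal T g F \<nu> N a c p in
        mean_curvature (spacetime_dom T c) (spacetime_metric g N c)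
          (track_dom T a c F) (track_rep a c F) n p
        - frechet_derivative (spacetime_potential N)
            (at (track_rep a c F p) within spacetime_dom T c) n)"

end

theory Submission
  imports Defs
begin

text \<open>
  Write \<open>m = n + 1\<close>, \<open>\<phi> = N/(2t\<^sup>3) + R/t + m/(2t\<^sup>2)\<close> and \<open>K = Ric(\<nu>, \<nu>)\<close>. The unit normal of the track is \<open>(a\<nu>, b)\<close> with
  \<open>b = aH/(t\<phi>)\<close>, and the tangent space of the track is the orthogonal sum of the tangent space of \<open>M\<^sub>t\<close>
  and the line spanned by \<open>(-H\<nu>, 1)\<close>, whose squared length is \<open>\<psi> = \<phi> + H\<^sup>2/t\<close>. The spatial part of the
  mean curvature of the track is \<open>aH - b(R - K) - bn/(2t)\<close>: the Ricci flow equation turns the time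
  derivative of the metric into the Ricci tensor, whose trace over \<open>M\<^sub>t\<close> is \<open>R - K\<close>. The derivative of the
  potential in direction of the normal is \<open>bN/(2t\<^sup>2)\<close>, which by the choice of \<open>\<phi>\<close> equals \<open>aH - b(R + m/(2t))\<close>.
  Hence the leading terms cancel and the defect is \<open>b(K + 1/(2t)) + h\<^sub>t\<^sub>t/\<psi>\<close>, where \<open>b\<close> and \<open>1/\<psi>\<close> are of order
  \<open>1/N\<close> and all other quantities are locally bounded.

  For a constant that works in all charts simultaneously, \<open>Ric = -\<partial>\<^sub>tg/2\<close>, \<open>R\<close>, and \<open>H = -g(\<partial>\<^sub>tF, \<nu>)\<close> are read off
  from the flow equations; in this form they are invariant under coordinate changes because \<open>g\<close>, \<open>\<nu>\<close>
  and \<open>\<partial>\<^sub>tF\<close> are, and no transformation law for curvature is needed.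
\<close>

section \<open>Traces with respect to an inner product\<close>

text \<open>The delicate term is the second fundamental form in the time direction: it contains the
  time derivative of \<phi>, which grows like \<open>N\<close>. That derivative occurs only with the
  factor \<open>b\<close>, so after division by \<psi> and multiplication by \<open>N\<close> it is
  a product of the bounded quantities \<open>N b\<close> and (time derivative of \<phi>) / \<psi>.
  The normal acceleration of \<open>F\<close> and the derivative \<open>X\<close> of the metric
  along \<nu> depend on the chart. Expressing the acceleration by the time derivative of
  \<open>H\<close> and by \<open>H\<close>, \<open>K\<close> and \<open>X\<close> makes
  \<open>X\<close> cancel, and what is left is invariant: \<open>H\<close>, its time derivative,
  \<open>K\<close>, \<open>R\<close> and the derivatives of \<open>R\<close> along \<nu> and
  \<open>t\<close>. Continuity in one pair of charts then bounds the defect in all pairs. The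
  curvature bound acts elsewhere: it makes \<open>N\<^sub>0\<close> global, by forcing \<phi> to be
  at least \<open>N / (4 * t ^ 3)\<close> everywhere. Since \<open>R\<close> is the trace of a time
  derivative of the metric, its C^1 regularity reduces to differentiating the solution
  \<open>w\<close> of \<open>G y w z = l y z\<close> in the parameter \<open>y\<close>.\<close>

lemma inner_product_bilinear: "inner_product B \<Longrightarrow> bilinear B"
  and inner_product_commute: "inner_product B \<Longrightarrow> B u v = B v u"
  and inner_product_pos: "inner_product B \<Longrightarrow> u \<noteq> 0 \<Longrightarrow> B u u > 0"
  by (auto simp: inner_product_def)

lemma inner_product_nonneg: "inner_product B \<Longrightarrow> 0 \<le> B u u"
  by (cases "u = 0") (auto simp: inner_product_def bilinear_lzero intro: less_imp_le)

lemma inner_product_eqI: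
  assumes "inner_product B" "\<And>z. B v z = B w z"
  shows "v = w"
proof (rule ccontr)
  assume "v \<noteq> w"
  then have "B (v - w) (v - w) > 0"
    using assms(1) by (simp add: inner_product_def)
  then show False
    using assms by (simp add: bilinear_lsub inner_product_bilinear)
qed

lemmas bilinear_simps = bilinear_ladd bilinear_radd bilinear_lmul bilinear_rmul bilinear_lneg
  bilinear_rneg bilinear_lzero bilinear_rzero bilinear_lsub bilinear_rsub

lemma bilinear_linear_left: "bilinear B \<Longrightarrow> linear (\<lambda>u. B u v)"
  and bilinear_linear_right: "bilinear B \<Longrightarrow> linear (B u)"
  by (auto simp: bilinear_def)

lemma riesz_eqI:
  assumes "inner_product B" "\<And>z. B w z = l z"
  shows "riesz B l = w"
  unfolding riesz_def using assms by (intro the_equality) (auto intro!: inner_product_eqI[of B])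

text \<open>\<open>riesz\<close> is a definite description, so existence has to be supplied:
  definiteness of \<open>B\<close> makes \<Phi> injective, and an injective linear endomorphism in
  finite dimension is onto.\<close>

lemma riesz_works:
  fixes B :: "'a::euclidean_space \<Rightarrow> 'a \<Rightarrow> real"
  assumes B: "inner_product B" and l: "linear l"
  shows "B (riesz B l) z = l z"
proof -
  define \<Phi> where "\<Phi> w = (\<Sum>b\<in>Basis. B w b *\<^sub>R b)" for w
  have bil: "bilinear B" using B by (rule inner_product_bilinear)
  have exp: "h z = (\<Sum>b\<in>Basis. (z \<bullet> b) * h b)" if "linear h" for h :: "'a \<Rightarrow> real" and z
  proof -
    have "h z = h (\<Sum>b\<in>Basis. (z \<bullet> b) *\<^sub>R b)" by (simp add: euclidean_representation)
    then show "h z = (\<Sum>b\<in>Basis. (z \<bullet> b) * h b)"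
      by (simp add: linear_sum[OF that] linear_cmul[OF that])
  qed
  have lin: "linear \<Phi>"
    unfolding \<Phi>_def by (auto intro!: linearI simp: bilinear_simps[OF bil] algebra_simps sum.distrib scaleR_sum_right)
  have Beq: "B w = B w'" if "\<Phi> w = \<Phi> w'" for w w'
  proof -
    have "B w b = B w' b" if "b \<in> Basis" for b
    proof -
      have "\<Phi> w \<bullet> b = \<Phi> w' \<bullet> b" using \<open>\<Phi> w = \<Phi> w'\<close> by simp
      then show ?thesis using that by (simp add: \<Phi>_def)
    qed
    then have "(\<Sum>b\<in>Basis. (z \<bullet> b) * B w b) = (\<Sum>b\<in>Basis. (z \<bullet> b) * B w' b)" for z by simp
    then have "B w z = B w' z" for z
      unfolding exp[OF bilinear_linear_right[OF bil, of w], of z]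
        exp[OF bilinear_linear_right[OF bil, of w'], of z] .
    then show ?thesis ..
  qed
  have "inj \<Phi>"
  proof (rule injI)
    fix w w' assume "\<Phi> w = \<Phi> w'"
    then have "B w = B w'" by (rule Beq)
    then show "w = w'" using inner_product_eqI[OF B, of w w'] by simp
  qed
  with lin have "surj \<Phi>" by (simp add: linear_injective_imp_surjective)
  then obtain w where w: "\<Phi> w = (\<Sum>b\<in>Basis. l b *\<^sub>R b)" by (metis surjD)
  have wb: "B w b = l b" if "b \<in> Basis" for b
  proof -
    have "\<Phi> w \<bullet> b = (\<Sum>b\<in>Basis. l b *\<^sub>R b) \<bullet> b" using w by simp
    then show ?thesis using that by (simp add: \<Phi>_def)
  qed
  have Bw: "B w z = l z" for z
  proof -
    have "B w z = (\<Sum>b\<in>Basis. (z \<bullet> b) * B w b)" by (rule exp[OF bilinear_linear_right[OF bil]])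
    also have "\<dots> = (\<Sum>b\<in>Basis. (z \<bullet> b) * l b)"
      using wb by simp
    also have "\<dots> = l z" by (rule exp[OF l, symmetric])
    finally show ?thesis .
  qed
  then have "riesz B l = w" by (rule riesz_eqI[OF B])
  then show ?thesis using Bw by simp
qed

lemma riesz_add:
  fixes B :: "'a::euclidean_space \<Rightarrow> 'a \<Rightarrow> real"
  assumes "inner_product B" "linear l" "linear l'"
  shows "riesz B (\<lambda>z. l z + l' z) = riesz B l + riesz B l'"
  by (rule riesz_eqI) (simp_all add: assms riesz_works bilinear_ladd inner_product_bilinear)

lemma riesz_scale:
  fixes B :: "'a::euclidean_space \<Rightarrow> 'a \<Rightarrow> real"
  assumes "inner_product B" "linear l"
  shows "riesz B (\<lambda>z. c * l z) = c *\<^sub>R riesz B l"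
  by (rule riesz_eqI) (simp_all add: assms riesz_works bilinear_lmul inner_product_bilinear)

lemma linear_riesz_bilinear:
  fixes B :: "'a::euclidean_space \<Rightarrow> 'a \<Rightarrow> real"
  assumes "inner_product B" "bilinear h"
  shows "linear (\<lambda>u. riesz B (h u))"
proof (rule linearI)
  have h: "linear (h u)" for u using assms(2) by (rule bilinear_linear_right)
  show "riesz B (h (u + v)) = riesz B (h u) + riesz B (h v)" for u v
    unfolding riesz_add[OF assms(1) h h, symmetric] bilinear_ladd[OF assms(2), symmetric] ..
  show "riesz B (h (c *\<^sub>R u)) = c *\<^sub>R riesz B (h u)" for c u
    unfolding riesz_scale[OF assms(1) h, symmetric] real_scaleR_def[symmetric]
      bilinear_lmul[OF assms(2), symmetric] ..
qed

lemma metric_trace_add: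
  fixes B :: "'a::euclidean_space \<Rightarrow> 'a \<Rightarrow> real"
  assumes "inner_product B" "bilinear h" "bilinear h'"
  shows "metric_trace B (\<lambda>u v. h u v + h' u v) = metric_trace B h + metric_trace B h'"
  unfolding metric_trace_def using assms
  by (simp add: riesz_add bilinear_linear_right inner_add_left sum.distrib)

lemma metric_trace_scale:
  fixes B :: "'a::euclidean_space \<Rightarrow> 'a \<Rightarrow> real"
  assumes "inner_product B" "bilinear h"
  shows "metric_trace B (\<lambda>u v. c * h u v) = c * metric_trace B h"
  unfolding metric_trace_def using assms
  by (simp add: riesz_scale bilinear_linear_right sum_distrib_left)

lemma metric_trace_self:
  fixes B :: "'a::euclidean_space \<Rightarrow> 'a \<Rightarrow> real"
  assumes "inner_product B"
  shows "metric_trace B B = DIM('a)"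
proof -
  have "riesz B (B b) = b" for b by (rule riesz_eqI[OF assms]) simp
  then show ?thesis by (simp add: metric_trace_def)
qed

section \<open>Traces of endomorphisms under pullback, restriction to a hyperplane and
  products\<close>

definition lin_trace :: "('a::euclidean_space \<Rightarrow> 'a) \<Rightarrow> real" where
  "lin_trace L = (\<Sum>b\<in>Basis. L b \<bullet> b)"

lemma metric_trace_eq_lin_trace: "metric_trace B h = lin_trace (\<lambda>b. riesz B (h b))"
  by (simp add: metric_trace_def lin_trace_def)

text \<open>Expansion in the two standard bases gives the same double sum. The two spaces may differ
  in dimension, which is how a trace is moved between a hypersurface and its ambient space.\<close>

lemma lin_trace_commute:
  fixes P :: "'a::euclidean_space \<Rightarrow> 'b::euclidean_space" and Q :: "'b \<Rightarrow> 'a"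
  assumes P: "linear P" and Q: "linear Q"
  shows "lin_trace (\<lambda>x. P (Q x)) = lin_trace (\<lambda>x. Q (P x))"
proof -
  have "P (Q b) \<bullet> b = (\<Sum>a\<in>Basis. (Q b \<bullet> a) * (P a \<bullet> b))" for b
  proof -
    have "P (Q b) = P (\<Sum>a\<in>Basis. (Q b \<bullet> a) *\<^sub>R a)" by (simp add: euclidean_representation)
    then show ?thesis by (simp add: linear_sum[OF P] linear_cmul[OF P] inner_sum_left)
  qed
  moreover have "Q (P a) \<bullet> a = (\<Sum>b\<in>Basis. (P a \<bullet> b) * (Q b \<bullet> a))" for a
  proof -
    have "Q (P a) = Q (\<Sum>b\<in>Basis. (P a \<bullet> b) *\<^sub>R b)" by (simp add: euclidean_representation)
    then show ?thesis by (simp add: linear_sum[OF Q] linear_cmul[OF Q] inner_sum_left)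
  qed
  ultimately show ?thesis
    unfolding lin_trace_def by (simp add: mult.commute) (rule sum.swap)
qed

lemma lin_trace_rank_one:
  "lin_trace (\<lambda>w. l w *\<^sub>R v) = l v" if "linear l" for l :: "'a::euclidean_space \<Rightarrow> real"
proof -
  have "l v = l (\<Sum>a\<in>Basis. (v \<bullet> a) *\<^sub>R a)" by (simp add: euclidean_representation)
  also have "\<dots> = (\<Sum>a\<in>Basis. (v \<bullet> a) * l a)"
    by (simp add: linear_sum[OF that] linear_cmul[OF that])
  finally show ?thesis by (simp add: lin_trace_def mult.commute)
qed

lemma bilinear_pullback:
  assumes B: "bilinear B" and A: "linear A"
  shows "bilinear (\<lambda>u v. B (A u) (A v))"
  using linear_compose[OF A bilinear_linear_right[OF B]] linear_compose[OF A bilinear_linear_left[OF B]]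
  by (simp add: bilinear_def o_def)

lemma inner_product_pullback:
  fixes B :: "'b::euclidean_space \<Rightarrow> 'b \<Rightarrow> real" and A :: "'a::euclidean_space \<Rightarrow> 'b"
  assumes B: "inner_product B" and A: "linear A" "inj A"
  shows "inner_product (\<lambda>u v. B (A u) (A v))"
  unfolding inner_product_def
proof (intro conjI allI impI)
  show "bilinear (\<lambda>u v. B (A u) (A v))"
    using inner_product_bilinear[OF B] A(1) by (rule bilinear_pullback)
  show "B (A u) (A v) = B (A v) (A u)" for u v using B by (rule inner_product_commute)
  show "B (A u) (A u) > 0" if "u \<noteq> 0" for u
  proof (rule inner_product_pos[OF B])
    show "A u \<noteq> 0" using that A linear_injective_0[OF A(1)] by blast
  qed
qed

text \<open>The endomorphism of the pulled-back pair is conjugate, through \<open>A\<close>, to that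
  of \<open>B\<close> and \<open>h\<close>, so cyclicity of the trace removes \<open>A\<close>. This
  gives the chart independence of the scalar curvature.\<close>

lemma metric_trace_pullback_iso:
  fixes B :: "'b::euclidean_space \<Rightarrow> 'b \<Rightarrow> real" and A :: "'a::euclidean_space \<Rightarrow> 'b"
  assumes B: "inner_product B" and h: "bilinear h" and A: "linear A" "bij A"
  shows "metric_trace (\<lambda>u v. B (A u) (A v)) (\<lambda>u v. h (A u) (A v)) = metric_trace B h"
proof -
  define C where "C = inv A"
  have C2: "C (A x) = x" "A (C y) = y" for x y
    unfolding C_def using A by (auto simp: bij_is_inj bij_is_surj surj_f_inv_f)
  have "linear C"
  proof (rule linearI)
    show "C (x + y) = C x + C y" for x y
      using C2(1)[of "C x + C y"] by (simp add: linear_add[OF A(1)] C2(2))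
    show "C (r *\<^sub>R x) = r *\<^sub>R C x" for r x
      using C2(1)[of "r *\<^sub>R C x"] by (simp add: linear_cmul[OF A(1)] C2(2))
  qed
  note C = this C2
  have S: "linear (\<lambda>u. riesz B (h u))" using B h by (rule linear_riesz_bilinear)
  have ip: "inner_product (\<lambda>u v. B (A u) (A v))"
    using B A(1) bij_is_inj[OF A(2)] by (rule inner_product_pullback)
  have "riesz (\<lambda>u v. B (A u) (A v)) (\<lambda>v. h (A u) (A v)) = C (riesz B (h (A u)))" for u
    by (rule riesz_eqI[OF ip]) (simp add: C riesz_works[OF B bilinear_linear_right[OF h]])
  then have "metric_trace (\<lambda>u v. B (A u) (A v)) (\<lambda>u v. h (A u) (A v))
      = lin_trace (\<lambda>u. C (riesz B (h (A u))))"
    by (simp add: metric_trace_eq_lin_trace)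
  also have "\<dots> = lin_trace (\<lambda>u. riesz B (h (A (C u))))"
    by (rule lin_trace_commute[OF C(1) linear_compose[OF A(1) S, unfolded o_def]])
  finally show ?thesis by (simp add: C metric_trace_eq_lin_trace)
qed

text \<open>The map \<Psi> is injective because pairing with \<nu> isolates \<open>s\<close>; by the
  dimension count it is onto, so what remains of \<open>w\<close> after removing its \<nu>-component
  is tangential.\<close>

lemma hyperplane_decomp:
  fixes B :: "'b::euclidean_space \<Rightarrow> 'b \<Rightarrow> real" and A :: "'a::euclidean_space \<Rightarrow> 'b"
  assumes B: "inner_product B" and A: "linear A" "inj A" and dim: "DIM('b) = DIM('a) + 1"
    and \<nu>: "B \<nu> \<nu> = 1" "\<And>u. B (A u) \<nu> = 0"
  obtains u where "w - B w \<nu> *\<^sub>R \<nu> = A u"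
proof -
  have bil: "bilinear B" using B by (rule inner_product_bilinear)
  define \<Psi> where "\<Psi> = (\<lambda>(u, s). A u + s *\<^sub>R \<nu>)"
  have "linear \<Psi>"
    unfolding \<Psi>_def by (auto intro!: linearI simp: linear_add[OF A(1)] linear_cmul[OF A(1)] algebra_simps)
  moreover have "inj \<Psi>"
  proof (rule linear_injective_0[THEN iffD2, OF \<open>linear \<Psi>\<close>, rule_format])
    fix p assume "\<Psi> p = 0"
    moreover obtain u s where p: "p = (u, s)" by force
    ultimately have *: "A u + s *\<^sub>R \<nu> = 0" by (simp add: \<Psi>_def)
    then have "B (A u + s *\<^sub>R \<nu>) \<nu> = 0" using bil by (simp add: bilinear_lzero)
    then have "s = 0" by (simp add: bilinear_simps[OF bil] \<nu>)
    with * A show "p = 0" by (simp add: p linear_injective_0 zero_prod_def)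
  qed
  ultimately have "\<exists>p. \<Psi> p = w"
  proof -
    have "dim (range \<Psi>) = dim (UNIV :: ('a \<times> real) set)"
      using \<open>linear \<Psi>\<close> \<open>inj \<Psi>\<close> by (metis dim_image_eq inj_on_subset subset_UNIV)
    then have "dim (range \<Psi>) = DIM('b)" using dim by simp
    then have "range \<Psi> = UNIV"
      using \<open>linear \<Psi>\<close> by (metis dim_eq_full linear_subspace_image span_eq_iff subspace_UNIV)
    then show ?thesis by (metis surjD)
  qed
  then obtain u s where w: "w = A u + s *\<^sub>R \<nu>" by (auto simp: \<Psi>_def)
  then have "B w \<nu> = s" by (simp add: bilinear_simps[OF bil] \<nu>)
  with w have "w - B w \<nu> *\<^sub>R \<nu> = A u" by simp
  then show ?thesis by (rule that)
qed

text \<open>\<open>A'\<close> is the metric adjoint of \<open>A\<close>, and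
  \<open>A \<circ> A'\<close> is the orthogonal projection onto the image of \<open>A\<close>. By
  cyclicity the trace of \<open>A' S A\<close> is that of \<open>S A A'\<close>, which is
  \<open>S\<close> minus a rank-one map of trace \<open>h \<nu> \<nu>\<close>.\<close>

lemma metric_trace_hypersurface:
  fixes B :: "'b::euclidean_space \<Rightarrow> 'b \<Rightarrow> real" and A :: "'a::euclidean_space \<Rightarrow> 'b"
  assumes B: "inner_product B" and h: "bilinear h"
    and A: "linear A" "inj A" and dim: "DIM('b) = DIM('a) + 1"
    and \<nu>: "B \<nu> \<nu> = 1" "\<And>u. B (A u) \<nu> = 0"
  shows "metric_trace (\<lambda>u v. B (A u) (A v)) (\<lambda>u v. h (A u) (A v)) = metric_trace B h - h \<nu> \<nu>"
proof -
  have bil: "bilinear B" using B by (rule inner_product_bilinear)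
  have ip: "inner_product (\<lambda>u v. B (A u) (A v))" using B A by (rule inner_product_pullback)
  define A' where "A' w = riesz (\<lambda>u v. B (A u) (A v)) (\<lambda>u. B w (A u))" for w
  have linB: "linear (\<lambda>u. B w (A u))" for w
    using linear_compose[OF A(1) bilinear_linear_right[OF bil]] by (simp add: o_def)
  have A': "B (A (A' w)) (A u) = B w (A u)" for w u
    unfolding A'_def using riesz_works[OF ip linB] by simp
  have AA': "A (A' w) = w - B w \<nu> *\<^sub>R \<nu>" for w
  proof -
    obtain u where u: "w - B w \<nu> *\<^sub>R \<nu> = A u" using hyperplane_decomp[OF B A dim \<nu>] .
    have "B (A u) (A v) = B w (A v)" for v
      unfolding u[symmetric] using \<nu>(2)[of v] inner_product_commute[OF B, of \<nu>]
      by (simp add: bilinear_simps[OF bil])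
    then have "A' w = u" unfolding A'_def by (intro riesz_eqI[OF ip])
    then show ?thesis using u by simp
  qed
  have linA': "linear A'"
    unfolding A'_def using riesz_add[OF ip linB linB] riesz_scale[OF ip linB]
    by (intro linearI) (simp_all add: bilinear_simps[OF bil])
  define S where "S w = riesz B (h w)" for w
  have S: "linear S" unfolding S_def using B h by (rule linear_riesz_bilinear)
  have BS: "B (S w) z = h w z" for w z
    unfolding S_def using riesz_works[OF B bilinear_linear_right[OF h]] .
  have "riesz (\<lambda>u v. B (A u) (A v)) (\<lambda>v. h (A u) (A v)) = A' (S (A u))" for u
    by (rule riesz_eqI[OF ip]) (simp add: A' BS)
  then have "metric_trace (\<lambda>u v. B (A u) (A v)) (\<lambda>u v. h (A u) (A v)) = lin_trace (\<lambda>u. A' (S (A u)))"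
    by (simp add: metric_trace_eq_lin_trace)
  also have "\<dots> = lin_trace (\<lambda>w. S (A (A' w)))"
    by (rule lin_trace_commute[OF linA' linear_compose[OF A(1) S, unfolded o_def]])
  also have "\<dots> = lin_trace S - lin_trace (\<lambda>w. B w \<nu> *\<^sub>R S \<nu>)"
    by (simp add: AA' linear_diff[OF S] linear_cmul[OF S] lin_trace_def inner_diff_left sum_subtractf)
  also have "lin_trace (\<lambda>w. B w \<nu> *\<^sub>R S \<nu>) = h \<nu> \<nu>"
    by (subst lin_trace_rank_one) (use bil BS in \<open>auto simp: bilinear_def\<close>)
  finally show ?thesis by (simp add: S_def metric_trace_eq_lin_trace)
qed

text \<open>The two factors are orthogonal, so the off-diagonal blocks of \<open>h\<close> do not
  enter the trace; dividing \<open>B\<close> by \<open>t\<close> multiplies its trace by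
  \<open>t\<close>.\<close>

lemma metric_trace_product:
  fixes B :: "'a::euclidean_space \<Rightarrow> 'a \<Rightarrow> real" and h :: "'a \<times> real \<Rightarrow> 'a \<times> real \<Rightarrow> real"
  assumes B: "inner_product B" and h: "bilinear h" and "t > 0" "\<psi> > 0"
  shows "metric_trace (\<lambda>(u, \<alpha>) (v, \<beta>). B u v / t + \<psi> * (\<alpha> * \<beta>)) h
    = t * metric_trace B (\<lambda>u v. h (u, 0) (v, 0)) + h (0, 1) (0, 1) / \<psi>"
proof -
  have bil: "bilinear B" using B by (rule inner_product_bilinear)
  let ?B = "\<lambda>(u, \<alpha>) (v, \<beta>). B u v / t + \<psi> * (\<alpha> * \<beta>)"
  have ip: "inner_product ?B"
    unfolding inner_product_def
  proof (intro conjI allI impI)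
    show "bilinear ?B"
      unfolding bilinear_def
      by (auto intro!: linearI simp: bilinear_simps[OF bil] algebra_simps add_divide_distrib)
    show "?B p q = ?B q p" for p q
      using inner_product_commute[OF B, of "fst p" "fst q"] by (simp add: split_beta mult.commute)
    show "?B p p > 0" if "p \<noteq> 0" for p
      using that inner_product_pos[OF B, of "fst p"] inner_product_nonneg[OF B, of "fst p"] assms
      by (cases "fst p = 0")
        (auto simp: split_beta prod_eq_iff bilinear_simps[OF bil] zero_less_mult_iff intro!: add_pos_nonneg)
  qed
  have lin: "linear (\<lambda>v. h p (v, 0))" for p
    by (intro linearI) (use bilinear_radd[OF h, of p "(_, 0)" "(_, 0)"] bilinear_rmul[OF h, of p _ "(_, 0)"] in auto)
  have split: "h p (v, \<beta>) = h p (v, 0) + \<beta> * h p (0, 1)" for p v \<beta>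
    using bilinear_radd[OF h, of p "(v, 0)" "(0, \<beta>)"] bilinear_rmul[OF h, of p \<beta> "(0, 1)"] by simp
  have R: "riesz ?B (h p) = (t *\<^sub>R riesz B (\<lambda>v. h p (v, 0)), h p (0, 1) / \<psi>)" for p
  proof (rule riesz_eqI[OF ip])
    fix z
    have "h p z = h p (fst z, 0) + snd z * h p (0, 1)" using split[of p "fst z" "snd z"] by simp
    then show "?B (t *\<^sub>R riesz B (\<lambda>v. h p (v, 0)), h p (0, 1) / \<psi>) z = h p z"
      using assms by (simp add: split_beta bilinear_lmul[OF bil] riesz_works[OF B lin])
  qed
  show ?thesis
    unfolding metric_trace_def R Basis_prod_def
    by (subst sum.union_disjoint)
      (auto simp: sum.reindex inj_on_def sum_distrib_left o_def)
qed

text \<open>An orthonormal set of maximal cardinality spans, since otherwise a Gram-Schmidt step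
  would enlarge it.\<close>

lemma ex_orthonormal_basis:
  fixes B :: "'a::euclidean_space \<Rightarrow> 'a \<Rightarrow> real"
  assumes B: "inner_product B"
  shows "\<exists>E. finite E \<and> card E = DIM('a) \<and> (\<forall>e\<in>E. B e e = 1) \<and> (\<forall>w. w = (\<Sum>e\<in>E. B w e *\<^sub>R e))"
proof -
  have bil: "bilinear B" using B by (rule inner_product_bilinear)
  define ON where "ON E \<longleftrightarrow> finite E \<and> (\<forall>e\<in>E. \<forall>e'\<in>E. B e e' = (if e = e' then 1 else 0))" for E
  have sumB: "B (\<Sum>e\<in>E. c e *\<^sub>R e) z = (\<Sum>e\<in>E. c e * B e z)" for E z c
    by (simp add: linear_sum[OF bilinear_linear_left[OF bil, of z]] bilinear_lmul[OF bil])
  have rep: "w = (\<Sum>e\<in>E. B w e *\<^sub>R e)" if E: "ON E" and w: "w \<in> span E" for E w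
  proof -
    have "finite E" using E by (simp add: ON_def)
    then obtain c where c: "w = (\<Sum>e\<in>E. c e *\<^sub>R e)"
      using w unfolding span_finite[OF \<open>finite E\<close>] by blast
    have "B w e = c e" if "e \<in> E" for e
    proof -
      have "B w e = (\<Sum>e'\<in>E. if e' = e then c e' else 0)"
        unfolding c sumB using E that by (intro sum.cong) (auto simp: ON_def)
      then show ?thesis using that \<open>finite E\<close> by simp
    qed
    then have "(\<Sum>e\<in>E. B w e *\<^sub>R e) = (\<Sum>e\<in>E. c e *\<^sub>R e)" by simp
    then show ?thesis using c by (rule trans[OF _ sym, THEN sym])
  qed
  have ind: "independent E" if E: "ON E" for E
    unfolding independent_explicit
  proof (intro conjI allI impI ballI)
    show "finite E" using E by (simp add: ON_def)
    fix c e assume "(\<Sum>v\<in>E. c v *\<^sub>R v) = 0" "e \<in> E"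
    then have "(\<Sum>e'\<in>E. c e' * B e' e) = 0"
      using sumB[of c E e] by (simp add: bilinear_simps[OF bil])
    moreover have "(\<Sum>e'\<in>E. c e' * B e' e) = (\<Sum>e'\<in>E. if e' = e then c e' else 0)"
      using E \<open>e \<in> E\<close> by (intro sum.cong) (auto simp: ON_def)
    ultimately show "c e = 0" using \<open>finite E\<close> \<open>e \<in> E\<close> by simp
  qed
  \<comment> \<open>Orthonormal sets are independent, so the dimension bounds their cardinality and
    a largest one exists.\<close>
  have "ON {}" by (simp add: ON_def)
  moreover have "\<forall>E. ON E \<longrightarrow> card E < Suc (DIM('a))"
    using independent_bound[OF ind] by (auto simp: less_Suc_eq_le)
  ultimately obtain E where E: "ON E" and max: "\<And>E'. ON E' \<Longrightarrow> card E' \<le> card E"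
    using Lattices_Big.ex_has_greatest_nat[of ON "{}" card "Suc (DIM('a))"] by blast
  have fin: "finite E" using E by (simp add: ON_def)
  have span: "span E = UNIV"
  proof (rule ccontr)
    assume "span E \<noteq> UNIV"
    then obtain w where w: "w \<notin> span E" by auto
    define z where "z = w - (\<Sum>e\<in>E. B w e *\<^sub>R e)"
    have z: "z \<noteq> 0"
    proof
      assume "z = 0"
      then have "w = (\<Sum>e\<in>E. B w e *\<^sub>R e)" unfolding z_def by (rule right_minus_eq[THEN iffD1])
      also have "\<dots> \<in> span E" by (intro span_sum span_scale span_base)
      finally show False using w by contradiction
    qed
    have ze: "B z e = 0" if "e \<in> E" for e
    proof -
      have "(\<Sum>e'\<in>E. B w e' * B e' e) = (\<Sum>e'\<in>E. if e' = e then B w e' else 0)"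
        using E that by (intro sum.cong) (auto simp: ON_def)
      then show ?thesis using fin that unfolding z_def
        by (simp add: bilinear_simps[OF bil] sumB)
    qed
    have pos: "B z z > 0" using B z by (rule inner_product_pos)
    define f where "f = (1 / sqrt (B z z)) *\<^sub>R z"
    have f: "B f f = 1" using pos by (simp add: f_def bilinear_simps[OF bil] field_simps)
    have fe: "B f e = 0" "B e f = 0" if "e \<in> E" for e
      using ze[OF that] inner_product_commute[OF B, of e] by (simp_all add: f_def bilinear_simps[OF bil])
    have "f \<notin> E" using fe(1) f by auto
    have "ON (insert f E)"
      using E f fe \<open>f \<notin> E\<close> by (auto simp: ON_def)
    then show False using max[of "insert f E"] fin \<open>f \<notin> E\<close> by simp
  qed
  have "card E = DIM('a)"
    using ind[OF E] span by (metis dim_UNIV dim_eq_card_independent dim_span)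
  moreover have "B e e = 1" if "e \<in> E" for e using E that by (auto simp: ON_def)
  moreover have "w = (\<Sum>e\<in>E. B w e *\<^sub>R e)" for w using rep[OF E, of w] span by blast
  ultimately show ?thesis using fin by blast
qed

text \<open>In a \<open>B\<close>-orthonormal basis the trace is the sum of the numbers
  \<open>B (L e) e\<close>, each at most \<open>C\<close> in absolute value; two sums over bases are
  exchanged to get there from the standard basis.\<close>

lemma lin_trace_bound:
  fixes B :: "'a::euclidean_space \<Rightarrow> 'a \<Rightarrow> real" and C :: real
  assumes B: "inner_product B" and L: "linear L"
    and bd: "\<And>u z. \<bar>B (L u) z\<bar> \<le> C * sqrt (B u u) * sqrt (B z z)"
  shows "\<bar>lin_trace L\<bar> \<le> DIM('a) * C"
proof -
  have bil: "bilinear B" using B by (rule inner_product_bilinear)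
  obtain E where E: "finite E" "card E = DIM('a)" "\<And>e. e \<in> E \<Longrightarrow> B e e = 1"
    "\<And>w. w = (\<Sum>e\<in>E. B w e *\<^sub>R e)"
    using ex_orthonormal_basis[OF B] by blast
  have "L b = (\<Sum>e\<in>E. B b e *\<^sub>R L e)" for b
  proof -
    have "L b = L (\<Sum>e\<in>E. B b e *\<^sub>R e)" by (rule arg_cong[OF E(4)])
    then show ?thesis by (simp add: linear_sum[OF L] linear_cmul[OF L])
  qed
  then have "lin_trace L = (\<Sum>b\<in>Basis. \<Sum>e\<in>E. B b e * (L e \<bullet> b))"
    unfolding lin_trace_def by (metis (no_types, lifting) inner_scaleR_left inner_sum_left sum.cong)
  also have "\<dots> = (\<Sum>e\<in>E. \<Sum>b\<in>Basis. B b e * (L e \<bullet> b))" by (rule sum.swap)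
  also have "\<dots> = (\<Sum>e\<in>E. B (L e) e)"
  proof (rule sum.cong[OF refl])
    fix e
    have "B (L e) e = B (\<Sum>b\<in>Basis. (L e \<bullet> b) *\<^sub>R b) e" by (simp add: euclidean_representation)
    also have "\<dots> = (\<Sum>b\<in>Basis. (L e \<bullet> b) * B b e)"
      by (simp add: linear_sum[OF bilinear_linear_left[OF bil, of e]] bilinear_lmul[OF bil])
    finally show "(\<Sum>b\<in>Basis. B b e * (L e \<bullet> b)) = B (L e) e" by (simp add: mult.commute)
  qed
  finally have "\<bar>lin_trace L\<bar> \<le> (\<Sum>e\<in>E. \<bar>B (L e) e\<bar>)" by simp
  also have "\<dots> \<le> (\<Sum>e\<in>E. C)"
    using bd[of e e for e] E(3) by (intro sum_mono) (metis mult.right_neutral real_sqrt_one)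
  finally show ?thesis using E(2) by simp
qed

lemma metric_trace_bound:
  fixes B :: "'a::euclidean_space \<Rightarrow> 'a \<Rightarrow> real" and C :: real
  assumes B: "inner_product B" and h: "bilinear h"
    and bd: "\<And>u z. \<bar>h u z\<bar> \<le> C * sqrt (B u u) * sqrt (B z z)"
  shows "\<bar>metric_trace B h\<bar> \<le> DIM('a) * C"
  unfolding metric_trace_eq_lin_trace
  by (rule lin_trace_bound[OF B linear_riesz_bilinear[OF B h]])
    (use bd riesz_works[OF B bilinear_linear_right[OF h]] in simp)

section \<open>Derivatives on relatively open sets\<close>

abbreviation D :: "'a::real_normed_vector set \<Rightarrow> ('a \<Rightarrow> 'b::real_normed_vector) \<Rightarrow> 'a \<Rightarrow> 'a \<Rightarrow> 'b" where
  "D S f x h \<equiv> frechet_derivative f (at x within S) h"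

text \<open>Derivatives within \<open>S\<close> are unique; this covers open sets and, at the final time, one-sided
  neighbourhoods in \<open>E \<times> (0,T]\<close>.\<close>

definition thick :: "'a::euclidean_space set \<Rightarrow> bool" where
  "thick S \<longleftrightarrow> (\<forall>x\<in>S. \<forall>i\<in>Basis. \<forall>e>0. \<exists>d. 0 < \<bar>d\<bar> \<and> \<bar>d\<bar> < e \<and> x + d *\<^sub>R i \<in> S)"

lemma thick_openin_halfspace:
  fixes S :: "('a::euclidean_space \<times> real) set"
  assumes "openin (top_of_set (UNIV \<times> {0<..T})) S"
  shows "thick S"
  unfolding thick_def
proof (intro ballI allI impI)
  fix p :: "'a \<times> real" and i :: "'a \<times> real" and e :: real
  assume p: "p \<in> S" and i: "i \<in> Basis" and e: "e > 0"
  obtain U where U: "open U" "S = (UNIV \<times> {0<..T}) \<inter> U"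
    using assms by (auto simp: openin_open)
  obtain r where r: "r > 0" "ball p r \<subseteq> U" using U p by (auto simp: open_contains_ball)
  \<comment> \<open>The step goes backwards, so the time stays at most \<open>T\<close> even at the
    final time; \<open>\<delta> < snd p\<close> keeps it positive.\<close>
  define \<delta> where "\<delta> = min (min e r) (snd p) / 2"
  have sp: "0 < snd p" "snd p \<le> T" using p U by auto
  have \<delta>: "0 < \<delta>" "\<delta> < e" "\<delta> < r" "\<delta> < snd p" using e r sp by (auto simp: \<delta>_def)
  have ni: "norm i = 1" using i by (rule norm_Basis)
  have si: "0 \<le> snd i" "snd i \<le> 1" using i by (auto simp: Basis_prod_def)
  have "p + (-\<delta>) *\<^sub>R i \<in> ball p r" using \<delta> ni by (simp add: dist_norm)
  moreover have "snd (p + (-\<delta>) *\<^sub>R i) \<in> {0<..T}"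
  proof -
    have "\<delta> * snd i \<le> \<delta>" using \<delta>(1) si by (simp add: mult_left_le)
    moreover have "0 \<le> \<delta> * snd i" using \<delta>(1) si by simp
    ultimately show ?thesis using \<delta>(4) sp by simp
  qed
  ultimately have "p + (-\<delta>) *\<^sub>R i \<in> S" using r U by (auto simp: mem_Times_iff)
  then show "\<exists>d. 0 < \<bar>d\<bar> \<and> \<bar>d\<bar> < e \<and> p + d *\<^sub>R i \<in> S" using \<delta> by (intro exI[of _ "-\<delta>"]) auto
qed

lemma thick_greaterThanAtMost: "thick {0<..T::real}"
  unfolding thick_def
proof (intro ballI allI impI)
  fix x i e :: real assume "x \<in> {0<..T}" "i \<in> Basis" "e > 0"
  then show "\<exists>d. 0 < \<bar>d\<bar> \<and> \<bar>d\<bar> < e \<and> x + d *\<^sub>R i \<in> {0<..T}"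
    by (intro exI[of _ "- min e x / 2"]) auto
qed

lemma thick_open: "open S \<Longrightarrow> thick S"
  unfolding thick_def
proof (intro ballI allI impI)
  fix x i :: 'a and e :: real
  assume S: "open S" and x: "x \<in> S" and i: "i \<in> Basis" and e: "e > 0"
  obtain r where r: "r > 0" "ball x r \<subseteq> S" using S x by (auto simp: open_contains_ball)
  have "x + (min e r / 2) *\<^sub>R i \<in> ball x r" using r e i by (simp add: dist_norm)
  then show "\<exists>d. 0 < \<bar>d\<bar> \<and> \<bar>d\<bar> < e \<and> x + d *\<^sub>R i \<in> S"
    using r e by (intro exI[of _ "min e r / 2"]) auto
qed

lemma D_eqI:
  assumes "thick S" "x \<in> S" "(f has_derivative f') (at x within S)"
  shows "D S f x h = f' h"
proof -
  have "(f has_derivative frechet_derivative f (at x within S)) (at x within S)"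
    using assms(3) by (auto simp: differentiable_def frechet_derivative_works[symmetric])
  then have "frechet_derivative f (at x within S) = f'"
    using assms by (intro frechet_derivative_unique_within[OF _ assms(3)]) (auto simp: thick_def)
  then show ?thesis by simp
qed

lemma D_works:
  "f differentiable (at x within S) \<Longrightarrow> (f has_derivative D S f x) (at x within S)"
  by (simp add: frechet_derivative_works)

lemma linear_D: "f differentiable (at x within S) \<Longrightarrow> linear (D S f x)"
  by (rule linear_frechet_derivative)

lemma smooth_on_differentiable: "smooth_on S f \<Longrightarrow> x \<in> S \<Longrightarrow> f differentiable (at x within S)"
  using Ck_on.simps(2)[of 0 S f] by (auto simp: smooth_on_def differentiable_on_def)

lemma smooth_on_D: "smooth_on S f \<Longrightarrow> smooth_on S (\<lambda>x. D S f x v)"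
  unfolding smooth_on_def
proof
  fix k assume "\<forall>k. Ck_on k S f"
  then have "Ck_on (Suc k) S f" by blast
  then show "Ck_on k S (\<lambda>x. D S f x v)" by simp
qed

lemma smooth_on_continuous: "smooth_on S f \<Longrightarrow> continuous_on S f"
  unfolding smooth_on_def using Ck_on.simps(1)[of S f] by blast

lemma has_derivative_chain_within:
  assumes "(\<phi> has_derivative \<phi>') (at x within S)" "\<And>y. y \<in> S \<Longrightarrow> \<phi> y \<in> U"
    "(f has_derivative f') (at (\<phi> x) within U)"
  shows "((\<lambda>y. f (\<phi> y)) has_derivative (\<lambda>h. f' (\<phi>' h))) (at x within S)"
  using assms by (intro has_derivative_in_compose[OF assms(1)] has_derivative_subset[OF assms(3)]) auto

lemma has_derivative_slice_fst:
  assumes "(f has_derivative f') (at (y, t) within S)"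
  shows "((\<lambda>y. f (y, t)) has_derivative (\<lambda>u. f' (u, 0))) (at y within {y. (y, t) \<in> S})"
  by (rule has_derivative_chain_within[where \<phi> = "\<lambda>y. (y, t)", OF _ _ assms]) (auto intro!: derivative_eq_intros)

lemma has_derivative_slice_snd:
  assumes "(f has_derivative f') (at (y, t) within S)"
  shows "((\<lambda>t. f (y, t)) has_derivative (\<lambda>s. f' (0, s))) (at t within {t. (y, t) \<in> S})"
  by (rule has_derivative_chain_within[where \<phi> = "\<lambda>t. (y, t)", OF _ _ assms]) (auto intro!: derivative_eq_intros)

lemma linear_D_parameter:
  assumes "thick S" "x \<in> S" and lin: "\<And>y. y \<in> S \<Longrightarrow> linear (l y)"
    and diff: "\<And>z. (\<lambda>y. l y z) differentiable (at x within S)"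
  shows "linear (\<lambda>z. D S (\<lambda>y. l y z) x h)"
proof (rule linearI)
  note d = D_works[OF diff]
  show "D S (\<lambda>y. l y (z + z')) x h = D S (\<lambda>y. l y z) x h + D S (\<lambda>y. l y z') x h" for z z'
    by (rule D_eqI[OF assms(1,2) has_derivative_transform[OF assms(2) _ has_derivative_add[OF d d]]])
      (simp add: linear_add[OF lin])
  show "D S (\<lambda>y. l y (c *\<^sub>R z)) x h = c *\<^sub>R D S (\<lambda>y. l y z) x h" for c z
    by (rule D_eqI[OF assms(1,2) has_derivative_transform[OF assms(2) _ has_derivative_scaleR_right[OF d]]])
      (simp add: linear_cmul[OF lin])
qed

lemma bilinear_D_parameter:
  assumes "thick S" "x \<in> S" and bil: "\<And>y. y \<in> S \<Longrightarrow> bilinear (G y)"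
    and diff: "\<And>u v. (\<lambda>y. G y u v) differentiable (at x within S)"
  shows "bilinear (\<lambda>u v. D S (\<lambda>y. G y u v) x h)"
  unfolding bilinear_def
proof (intro allI conjI)
  show "linear (\<lambda>v. D S (\<lambda>y. G y u v) x h)" for u
    by (rule linear_D_parameter[OF assms(1,2)]) (use bil diff in \<open>auto simp: bilinear_def\<close>)
  show "linear (\<lambda>u. D S (\<lambda>y. G y u v) x h)" for v
    by (rule linear_D_parameter[OF assms(1,2)]) (use bil diff in \<open>auto simp: bilinear_def\<close>)
qed

section \<open>Differentiating the solution of a linear system that depends on a parameter\<close>

lemma linear_expand:
  fixes l :: "'a::euclidean_space \<Rightarrow> 'b::real_vector"
  assumes "linear l"
  shows "l z = (\<Sum>b\<in>Basis. (z \<bullet> b) *\<^sub>R l b)"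
proof -
  have "l z = l (\<Sum>b\<in>Basis. (z \<bullet> b) *\<^sub>R b)" by (simp add: euclidean_representation)
  then show ?thesis by (simp add: linear_sum[OF assms] linear_cmul[OF assms])
qed

text \<open>No bound on \<open>e\<close> is assumed in advance. Nondegeneracy of the limit gives
  \<open>c * norm u \<le> norm (\<Phi> u)\<close>, and once the entries of \<open>G y\<close> and
  \<open>B\<close> differ by less than \<open>c / 2\<close> in total, the error of replacing
  \<open>B\<close> by \<open>G y\<close> is absorbed on the left.\<close>

lemma tendsto_zero_of_nondegenerate:
  fixes G :: "'i \<Rightarrow> 'a::euclidean_space \<Rightarrow> 'a \<Rightarrow> real" and e :: "'i \<Rightarrow> 'a"
  assumes B: "inner_product B" and bil: "\<forall>\<^sub>F y in F. bilinear (G y)"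
    and G: "\<And>u v. ((\<lambda>y. G y u v) \<longlongrightarrow> B u v) F"
    and e: "\<And>z. ((\<lambda>y. G y (e y) z) \<longlongrightarrow> 0) F"
  shows "(e \<longlongrightarrow> 0) F"
proof -
  have bB: "bilinear B" using B by (rule inner_product_bilinear)
  define \<Phi> where "\<Phi> u = (\<Sum>b\<in>Basis. B u b *\<^sub>R b)" for u
  have lin: "linear \<Phi>"
    unfolding \<Phi>_def
    by (intro linear_compose_sum ballI)
      (auto intro!: linearI simp: bilinear_simps[OF bB] scaleR_add_left)
  have \<Phi>b: "\<Phi> u \<bullet> b = B u b" if "b \<in> Basis" for u b
    using that by (simp add: \<Phi>_def)
  have "inj \<Phi>"
    unfolding linear_injective_0[OF lin]
  proof (intro allI impI)
    fix u assume "\<Phi> u = 0"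
    then have "B u b = 0" if "b \<in> Basis" for b using \<Phi>b[OF that, of u] by simp
    then have "B u u = 0"
      by (subst linear_expand[OF bilinear_linear_right[OF bB]]) simp
    then show "u = 0" using inner_product_pos[OF B, of u] by auto
  qed
  then obtain c where c: "c > 0" "\<And>u. c * norm u \<le> norm (\<Phi> u)"
    using linear_inj_bounded_below_pos[OF lin] by blast
  define \<delta> where "\<delta> y = (\<Sum>b\<in>Basis. \<Sum>i\<in>Basis. \<bar>B i b - G y i b\<bar>)" for y
  have "(\<delta> \<longlongrightarrow> (\<Sum>b\<in>Basis. \<Sum>i\<in>Basis. \<bar>B i b - B i b\<bar>)) F"
    unfolding \<delta>_def by (intro tendsto_intros G)
  then have "(\<delta> \<longlongrightarrow> 0) F" by simp
  then have small: "\<forall>\<^sub>F y in F. \<delta> y < c / 2"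
    using c(1) by (intro order_tendstoD) auto
  have key: "norm (e y) \<le> 2 / c * (\<Sum>b\<in>Basis. \<bar>G y (e y) b\<bar>)"
    if y: "bilinear (G y)" "\<delta> y < c / 2" for y
  proof -
    have 1: "\<bar>B u b - G y u b\<bar> \<le> norm u * (\<Sum>i\<in>Basis. \<bar>B i b - G y i b\<bar>)" for u b
    proof -
      have "B u b - G y u b = (\<Sum>i\<in>Basis. (u \<bullet> i) * (B i b - G y i b))"
        by (subst linear_expand[OF bilinear_linear_left[OF bB, of b]],
            subst linear_expand[OF bilinear_linear_left[OF y(1), of b]])
          (simp add: sum_subtractf[symmetric] right_diff_distrib)
      also have "\<bar>\<dots>\<bar> \<le> (\<Sum>i\<in>Basis. norm u * \<bar>B i b - G y i b\<bar>)"
        by (intro order_trans[OF sum_abs] sum_mono) (auto simp: abs_mult intro!: mult_right_mono Basis_le_norm)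
      finally show ?thesis by (simp add: sum_distrib_left)
    qed
    have "c * norm (e y) \<le> (\<Sum>b\<in>Basis. \<bar>\<Phi> (e y) \<bullet> b\<bar>)"
      using c(2) norm_le_l1 by (rule order_trans)
    also have "\<dots> = (\<Sum>b\<in>Basis. \<bar>B (e y) b\<bar>)" by (simp add: \<Phi>b)
    also have "\<dots> \<le> (\<Sum>b\<in>Basis. \<bar>G y (e y) b\<bar> + norm (e y) * (\<Sum>i\<in>Basis. \<bar>B i b - G y i b\<bar>))"
      using 1[of "e y"] by (intro sum_mono) (smt (verit))
    also have "\<dots> = (\<Sum>b\<in>Basis. \<bar>G y (e y) b\<bar>) + norm (e y) * \<delta> y"
      by (simp add: sum.distrib \<delta>_def sum_distrib_left)
    also have "norm (e y) * \<delta> y \<le> norm (e y) * (c / 2)"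
      using y by (intro mult_left_mono) auto
    finally show ?thesis using c(1) by (simp add: field_simps)
  qed
  show ?thesis
  proof (rule Lim_null_comparison)
    show "\<forall>\<^sub>F y in F. norm (e y) \<le> 2 / c * (\<Sum>b\<in>Basis. \<bar>G y (e y) b\<bar>)"
      using bil small by eventually_elim (rule key)
    have "((\<lambda>y. 2 / c * (\<Sum>b\<in>Basis. \<bar>G y (e y) b\<bar>)) \<longlongrightarrow> 2 / c * (\<Sum>b\<in>(Basis::'a set). \<bar>0\<bar>)) F"
      by (intro tendsto_intros e)
    then show "((\<lambda>y. 2 / c * (\<Sum>b\<in>Basis. \<bar>G y (e y) b\<bar>)) \<longlongrightarrow> 0) F" by simp
  qed
qed

text \<open>Implicit differentiation of \<open>G y w z = l y z\<close>: the derivative of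
  \<open>w\<close> solves the same system, with the derivative of \<open>l\<close> minus that of
  \<open>G\<close> at the fixed \<open>w\<close> as right-hand side. The remainder is tested against
  \<open>G y\<close>, so no inverse matrix has to be differentiated.\<close>

lemma riesz_has_derivative:
  fixes G :: "'c::euclidean_space \<Rightarrow> 'a::euclidean_space \<Rightarrow> 'a \<Rightarrow> real"
  assumes S: "thick S" "x \<in> S"
    and G: "\<And>y. y \<in> S \<Longrightarrow> inner_product (G y)"
    and l: "\<And>y. y \<in> S \<Longrightarrow> linear (l y)"
    and dgmet: "\<And>u v. (\<lambda>y. G y u v) differentiable (at x within S)"
    and dl: "\<And>z. (\<lambda>y. l y z) differentiable (at x within S)"
  shows "((\<lambda>y. riesz (G y) (l y)) has_derivative
    (\<lambda>h. riesz (G x) (\<lambda>z. D S (\<lambda>y. l y z) x h - D S (\<lambda>y. G y (riesz (G x) (l x)) z) x h)))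
    (at x within S)"
proof -
  have bil: "bilinear (G y)" if "y \<in> S" for y using G[OF that] by (rule inner_product_bilinear)
  define w where "w = riesz (G x) (l x)"
  define r where "r h z = D S (\<lambda>y. l y z) x h - D S (\<lambda>y. G y w z) x h" for h z
  define W where "W h = riesz (G x) (r h)" for h
  have bG: "bilinear (\<lambda>u v. D S (\<lambda>y. G y u v) x h)" for h
    using S bil dgmet by (rule bilinear_D_parameter)
  have lr: "linear (r h)" for h
    unfolding r_def
    using linear_compose_sub[OF linear_D_parameter[OF S l dl] bilinear_linear_right[OF bG]] by simp
  have lr': "linear (\<lambda>h. r h z)" for z
    unfolding r_def using linear_compose_sub[OF linear_D[OF dl] linear_D[OF dgmet]] by simp
  have br: "bilinear r"
    using lr lr' by (simp add: bilinear_def)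
  have GW: "G x (W h) z = r h z" for h z
    unfolding W_def using riesz_works[OF G[OF S(2)] lr] .
  have Gw: "G y (riesz (G y) (l y)) z = l y z" if "y \<in> S" for y z
    using riesz_works[OF G[OF that] l[OF that]] .
  have linW: "linear W"
  proof (rule linearI)
    show "W (h + h') = W h + W h'" for h h'
      by (rule inner_product_eqI[OF G[OF S(2)]])
        (simp add: GW bilinear_ladd[OF bil[OF S(2)]] bilinear_ladd[OF br])
    show "W (c *\<^sub>R h) = c *\<^sub>R W h" for c h
      by (rule inner_product_eqI[OF G[OF S(2)]])
        (simp add: GW bilinear_lmul[OF bil[OF S(2)]] bilinear_lmul[OF br])
  qed
  then obtain C where C: "\<And>h. norm (W h) \<le> C * norm h" using linear_bounded by blast
  define F where "F = at x within S"
  have inS: "\<forall>\<^sub>F y in F. y \<in> S"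
    unfolding F_def by (simp add: eventually_at_filter)
  have contG: "((\<lambda>y. G y u v) \<longlongrightarrow> G x u v) F" for u v
    using differentiable_imp_continuous_within[OF dgmet] by (simp add: F_def continuous_within)
  define e where "e y = (1 / norm (y - x)) *\<^sub>R (riesz (G y) (l y) - (w + W (y - x)))" for y
  have "(e \<longlongrightarrow> 0) F"
  proof (rule tendsto_zero_of_nondegenerate[OF G[OF S(2)] _ contG])
    show "\<forall>\<^sub>F y in F. bilinear (G y)" using inS by eventually_elim (rule bil)
    fix z
    \<comment> \<open>The tested remainder splits into the first-order remainder of
      \<open>l\<close>, that of \<open>G\<close> at the fixed vector \<open>w\<close>, and the error
      of replacing \<open>G y\<close> by \<open>G x\<close> on the increment
      \<open>W (y - x)\<close>.\<close>
    define r1 where "r1 y = (1 / norm (y - x)) *\<^sub>R (l y z - (l x z + D S (\<lambda>y. l y z) x (y - x)))" for y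
    define r2 where "r2 y = (1 / norm (y - x)) *\<^sub>R (G y w z - (G x w z + D S (\<lambda>y. G y w z) x (y - x)))" for y
    define r3 where "r3 y = (1 / norm (y - x)) * (G x (W (y - x)) z - G y (W (y - x)) z)" for y
    have 1: "(r1 \<longlongrightarrow> 0) F" "(r2 \<longlongrightarrow> 0) F"
      unfolding r1_def r2_def F_def
      using D_works[OF dl[of z]] D_works[OF dgmet[of w z]] by (auto simp: has_derivative_within)
    have 3: "(r3 \<longlongrightarrow> 0) F"
    proof (rule Lim_null_comparison)
      show "\<forall>\<^sub>F y in F. norm (r3 y) \<le> \<bar>C\<bar> * (\<Sum>b\<in>Basis. \<bar>G x b z - G y b z\<bar>)"
        using inS
      proof eventually_elim
        case (elim y)
        have W: "\<bar>(1 / norm (y - x)) * (W (y - x) \<bullet> b)\<bar> \<le> \<bar>C\<bar>" if "b \<in> Basis" for b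
        proof (cases "y = x")
          case False
          have "\<bar>W (y - x) \<bullet> b\<bar> \<le> \<bar>C\<bar> * norm (y - x)"
            using C[of "y - x"] Basis_le_norm[OF that, of "W (y - x)"]
            by (smt (verit) abs_ge_self mult_right_mono norm_ge_zero)
          then show ?thesis using False by (simp add: abs_mult field_simps)
        qed simp
        have "r3 y = (\<Sum>b\<in>Basis. (1 / norm (y - x)) * (W (y - x) \<bullet> b) * (G x b z - G y b z))"
          unfolding r3_def
          by (subst linear_expand[OF bilinear_linear_left[OF bil[OF S(2)], of z]],
            subst linear_expand[OF bilinear_linear_left[OF bil[OF elim], of z]])
           (simp add: sum_subtractf[symmetric] right_diff_distrib sum_distrib_left sum_divide_distrib diff_divide_distrib)
        also have "norm \<dots> \<le> (\<Sum>b\<in>Basis. \<bar>C\<bar> * \<bar>G x b z - G y b z\<bar>)"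
          using W by (intro sum_norm_le) (metis abs_mult abs_ge_zero mult_right_mono real_norm_def)
        finally show ?case by (simp add: sum_distrib_left)
      qed
      have "((\<lambda>y. \<bar>C\<bar> * (\<Sum>b\<in>Basis. \<bar>G x b z - G y b z\<bar>)) \<longlongrightarrow> \<bar>C\<bar> * (\<Sum>b\<in>(Basis::'a set). \<bar>G x b z - G x b z\<bar>)) F"
        by (intro tendsto_intros contG)
      then show "((\<lambda>y. \<bar>C\<bar> * (\<Sum>b\<in>Basis. \<bar>G x b z - G y b z\<bar>)) \<longlongrightarrow> 0) F" by simp
    qed
    have "((\<lambda>y. r1 y - r2 y + r3 y) \<longlongrightarrow> 0 - 0 + 0) F" by (intro tendsto_intros 1 3)
    moreover have "\<forall>\<^sub>F y in F. r1 y - r2 y + r3 y = G y (e y) z"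
      using inS
    proof eventually_elim
      case (elim y)
      have "G y (e y) z = (1 / norm (y - x)) * (l y z - G y w z - G y (W (y - x)) z)"
        unfolding e_def by (simp add: bilinear_simps[OF bil[OF elim]] Gw[OF elim] algebra_simps)
      moreover have "G x w z = l x z" unfolding w_def by (rule Gw[OF S(2)])
      moreover have "G x (W (y - x)) z = D S (\<lambda>y. l y z) x (y - x) - D S (\<lambda>y. G y w z) x (y - x)"
        by (simp add: GW r_def)
      ultimately show ?case
        unfolding r1_def r2_def r3_def real_scaleR_def
        by (simp add: right_diff_distrib[symmetric] distrib_left[symmetric] del: times_divide_eq_left mult_cancel_left)
    qed
    ultimately show "((\<lambda>y. G y (e y) z) \<longlongrightarrow> 0) F" by (simp add: tendsto_cong)
  qed
  then have "((\<lambda>y. riesz (G y) (l y)) has_derivative W) (at x within S)"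
    using linW by (simp add: linear_conv_bounded_linear has_derivative_within e_def[abs_def] w_def F_def)
  then show ?thesis by (simp add: W_def[abs_def] r_def[abs_def] w_def)
qed

section \<open>Curvature of a Ricci flow in a chart\<close>

lemma differentiable_on_riesz:
  fixes G :: "'c::euclidean_space \<Rightarrow> 'a::euclidean_space \<Rightarrow> 'a \<Rightarrow> real"
  assumes "thick S" "\<And>y. y \<in> S \<Longrightarrow> inner_product (G y)" "\<And>y. y \<in> S \<Longrightarrow> linear (l y)"
    and "\<And>u v. (\<lambda>y. G y u v) differentiable_on S" "\<And>z. (\<lambda>y. l y z) differentiable_on S"
  shows "(\<lambda>y. riesz (G y) (l y)) differentiable_on S"
  unfolding differentiable_on_def
proof
  fix x assume x: "x \<in> S"
  show "(\<lambda>y. riesz (G y) (l y)) differentiable (at x within S)"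
    by (rule differentiableI[OF riesz_has_derivative[OF assms(1) x assms(2,3)]])
      (use assms(4,5) x in \<open>auto simp: differentiable_on_def\<close>)
qed

lemma smooth_on_differentiable_on: "smooth_on S f \<Longrightarrow> f differentiable_on S"
  by (auto simp: differentiable_on_def smooth_on_differentiable)

text \<open>By \<open>riesz_has_derivative\<close> the derivative is again a \<open>riesz\<close>
  vector, whose right-hand side \<open>k\<close> is built from derivatives of smooth data and from
  the differentiable \<open>w\<close>. It is therefore differentiable, in particular continuous.
  This is the source of the C^1 regularity of \<open>scal\<close>.\<close>

lemma continuous_on_D_riesz:
  fixes G :: "'c::euclidean_space \<Rightarrow> 'a::euclidean_space \<Rightarrow> 'a \<Rightarrow> real"
  assumes S: "thick S" and G: "\<And>y. y \<in> S \<Longrightarrow> inner_product (G y)"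
    and l: "\<And>y. y \<in> S \<Longrightarrow> linear (l y)"
    and sG: "\<And>u v. smooth_on S (\<lambda>y. G y u v)" and sl: "\<And>z. smooth_on S (\<lambda>y. l y z)"
  shows "continuous_on S (\<lambda>x. D S (\<lambda>y. riesz (G y) (l y)) x h)"
proof -
  note bil = inner_product_bilinear[OF G]
  note dgmet = smooth_on_differentiable[OF sG] and dl = smooth_on_differentiable[OF sl]
  define w where "w x = riesz (G x) (l x)" for x
  \<comment> \<open>Expanding the moving vector \<open>w x\<close> in coordinates leaves derivatives
    of \<open>G\<close> at constant vectors, which are smooth.\<close>
  define k where "k x z = D S (\<lambda>y. l y z) x h - (\<Sum>a\<in>Basis. (w x \<bullet> a) * D S (\<lambda>y. G y a z) x h)" for x z
  have bG: "bilinear (\<lambda>u v. D S (\<lambda>y. G y u v) x h)" if "x \<in> S" for x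
    using S that bil dgmet[OF that] by (rule bilinear_D_parameter)
  have wd: "w differentiable_on S"
    unfolding w_def[abs_def] using sG sl
    by (intro differentiable_on_riesz[OF S G l] smooth_on_differentiable_on)
  have k: "k x z = D S (\<lambda>y. l y z) x h - D S (\<lambda>y. G y (w x) z) x h" if "x \<in> S" for x z
    unfolding k_def by (subst (2) linear_expand[OF bilinear_linear_left[OF bG[OF that], of z]]) simp
  have "linear (k x)" if "x \<in> S" for x
  proof -
    have "linear (\<lambda>z. D S (\<lambda>y. l y z) x h - D S (\<lambda>y. G y (w x) z) x h)"
      using linear_compose_sub[OF linear_D_parameter[OF S that l dl[OF that]] bilinear_linear_right[OF bG[OF that]]]
      by simp
    moreover have "k x = (\<lambda>z. D S (\<lambda>y. l y z) x h - D S (\<lambda>y. G y (w x) z) x h)" using k[OF that] by (intro ext)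
    ultimately show ?thesis by simp
  qed
  moreover have "(\<lambda>x. k x z) differentiable_on S" for z
  proof -
    have wa: "(\<lambda>x. w x \<bullet> a) differentiable (at x within S)" if "x \<in> S" for a x
      using wd that by (intro differentiableI[OF has_derivative_inner_left[OF D_works]])
        (auto simp: differentiable_on_def)
    show ?thesis
      unfolding k_def differentiable_on_def
    proof
      fix x assume x: "x \<in> S"
      show "(\<lambda>x. D S (\<lambda>y. l y z) x h - (\<Sum>a\<in>Basis. (w x \<bullet> a) * D S (\<lambda>y. G y a z) x h))
          differentiable (at x within S)"
        by (rule differentiable_diff[OF smooth_on_differentiable[OF smooth_on_D[OF sl] x]
              differentiable_sum[OF finite_Basis ballI[OF differentiable_mult[OF wa[OF x]
              smooth_on_differentiable[OF smooth_on_D[OF sG] x]]]]])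
    qed
  qed
  ultimately have "(\<lambda>x. riesz (G x) (k x)) differentiable_on S"
    by (intro differentiable_on_riesz[OF S G] smooth_on_differentiable_on[OF sG])
  then have "continuous_on S (\<lambda>x. riesz (G x) (k x))" by (rule differentiable_imp_continuous_on)
  moreover have "D S (\<lambda>y. riesz (G y) (l y)) x h = riesz (G x) (k x)" if x: "x \<in> S" for x
  proof -
    have "D S (\<lambda>y. riesz (G y) (l y)) x h
      = riesz (G x) (\<lambda>z. D S (\<lambda>y. l y z) x h - D S (\<lambda>y. G y (riesz (G x) (l x)) z) x h)"
      by (rule D_eqI[OF S x riesz_has_derivative[OF S x G l dgmet[OF x] dl[OF x]]])
    then show ?thesis by (simp add: k[OF x, abs_def] w_def)
  qed
  ultimately show ?thesis by (simp cong: continuous_on_cong)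
qed

section \<open>The Levi-Civita connection in coordinates and a bound on scalar curvature\<close>

lemma linear_Koszul:
  fixes G :: "'a::euclidean_space \<Rightarrow> 'a \<Rightarrow> 'a \<Rightarrow> real"
  assumes S: "thick S" "x \<in> S" and bil: "\<And>y. y \<in> S \<Longrightarrow> bilinear (G y)"
    and dgmet: "\<And>u v. (\<lambda>y. G y u v) differentiable (at x within S)"
  shows "linear (\<lambda>z. (D S (\<lambda>y. G y v z) x u + D S (\<lambda>y. G y u z) x v - D S (\<lambda>y. G y u v) x z) / 2)"
proof -
  have "bilinear (\<lambda>u v. D S (\<lambda>y. G y u v) x h)" for h
    using S bil dgmet by (rule bilinear_D_parameter)
  note b = bilinear_linear_right[OF this] and l = linear_D[OF dgmet]
  show ?thesis
    by (rule linearI)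
      (simp_all add: linear_add[OF b] linear_cmul[OF b] linear_add[OF l] linear_cmul[OF l] field_simps)
qed

lemma christoffel_pairing:
  fixes G :: "'a::euclidean_space \<Rightarrow> 'a \<Rightarrow> 'a \<Rightarrow> real"
  assumes "thick S" "x \<in> S" and G: "\<And>y. y \<in> S \<Longrightarrow> inner_product (G y)"
    and dgmet: "\<And>u v. (\<lambda>y. G y u v) differentiable (at x within S)"
  shows "G x (christoffel S G x u v) z =
    (D S (\<lambda>y. G y v z) x u + D S (\<lambda>y. G y u z) x v - D S (\<lambda>y. G y u v) x z) / 2"
  unfolding christoffel_def
  by (rule riesz_works[OF G[OF assms(2)] linear_Koszul[OF assms(1,2) inner_product_bilinear[OF G] dgmet]])

lemma bilinear_christoffel:
  fixes G :: "'a::euclidean_space \<Rightarrow> 'a \<Rightarrow> 'a \<Rightarrow> real"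
  assumes S: "thick S" "x \<in> S" and G: "\<And>y. y \<in> S \<Longrightarrow> inner_product (G y)"
    and dgmet: "\<And>u v. (\<lambda>y. G y u v) differentiable (at x within S)"
  shows "bilinear (christoffel S G x)"
proof -
  note bil = inner_product_bilinear[OF G]
  have b: "bilinear (\<lambda>u v. D S (\<lambda>y. G y u v) x h)" for h
    using S bil dgmet by (rule bilinear_D_parameter)
  note lin = linear_D[OF dgmet]
  note eq = inner_product_eqI[OF G[OF S(2)]]
  note pair = christoffel_pairing[OF S G dgmet]
  show ?thesis
    unfolding bilinear_def
    by (intro conjI allI linearI; rule eq)
      (simp_all add: pair bilinear_simps[OF b] bilinear_simps[OF bil[OF S(2)]]
        linear_add[OF lin] linear_cmul[OF lin] field_simps)
qed

text \<open>Two successive traces. The first, of \<open>riemann\<close> over its first slot, is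
  bounded with the constant \<open>C * sqrt (G x v v) * sqrt (G x w w)\<close>; the second costs
  another factor \<open>DIM('a)\<close>. Bilinearity of \<open>ricci\<close> is a hypothesis because
  along the flow it is read off from the time derivative of the metric and not from symmetries of
  the curvature.\<close>

lemma bounded_scalar_curvature:
  fixes G :: "'a::euclidean_space \<Rightarrow> 'a \<Rightarrow> 'a \<Rightarrow> real" and C :: real
  assumes S: "thick S" and x: "x \<in> S" and G: "\<And>y. y \<in> S \<Longrightarrow> inner_product (G y)"
    and dgmet: "\<And>u v. (\<lambda>y. G y u v) differentiable_on S"
    and ddG: "\<And>u v h. (\<lambda>y. D S (\<lambda>y. G y u v) y h) differentiable_on S"
    and bil: "bilinear (ricci S G x)"
    and C: "\<And>u v w z. \<bar>G x (riemann S G x u v w) z\<bar>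
      \<le> C * sqrt (G x u u) * sqrt (G x v v) * sqrt (G x w w) * sqrt (G x z z)"
  shows "\<bar>scalar_curvature S G x\<bar> \<le> DIM('a) * (DIM('a) * C)"
proof -
  have dG': "(\<lambda>y. G y u v) differentiable (at y within S)" if "y \<in> S" for u v y
    using dgmet that by (simp add: differentiable_on_def)
  note bilG = inner_product_bilinear[OF G]
  have bch: "bilinear (christoffel S G y)" if "y \<in> S" for y
    using S that G dG'[OF that] by (rule bilinear_christoffel)
  \<comment> \<open>\<open>frechet_derivative\<close> is known to be linear only where a derivative
    exists, so the Christoffel symbols have to be differentiable before \<open>riemann\<close> is
    linear in its first slot.\<close>
  have dch: "(\<lambda>y. christoffel S G y u v) differentiable (at x within S)" for u v
  proof -
    have "(\<lambda>y. christoffel S G y u v) differentiable_on S"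
      unfolding christoffel_def
    proof (rule differentiable_on_riesz[OF S G linear_Koszul[OF S _ bilG dG'] dgmet])
      show "(\<lambda>y. (D S (\<lambda>y. G y v z) y u + D S (\<lambda>y. G y u z) y v - D S (\<lambda>y. G y u v) y z) / 2)
          differentiable_on S" for z
        using ddG unfolding differentiable_on_def
        by (auto intro!: differentiable_divide differentiable_add differentiable_diff)
    qed auto
    then show ?thesis using x by (simp add: differentiable_on_def)
  qed
  have lin: "linear (\<lambda>u. riemann S G x u v w)" for v w
  proof -
    have l1: "linear (\<lambda>u. D S (\<lambda>y. christoffel S G y v w) x u)" using dch by (rule linear_D)
    have l2: "linear (\<lambda>u. D S (\<lambda>y. christoffel S G y u w) x v)"
      by (rule linear_D_parameter[OF S x bilinear_linear_left[OF bch] dch])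
    show ?thesis
      unfolding riemann_def
      by (rule linearI) (simp_all add: linear_add[OF l1] linear_cmul[OF l1] linear_add[OF l2] linear_cmul[OF l2]
          bilinear_simps[OF bch[OF x]] algebra_simps)
  qed
  have "\<bar>ricci S G x v w\<bar> \<le> DIM('a) * C * sqrt (G x v v) * sqrt (G x w w)" for v w
  proof -
    have "\<bar>lin_trace (\<lambda>u. riemann S G x u v w)\<bar> \<le> DIM('a) * (C * sqrt (G x v v) * sqrt (G x w w))"
    proof (rule lin_trace_bound[OF G[OF x] lin])
      show "\<bar>G x (riemann S G x u v w) z\<bar>
        \<le> C * sqrt (G x v v) * sqrt (G x w w) * sqrt (G x u u) * sqrt (G x z z)" for u z
        using C[of u v w z] by (simp add: mult_ac)
    qed
    then show ?thesis by (simp add: ricci_def lin_trace_def mult.assoc)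
  qed
  then show ?thesis
    unfolding scalar_curvature_def by (rule metric_trace_bound[OF G[OF x] bil])
qed

section \<open>A Ricci flow over one coordinate domain\<close>

locale chart_flow =
  fixes U :: "'e::euclidean_space set" and T :: real and G :: "real \<Rightarrow> 'e \<Rightarrow> 'e \<Rightarrow> 'e \<Rightarrow> real"
  assumes open_U: "open U"
    and G_inner: "\<And>t y. t \<in> {0<..T} \<Longrightarrow> y \<in> U \<Longrightarrow> inner_product (G t y)"
    and G_smooth: "\<And>u v. smooth_on (U \<times> {0<..T}) (\<lambda>(y, t). G t y u v)"
    and G_ricci: "\<And>t y u v. t \<in> {0<..T} \<Longrightarrow> y \<in> U \<Longrightarrow>
      ((\<lambda>s. G s y u v) has_real_derivative - 2 * ricci U (G t) y u v) (at t within {0<..T})"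
begin

abbreviation \<Omega> where "\<Omega> \<equiv> U \<times> {0<..T}"

definition gmet :: "'e \<times> real \<Rightarrow> 'e \<Rightarrow> 'e \<Rightarrow> real" where
  "gmet p = G (snd p) (fst p)"

text \<open>The direction \<open>h\<close> lies in space-time: \<open>(y, 0)\<close> gives the
  spatial derivatives of the Koszul formula and \<open>(0, 1)\<close> the time derivative of the
  flow equation.\<close>

definition dgmet :: "'e \<times> real \<Rightarrow> 'e \<times> real \<Rightarrow> 'e \<Rightarrow> 'e \<Rightarrow> real" where
  "dgmet p h u v = D \<Omega> (\<lambda>q. gmet q u v) p h"

text \<open>Time-derivative form of the Ricci tensor; see \<open>ricci_eq_Ric\<close>.\<close>

definition Ric :: "'e \<times> real \<Rightarrow> 'e \<Rightarrow> 'e \<Rightarrow> real" where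
  "Ric p u v = - dgmet p (0, 1) u v / 2"

definition scal :: "'e \<times> real \<Rightarrow> real" where
  "scal p = metric_trace (gmet p) (Ric p)"

lemma thick_U: "thick U" using open_U by (rule thick_open)

lemma thick_\<Omega>: "thick \<Omega>"
  using open_U by (intro thick_openin_halfspace[of T])
    (auto simp: openin_open intro!: exI[of _ "U \<times> UNIV"] open_Times)

lemma gmet_inner: "p \<in> \<Omega> \<Longrightarrow> inner_product (gmet p)"
  using G_inner by (auto simp: gmet_def)

lemma gmet_smooth: "smooth_on \<Omega> (\<lambda>p. gmet p u v)"
  using G_smooth[of u v] by (simp add: gmet_def case_prod_unfold)

lemmas gmet_bilinear = inner_product_bilinear[OF gmet_inner]

lemma gmet_has_derivative: "p \<in> \<Omega> \<Longrightarrow> ((\<lambda>q. gmet q u v) has_derivative (\<lambda>h. dgmet p h u v)) (at p within \<Omega>)"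
  unfolding dgmet_def by (intro D_works smooth_on_differentiable[OF gmet_smooth])

lemma dgmet_smooth: "smooth_on \<Omega> (\<lambda>p. dgmet p h u v)"
  unfolding dgmet_def by (intro smooth_on_D gmet_smooth)

lemma dgmet_bilinear: "p \<in> \<Omega> \<Longrightarrow> bilinear (dgmet p h)"
  unfolding dgmet_def[abs_def]
  by (intro bilinear_D_parameter[OF thick_\<Omega>] gmet_bilinear smooth_on_differentiable[OF gmet_smooth])

lemma dgmet_linear: "p \<in> \<Omega> \<Longrightarrow> linear (\<lambda>h. dgmet p h u v)"
  unfolding dgmet_def by (intro linear_D smooth_on_differentiable[OF gmet_smooth])

lemma dgmet_split:
  assumes "p \<in> \<Omega>" shows "dgmet p (y, s) u v = dgmet p (y, 0) u v + s * dgmet p (0, 1) u v"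
proof -
  have "dgmet p ((y, 0) + s *\<^sub>R (0, 1)) u v = dgmet p (y, 0) u v + s * dgmet p (0, 1) u v"
    by (simp only: linear_add[OF dgmet_linear[OF assms]] linear_cmul[OF dgmet_linear[OF assms]] real_scaleR_def)
  then show ?thesis by simp
qed

text \<open>The derivative in time of one metric component within \<open>{0<..T}\<close> is computed
  twice, by restricting the space-time derivative and from the flow equation; uniqueness of the
  derivative equates the results.\<close>

lemma ricci_eq_Ric:
  assumes "(y, t) \<in> \<Omega>" shows "ricci U (G t) y u v = Ric (y, t) u v"
proof -
  have t: "t \<in> {0<..T}" "y \<in> U" using assms by auto
  have "((\<lambda>s. gmet (y, s) u v) has_derivative (\<lambda>s. dgmet (y, t) (0, s) u v)) (at t within {s. (y, s) \<in> \<Omega>})"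
    by (rule has_derivative_slice_snd[OF gmet_has_derivative[OF assms]])
  then have d1: "((\<lambda>s. G s y u v) has_derivative (\<lambda>s. dgmet (y, t) (0, s) u v)) (at t within {0<..T})"
    using t by (simp add: gmet_def greaterThanAtMost_def greaterThan_def atMost_def Int_def)
  have d2: "((\<lambda>s. G s y u v) has_derivative (\<lambda>s. - 2 * ricci U (G t) y u v * s)) (at t within {0<..T})"
    using G_ricci[OF t, of u v] unfolding has_field_derivative_def .
  have "dgmet (y, t) (0, 1) u v = - 2 * ricci U (G t) y u v"
    using D_eqI[OF thick_greaterThanAtMost t(1) d1, of 1] D_eqI[OF thick_greaterThanAtMost t(1) d2, of 1] by simp
  then show ?thesis by (simp add: Ric_def)
qed

lemma Ric_bilinear: "p \<in> \<Omega> \<Longrightarrow> bilinear (Ric p)"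
  unfolding Ric_def[abs_def] bilinear_def
  by (intro conjI allI linearI) (simp_all add: bilinear_simps[OF dgmet_bilinear] field_simps)

lemma scalar_curvature_eq_scal:
  assumes "(y, t) \<in> \<Omega>" shows "scalar_curvature U (G t) y = scal (y, t)"
proof -
  have "ricci U (G t) y = Ric (y, t)" using ricci_eq_Ric[OF assms] by (intro ext)
  then show ?thesis by (simp add: scalar_curvature_def scal_def gmet_def)
qed

lemma scal_eq: "p \<in> \<Omega> \<Longrightarrow> scal p = - (\<Sum>b\<in>Basis. riesz (gmet p) (dgmet p (0, 1) b) \<bullet> b) / 2"
  unfolding scal_def metric_trace_def Ric_def[abs_def]
  using riesz_scale[OF gmet_inner bilinear_linear_right[OF dgmet_bilinear], of p p "- 1 / 2"]
  by (simp add: sum_negf sum_divide_distrib)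

text \<open>In the form of \<open>scal_eq\<close> the scalar curvature is a sum of coordinates of
  \<open>riesz\<close> vectors with smooth data and inherits their C^1 regularity; no derivative of
  \<open>riemann\<close> is taken.\<close>

lemma scal_has_derivative: "p \<in> \<Omega> \<Longrightarrow> (scal has_derivative D \<Omega> scal p) (at p within \<Omega>)"
  and continuous_on_D_scal: "continuous_on \<Omega> (\<lambda>p. D \<Omega> scal p h)"
  and continuous_on_scal: "continuous_on \<Omega> scal"
proof -
  let ?w = "\<lambda>b p. riesz (gmet p) (dgmet p (0, 1) b)"
  note lin = bilinear_linear_right[OF dgmet_bilinear]
  have w: "?w b differentiable_on \<Omega>" for b
    by (intro differentiable_on_riesz[OF thick_\<Omega> gmet_inner lin] smooth_on_differentiable_on gmet_smooth dgmet_smooth)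
  have cw: "continuous_on \<Omega> (\<lambda>p. D \<Omega> (?w b) p h)" for b h
    by (rule continuous_on_D_riesz[OF thick_\<Omega> gmet_inner lin gmet_smooth dgmet_smooth])
  have wd: "(?w b has_derivative D \<Omega> (?w b) p) (at p within \<Omega>)" if "p \<in> \<Omega>" for b p
    using w that by (intro D_works) (auto simp: differentiable_on_def)
  have d: "(scal has_derivative (\<lambda>h. - (\<Sum>b\<in>Basis. D \<Omega> (?w b) p h \<bullet> b) / 2)) (at p within \<Omega>)" if p: "p \<in> \<Omega>" for p
    by (rule has_derivative_transform[OF p scal_eq])
      (auto intro!: derivative_eq_intros wd p)
  then show *: "(scal has_derivative D \<Omega> scal p) (at p within \<Omega>)" if "p \<in> \<Omega>" for p
    using that by (intro D_works) (auto simp: differentiable_def)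
  have "D \<Omega> scal p h = - (\<Sum>b\<in>Basis. D \<Omega> (?w b) p h \<bullet> b) / 2" if "p \<in> \<Omega>" for p h
    by (rule D_eqI[OF thick_\<Omega> that d[OF that]])
  moreover have "continuous_on \<Omega> (\<lambda>p. - (\<Sum>b\<in>Basis. D \<Omega> (?w b) p h \<bullet> b) / 2)" for h
    by (intro continuous_intros cw) simp
  ultimately show "continuous_on \<Omega> (\<lambda>p. D \<Omega> scal p h)" for h
    by (simp cong: continuous_on_cong)
  show "continuous_on \<Omega> scal"
    using * by (rule has_derivative_continuous_on)
qed

lemma D_slice_G:
  assumes "(y, t) \<in> \<Omega>" shows "D U (\<lambda>y. G t y u v) y h = dgmet (y, t) (h, 0) u v"
    and "((\<lambda>y. G t y u v) has_derivative (\<lambda>h. dgmet (y, t) (h, 0) u v)) (at y within U)"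
proof -
  have "((\<lambda>y. gmet (y, t) u v) has_derivative (\<lambda>h. dgmet (y, t) (h, 0) u v)) (at y within {y. (y, t) \<in> \<Omega>})"
    by (rule has_derivative_slice_fst[OF gmet_has_derivative[OF assms]])
  then show *: "((\<lambda>y. G t y u v) has_derivative (\<lambda>h. dgmet (y, t) (h, 0) u v)) (at y within U)"
    using assms by (simp add: gmet_def)
  show "D U (\<lambda>y. G t y u v) y h = dgmet (y, t) (h, 0) u v"
    by (rule D_eqI[OF thick_U _ *]) (use assms in auto)
qed

lemma scal_bound:
  fixes C :: real
  assumes p: "(y, t) \<in> \<Omega>"
    and C: "\<And>u v w z. \<bar>G t y (riemann U (G t) y u v w) z\<bar>
      \<le> C * sqrt (G t y u u) * sqrt (G t y v v) * sqrt (G t y w w) * sqrt (G t y z z)"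
  shows "\<bar>scal (y, t)\<bar> \<le> DIM('e) * (DIM('e) * C)"
proof -
  have t: "t \<in> {0<..T}" "y \<in> U" using p by auto
  have "\<bar>scalar_curvature U (G t) y\<bar> \<le> DIM('e) * (DIM('e) * C)"
  proof (rule bounded_scalar_curvature[where S = U and x = y and G = "G t" and C = C])
    show "thick U" "y \<in> U" by (fact thick_U t)+
    show "inner_product (G t z)" if "z \<in> U" for z using t(1) that by (rule G_inner)
    show "\<bar>G t y (riemann U (G t) y u v w) z\<bar>
      \<le> C * sqrt (G t y u u) * sqrt (G t y v v) * sqrt (G t y w w) * sqrt (G t y z z)" for u v w z
      by (rule C)
    show "(\<lambda>y. G t y u v) differentiable_on U" for u v
      using D_slice_G(2) t unfolding differentiable_on_def differentiable_def by blast
    show "(\<lambda>y. D U (\<lambda>y. G t y u v) y h) differentiable_on U" for u v h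
      unfolding differentiable_on_def
    proof
      fix y assume y: "y \<in> U"
      have "((\<lambda>y. dgmet (y, t) (h, 0) u v) has_derivative
          (\<lambda>k. D \<Omega> (\<lambda>p. dgmet p (h, 0) u v) (y, t) (k, 0))) (at y within {y. (y, t) \<in> \<Omega>})"
        by (rule has_derivative_slice_fst[OF D_works[OF smooth_on_differentiable[OF dgmet_smooth]]])
          (use t y in auto)
      then have "((\<lambda>y. dgmet (y, t) (h, 0) u v) has_derivative
          (\<lambda>k. D \<Omega> (\<lambda>p. dgmet p (h, 0) u v) (y, t) (k, 0))) (at y within U)"
        using t by simp
      note d = this
      have "D U (\<lambda>y. G t y u v) z h = dgmet (z, t) (h, 0) u v" if "z \<in> U" for z
        using t that by (intro D_slice_G(1)) auto
      from differentiableI[OF has_derivative_transform[OF y this d]]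
      show "(\<lambda>y. D U (\<lambda>y. G t y u v) y h) differentiable (at y within U)" .
    qed
    have "ricci U (G t) y = Ric (y, t)" using ricci_eq_Ric[OF p] by (intro ext)
    then show "bilinear (ricci U (G t) y)" using Ric_bilinear[OF p] by simp
  qed
  then show ?thesis by (simp add: scalar_curvature_eq_scal[OF p])
qed

end

section \<open>Mean curvature flow in a pair of charts\<close>

lemma bilinear_expand:
  fixes B :: "'a::euclidean_space \<Rightarrow> 'a \<Rightarrow> real"
  assumes "bilinear B"
  shows "B u v = (\<Sum>i\<in>Basis. \<Sum>j\<in>Basis. (u \<bullet> i) * (v \<bullet> j) * B i j)"
  by (subst linear_expand[OF bilinear_linear_left[OF assms]],
      subst linear_expand[OF bilinear_linear_right[OF assms]])
    (simp add: sum_distrib_left mult.assoc)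

lemma continuous_on_bilinear_family:
  fixes B :: "'c::topological_space \<Rightarrow> 'a::euclidean_space \<Rightarrow> 'a \<Rightarrow> real"
  assumes "\<And>x. x \<in> S \<Longrightarrow> bilinear (B (q x))" "\<And>u v. continuous_on \<Omega> (\<lambda>y. B y u v)"
    and q: "continuous_on S q" "\<And>x. x \<in> S \<Longrightarrow> q x \<in> \<Omega>"
    and "continuous_on S a" "continuous_on S b"
  shows "continuous_on S (\<lambda>x. B (q x) (a x) (b x))"
proof -
  have "continuous_on S (\<lambda>x. B (q x) u v)" for u v
    using continuous_on_compose2[OF assms(2) q(1)] q(2) by (auto simp: image_subset_iff)
  then have "continuous_on S (\<lambda>x. \<Sum>i\<in>Basis. \<Sum>j\<in>Basis. (a x \<bullet> i) * (b x \<bullet> j) * B (q x) i j)"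
    by (intro continuous_intros assms)
  moreover have "B (q x) (a x) (b x) = (\<Sum>i\<in>Basis. \<Sum>j\<in>Basis. (a x \<bullet> i) * (b x \<bullet> j) * B (q x) i j)" if "x \<in> S" for x
    using assms(1)[OF that] by (rule bilinear_expand)
  ultimately show ?thesis by (simp cong: continuous_on_cong)
qed

lemma has_derivative_bilinear_family:
  fixes B :: "'c::euclidean_space \<Rightarrow> 'a::euclidean_space \<Rightarrow> 'a \<Rightarrow> real"
  assumes x: "x \<in> S" and B: "\<And>y. y \<in> S \<Longrightarrow> bilinear (B y)" "\<And>h. bilinear (B' h)"
    and dB: "\<And>u v. ((\<lambda>y. B y u v) has_derivative (\<lambda>h. B' h u v)) (at x within S)"
    and da: "(a has_derivative a') (at x within S)" and db: "(b has_derivative b') (at x within S)"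
  shows "((\<lambda>y. B y (a y) (b y)) has_derivative
    (\<lambda>h. B' h (a x) (b x) + B x (a' h) (b x) + B x (a x) (b' h))) (at x within S)"
proof (rule has_derivative_transform[OF x bilinear_expand[OF B(1)]])
  have "((\<lambda>y. \<Sum>i\<in>Basis. \<Sum>j\<in>Basis. (a y \<bullet> i) * (b y \<bullet> j) * B y i j) has_derivative
     (\<lambda>h. \<Sum>i\<in>Basis. \<Sum>j\<in>Basis. (a x \<bullet> i) * (b x \<bullet> j) * B' h i j
        + ((a x \<bullet> i) * (b' h \<bullet> j) + (a' h \<bullet> i) * (b x \<bullet> j)) * B x i j)) (at x within S)"
    by (intro has_derivative_sum has_derivative_mult has_derivative_inner_left dB da db)
  moreover have "(\<Sum>i\<in>Basis. \<Sum>j\<in>Basis. (a x \<bullet> i) * (b x \<bullet> j) * B' h i j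
        + ((a x \<bullet> i) * (b' h \<bullet> j) + (a' h \<bullet> i) * (b x \<bullet> j)) * B x i j)
      = B' h (a x) (b x) + B x (a' h) (b x) + B x (a x) (b' h)" for h
    unfolding bilinear_expand[OF B(2), of h "a x" "b x"] bilinear_expand[OF B(1)[OF x], of "a' h" "b x"]
      bilinear_expand[OF B(1)[OF x], of "a x" "b' h"]
    by (simp add: sum.distrib[symmetric] algebra_simps)
  ultimately show "((\<lambda>y. \<Sum>i\<in>Basis. \<Sum>j\<in>Basis. (a y \<bullet> i) * (b y \<bullet> j) * B y i j) has_derivative
    (\<lambda>h. B' h (a x) (b x) + B x (a' h) (b x) + B x (a x) (b' h))) (at x within S)"
    by simp
qed

text \<open>The flow in one chart of \<open>M\<close> and one of \<open>O\<close>. The set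
  \<open>S\<close> of coordinates and times where this pair of charts applies need not be a product,
  since points may enter and leave the ambient chart.\<close>

locale track_flow = chart_flow U T G
  for U :: "'e::euclidean_space set" and T :: real and G :: "real \<Rightarrow> 'e \<Rightarrow> 'e \<Rightarrow> 'e \<Rightarrow> real" +
  fixes S :: "('d::euclidean_space \<times> real) set" and f :: "'d \<times> real \<Rightarrow> 'e" and \<nu> :: "'d \<times> real \<Rightarrow> 'e"
  assumes S_open: "openin (top_of_set (UNIV \<times> {0<..T})) S"
    and f_in: "\<And>p. p \<in> S \<Longrightarrow> f p \<in> U"
    and f_smooth: "smooth_on S f" and \<nu>_smooth: "smooth_on S \<nu>"
    and dim: "DIM('e) = DIM('d) + 1"
    and f_inj: "\<And>\<xi> t. (\<xi>, t) \<in> S \<Longrightarrow> inj (frechet_derivative (\<lambda>\<xi>. f (\<xi>, t)) (at \<xi>))"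
    and normal: "\<And>\<xi> t. (\<xi>, t) \<in> S \<Longrightarrow>
      unit_normal_at (G t) {\<xi>. (\<xi>, t) \<in> S} (\<lambda>\<xi>. f (\<xi>, t)) \<xi> (\<nu> (\<xi>, t))"
    and mcf: "\<And>\<xi> t. (\<xi>, t) \<in> S \<Longrightarrow> ((\<lambda>s. f (\<xi>, s)) has_vector_derivative
      - mean_curvature U (G t) {\<xi>. (\<xi>, t) \<in> S} (\<lambda>\<xi>. f (\<xi>, t)) (\<nu> (\<xi>, t)) \<xi> *\<^sub>R \<nu> (\<xi>, t))
      (at t within {0<..T})"
begin

definition Df :: "'d \<times> real \<Rightarrow> 'd \<times> real \<Rightarrow> 'e" where "Df p h = D S f p h"
definition DDf :: "'d \<times> real \<Rightarrow> 'd \<times> real \<Rightarrow> 'd \<times> real \<Rightarrow> 'e" where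
  "DDf p h k = D S (\<lambda>p. Df p h) p k"
definition A :: "'d \<times> real \<Rightarrow> 'd \<Rightarrow> 'e" where "A p u = Df p (u, 0)"
definition q :: "'d \<times> real \<Rightarrow> 'e \<times> real" where "q p = (f p, snd p)"
definition H :: "'d \<times> real \<Rightarrow> real" where "H p = - gmet (q p) (Df p (0, 1)) (\<nu> p)"
definition K :: "'d \<times> real \<Rightarrow> real" where "K p = Ric (q p) (\<nu> p) (\<nu> p)"
definition Ht :: "'d \<times> real \<Rightarrow> real" where "Ht p = D S H p (0, 1)"
text \<open>A derivative of metric components, hence dependent on the chart. It enters through the
  acceleration and through the Christoffel terms, and the two contributions cancel in
  \<open>sff_tt\<close>.\<close>

definition X :: "'d \<times> real \<Rightarrow> real" where "X p = dgmet (q p) (\<nu> p, 0) (\<nu> p) (\<nu> p)"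

lemma thick_S: "thick S" using S_open by (rule thick_openin_halfspace)

lemma S_sub: "p \<in> S \<Longrightarrow> snd p \<in> {0<..T}"
  using openin_imp_subset[OF S_open] by auto

lemma open_slice: "open {\<xi>. (\<xi>, t) \<in> S}"
proof (cases "t \<in> {0<..T}")
  case True
  obtain W where W: "open W" "S = (UNIV \<times> {0<..T}) \<inter> W" using S_open by (auto simp: openin_open)
  have "{\<xi>. (\<xi>, t) \<in> S} = (\<lambda>\<xi>. (\<xi>, t)) -` W" using True W by auto
  also have "open \<dots>" by (intro open_vimage W continuous_intros)
  finally show ?thesis .
next
  case False
  then have "{\<xi>. (\<xi>, t) \<in> S} = {}" using S_sub by auto
  then show ?thesis by simp
qed

text \<open>Membership in \<open>S\<close> is an open condition on times within
  \<open>{0<..T}\<close>, so the slice and the interval agree near \<open>t\<close>. Restricted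
  space-time derivatives thus become comparable with the derivative in the flow equation.\<close>

lemma at_within_time_slice:
  assumes "(\<xi>, t) \<in> S" shows "at t within {s. (\<xi>, s) \<in> S} = at t within {0<..T}"
proof -
  obtain W where W: "open W" "S = (UNIV \<times> {0<..T}) \<inter> W" using S_open by (auto simp: openin_open)
  have "open ((\<lambda>s. (\<xi>, s)) -` W)" by (intro open_vimage W continuous_intros)
  then show ?thesis
    by (rule at_within_nhd[rotated]) (use assms W in auto)
qed

lemma time_has_derivative:
  assumes "(h has_derivative h') (at (\<xi>, t) within S)" "(\<xi>, t) \<in> S"
  shows "((\<lambda>s. h (\<xi>, s)) has_derivative (\<lambda>s. h' (0, s))) (at t within {0<..T})"
  using has_derivative_slice_snd[OF assms(1)] unfolding at_within_time_slice[OF assms(2)] .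

lemma q_in: "p \<in> S \<Longrightarrow> q p \<in> \<Omega>" using f_in S_sub by (auto simp: q_def mem_Times_iff)

lemma f_has_derivative: "p \<in> S \<Longrightarrow> (f has_derivative Df p) (at p within S)"
  unfolding Df_def[abs_def] by (intro D_works smooth_on_differentiable[OF f_smooth])

lemma Df_smooth: "smooth_on S (\<lambda>p. Df p h)"
  unfolding Df_def by (intro smooth_on_D f_smooth)

lemma Df_has_derivative: "p \<in> S \<Longrightarrow> ((\<lambda>p. Df p h) has_derivative DDf p h) (at p within S)"
  unfolding DDf_def[abs_def] by (intro D_works smooth_on_differentiable[OF Df_smooth])

lemma linear_Df: "p \<in> S \<Longrightarrow> linear (Df p)"
  using f_has_derivative has_derivative_linear by blast

lemma DDf_bilinear: "p \<in> S \<Longrightarrow> bilinear (DDf p)"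
  unfolding bilinear_def DDf_def[abs_def]
  using linear_D_parameter[OF thick_S _ linear_Df smooth_on_differentiable[OF Df_smooth]]
    linear_D[OF smooth_on_differentiable[OF Df_smooth]]
  by auto

lemma q_has_derivative: "p \<in> S \<Longrightarrow> (q has_derivative (\<lambda>h. (Df p h, snd h))) (at p within S)"
  unfolding q_def[abs_def]
  by (intro has_derivative_Pair f_has_derivative has_derivative_snd has_derivative_ident)

lemma D_q: "p \<in> S \<Longrightarrow> D S q p h = (Df p h, snd h)"
  by (intro D_eqI[OF thick_S _ q_has_derivative])

lemma slice_has_derivative:
  "(\<xi>, t) \<in> S \<Longrightarrow> ((\<lambda>\<xi>. f (\<xi>, t)) has_derivative A (\<xi>, t)) (at \<xi> within {\<xi>. (\<xi>, t) \<in> S})"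
  unfolding A_def[abs_def] by (intro has_derivative_slice_fst f_has_derivative)

lemma D_slice:
  assumes "(\<xi>, t) \<in> S" shows "D {\<xi>. (\<xi>, t) \<in> S} (\<lambda>\<xi>. f (\<xi>, t)) \<xi> u = A (\<xi>, t) u"
  by (rule D_eqI[OF thick_open[OF open_slice] _ slice_has_derivative]) (use assms in auto)

lemma linear_A: "p \<in> S \<Longrightarrow> linear (A p)"
  using has_derivative_linear[OF slice_has_derivative[of "fst p" "snd p"]] by simp

lemma inj_A:
  assumes "p \<in> S" shows "inj (A p)"
proof -
  obtain \<xi> t where p: "p = (\<xi>, t)" by force
  have S: "(\<xi>, t) \<in> S" using assms p by blast
  have "at \<xi> within {\<xi>. (\<xi>, t) \<in> S} = at \<xi>"
    by (rule at_within_open[OF _ open_slice]) (simp add: S)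
  with slice_has_derivative[OF S] have "((\<lambda>\<xi>. f (\<xi>, t)) has_derivative A p) (at \<xi>)"
    unfolding p by metis
  then have "frechet_derivative (\<lambda>\<xi>. f (\<xi>, t)) (at \<xi>) = A p"
    by (rule frechet_derivative_at[symmetric])
  then show ?thesis using f_inj[OF S] by metis
qed

lemma \<nu>_unit: "p \<in> S \<Longrightarrow> gmet (q p) (\<nu> p) (\<nu> p) = 1"
  and \<nu>_normal: "p \<in> S \<Longrightarrow> gmet (q p) (A p u) (\<nu> p) = 0"
  using normal[of "fst p" "snd p"] D_slice[of "fst p" "snd p"]
  by (simp_all add: unit_normal_at_def gmet_def q_def)

lemma \<nu>_normal': "p \<in> S \<Longrightarrow> gmet (q p) (\<nu> p) (A p u) = 0"
  using \<nu>_normal[of p u] inner_product_commute[OF gmet_inner[OF q_in], of p "A p u" "\<nu> p"] by simp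

text \<open>The flow equation makes the velocity a multiple of \<nu>, and pairing with the unit
  vector \<nu> identifies the factor. The mean curvature is thereby available from first derivatives
  of \<open>f\<close> alone.\<close>

lemma Df_time:
  assumes "(\<xi>, t) \<in> S"
  shows "mean_curvature U (G t) {\<xi>. (\<xi>, t) \<in> S} (\<lambda>\<xi>. f (\<xi>, t)) (\<nu> (\<xi>, t)) \<xi> = H (\<xi>, t)"
    and "Df (\<xi>, t) (0, 1) = - H (\<xi>, t) *\<^sub>R \<nu> (\<xi>, t)"
proof -
  let ?m = "mean_curvature U (G t) {\<xi>. (\<xi>, t) \<in> S} (\<lambda>\<xi>. f (\<xi>, t)) (\<nu> (\<xi>, t)) \<xi>"
  note 1 = time_has_derivative[OF f_has_derivative[OF assms] assms]
  note 2 = mcf[OF assms, unfolded has_vector_derivative_def]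
  have t: "t \<in> {0<..T}" using S_sub[OF assms] by simp
  have e: "Df (\<xi>, t) (0, 1) = - ?m *\<^sub>R \<nu> (\<xi>, t)"
    using D_eqI[OF thick_greaterThanAtMost t 1, of 1] D_eqI[OF thick_greaterThanAtMost t 2, of 1] by simp
  then show "?m = H (\<xi>, t)"
    using \<nu>_unit[OF assms] by (simp add: H_def bilinear_simps[OF gmet_bilinear[OF q_in[OF assms]]])
  with e show "Df (\<xi>, t) (0, 1) = - H (\<xi>, t) *\<^sub>R \<nu> (\<xi>, t)" by simp
qed

lemma Df_eq:
  assumes "p \<in> S" shows "Df p (u, s) = A p u - (s * H p) *\<^sub>R \<nu> p"
proof -
  have "Df p ((u, 0) + s *\<^sub>R (0, 1)) = A p u + s *\<^sub>R Df p (0, 1)"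
    unfolding A_def by (simp only: linear_add[OF linear_Df[OF assms]] linear_cmul[OF linear_Df[OF assms]])
  then show ?thesis using Df_time(2)[of "fst p" "snd p"] assms by simp
qed

text \<open>The second fundamental form of \<open>M\<^sub>t\<close>, with the Christoffel term expanded by the Koszul formula.\<close>

definition sff :: "'d \<times> real \<Rightarrow> 'd \<Rightarrow> 'd \<Rightarrow> real" where
  "sff p u v = - gmet (q p) (DDf p (v, 0) (u, 0)) (\<nu> p)
     - (dgmet (q p) (A p u, 0) (A p v) (\<nu> p) + dgmet (q p) (A p v, 0) (A p u) (\<nu> p)
        - dgmet (q p) (\<nu> p, 0) (A p u) (A p v)) / 2"

lemma sff_bilinear: "p \<in> S \<Longrightarrow> bilinear (sff p)"
proof -
  assume p: "p \<in> S"
  note g = bilinear_simps[OF gmet_bilinear[OF q_in[OF p]]] bilinear_simps[OF dgmet_bilinear[OF q_in[OF p]]]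
    linear_add[OF linear_A[OF p]] linear_cmul[OF linear_A[OF p]]
  have dl: "dgmet (q p) (x + y, 0) u v = dgmet (q p) (x, 0) u v + dgmet (q p) (y, 0) u v"
    "dgmet (q p) (c *\<^sub>R x, 0) u v = c * dgmet (q p) (x, 0) u v" for x y c u v
    using linear_add[OF dgmet_linear[OF q_in[OF p], of u v], of "(x, 0)" "(y, 0)"]
      linear_cmul[OF dgmet_linear[OF q_in[OF p], of u v], of c "(x, 0)"] by simp_all
  have d: "DDf p (x + y, 0) k = DDf p (x, 0) k + DDf p (y, 0) k" "DDf p (c *\<^sub>R x, 0) k = c *\<^sub>R DDf p (x, 0) k"
    "DDf p h (x + y, 0) = DDf p h (x, 0) + DDf p h (y, 0)" "DDf p h (c *\<^sub>R x, 0) = c *\<^sub>R DDf p h (x, 0)" for x y c k h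
    using bilinear_ladd[OF DDf_bilinear[OF p], of "(x, 0)" "(y, 0)" k] bilinear_lmul[OF DDf_bilinear[OF p], of c "(x, 0)" k]
      bilinear_radd[OF DDf_bilinear[OF p], of h "(x, 0)" "(y, 0)"] bilinear_rmul[OF DDf_bilinear[OF p], of h c "(x, 0)"]
    by simp_all
  show ?thesis
    unfolding bilinear_def sff_def
    by (intro conjI allI linearI) (simp_all add: g dl d field_simps)
qed

lemma second_fundamental_form_eq:
  assumes p: "(\<xi>, t) \<in> S"
  shows "second_fundamental_form U (G t) {\<xi>. (\<xi>, t) \<in> S} (\<lambda>\<xi>. f (\<xi>, t)) (\<nu> (\<xi>, t)) \<xi> u v = sff (\<xi>, t) u v"
proof -
  let ?S = "{\<xi>. (\<xi>, t) \<in> S}"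
  have t: "t \<in> {0<..T}" using S_sub[OF p] by simp
  have U: "f (\<xi>, t) \<in> U" using f_in[OF p] .
  have \<Omega>: "(f (\<xi>, t), t) \<in> \<Omega>" using t U by simp
  have "((\<lambda>\<xi>. Df (\<xi>, t) (v, 0)) has_derivative (\<lambda>u. DDf (\<xi>, t) (v, 0) (u, 0))) (at \<xi> within ?S)"
    by (rule has_derivative_slice_fst[OF Df_has_derivative[OF p]])
  then have "((\<lambda>\<xi>. D ?S (\<lambda>\<xi>. f (\<xi>, t)) \<xi> v) has_derivative (\<lambda>u. DDf (\<xi>, t) (v, 0) (u, 0))) (at \<xi> within ?S)"
    by (rule has_derivative_transform[rotated 2]) (use p in \<open>auto simp: D_slice A_def\<close>)
  then have 1: "D ?S (\<lambda>\<xi>. D ?S (\<lambda>\<xi>. f (\<xi>, t)) \<xi> v) \<xi> u = DDf (\<xi>, t) (v, 0) (u, 0)"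
    by (intro D_eqI[OF thick_open[OF open_slice]]) (use p in auto)
  have 2: "G t (f (\<xi>, t)) (christoffel U (G t) (f (\<xi>, t)) (A (\<xi>, t) u) (A (\<xi>, t) v)) (\<nu> (\<xi>, t))
    = (dgmet (q (\<xi>, t)) (A (\<xi>, t) u, 0) (A (\<xi>, t) v) (\<nu> (\<xi>, t)) + dgmet (q (\<xi>, t)) (A (\<xi>, t) v, 0) (A (\<xi>, t) u) (\<nu> (\<xi>, t))
        - dgmet (q (\<xi>, t)) (\<nu> (\<xi>, t), 0) (A (\<xi>, t) u) (A (\<xi>, t) v)) / 2"
    by (subst christoffel_pairing[OF thick_U U G_inner[OF t] differentiableI[OF D_slice_G(2)[OF \<Omega>]]])
      (simp_all add: D_slice_G(1)[OF \<Omega>] q_def)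
  show ?thesis
    unfolding second_fundamental_form_def cov_deriv_along_def sff_def 1 D_slice[OF p]
    using 2 by (simp add: bilinear_ladd[OF inner_product_bilinear[OF G_inner[OF t U]]] gmet_def q_def)
qed

lemma trace_sff:
  assumes "p \<in> S"
  shows "metric_trace (\<lambda>u v. gmet (q p) (A p u) (A p v)) (sff p) = H p"
proof -
  obtain \<xi> t where p: "p = (\<xi>, t)" by force
  have "induced_metric (G t) {\<xi>. (\<xi>, t) \<in> S} (\<lambda>\<xi>. f (\<xi>, t)) \<xi> = (\<lambda>u v. gmet (q p) (A p u) (A p v))"
    using assms by (intro ext) (simp add: induced_metric_def D_slice p gmet_def q_def)
  moreover have "second_fundamental_form U (G t) {\<xi>. (\<xi>, t) \<in> S} (\<lambda>\<xi>. f (\<xi>, t)) (\<nu> (\<xi>, t)) \<xi> = sff p"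
    using assms second_fundamental_form_eq[of \<xi> t] by (intro ext) (simp add: p)
  ultimately show ?thesis
    using Df_time(1)[of \<xi> t] assms by (simp add: mean_curvature_def p)
qed

lemma gmet_along:
  assumes p: "p \<in> S" and "(a has_derivative a') (at p within S)" "(b has_derivative b') (at p within S)"
  shows "((\<lambda>p. gmet (q p) (a p) (b p)) has_derivative
    (\<lambda>h. dgmet (q p) (Df p h, snd h) (a p) (b p) + gmet (q p) (a' h) (b p) + gmet (q p) (a p) (b' h))) (at p within S)"
  by (rule has_derivative_bilinear_family[OF p gmet_bilinear[OF q_in] dgmet_bilinear[OF q_in[OF p]] _ assms(2,3)], assumption)
    (rule has_derivative_chain_within[OF q_has_derivative[OF p] q_in gmet_has_derivative[OF q_in[OF p]]])

lemma \<nu>_has_derivative: "p \<in> S \<Longrightarrow> (\<nu> has_derivative D S \<nu> p) (at p within S)"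
  by (intro D_works smooth_on_differentiable[OF \<nu>_smooth])

lemma H_has_derivative:
  assumes "p \<in> S"
  shows "(H has_derivative D S H p) (at p within S)"
    and "D S H p h = - (dgmet (q p) (Df p h, snd h) (Df p (0, 1)) (\<nu> p) + gmet (q p) (DDf p (0, 1) h) (\<nu> p)
      + gmet (q p) (Df p (0, 1)) (D S \<nu> p h))"
proof -
  note d = has_derivative_minus[OF gmet_along[OF assms Df_has_derivative[OF assms] \<nu>_has_derivative[OF assms]]]
  then show "(H has_derivative D S H p) (at p within S)"
    unfolding H_def[abs_def] by (intro D_works differentiableI)
  show "D S H p h = - (dgmet (q p) (Df p h, snd h) (Df p (0, 1)) (\<nu> p) + gmet (q p) (DDf p (0, 1) h) (\<nu> p)
      + gmet (q p) (Df p (0, 1)) (D S \<nu> p h))"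
    unfolding H_def[abs_def] by (rule D_eqI[OF thick_S assms d])
qed

lemma dgmet_smult: "p \<in> \<Omega> \<Longrightarrow> dgmet p (c *\<^sub>R y, 0) u v = c * dgmet p (y, 0) u v"
  using linear_cmul[OF dgmet_linear[of p u v], of c "(y, 0)"] by simp

text \<open>Differentiate \<open>H = -g(\<partial>\<^sub>tF, \<nu>)\<close> and \<open>g(\<nu>, \<nu>) = 1\<close> in time and eliminate \<open>g(\<nu>, \<partial>\<^sub>t\<nu>)\<close>.\<close>

lemma acceleration:
  assumes p: "p \<in> S"
  shows "gmet (q p) (DDf p (0, 1) (0, 1)) (\<nu> p) = - Ht p - H p * K p - (H p)\<^sup>2 * X p / 2"
proof -
  note g = bilinear_simps[OF gmet_bilinear[OF q_in[OF p]]] bilinear_simps[OF dgmet_bilinear[OF q_in[OF p]]]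
  have Dt: "Df p (0, 1) = - H p *\<^sub>R \<nu> p" using Df_eq[OF p, of 0 1] linear_0[OF linear_A[OF p]] by simp
  have K: "dgmet (q p) (0, 1) (\<nu> p) (\<nu> p) = - 2 * K p" by (simp add: K_def Ric_def)
  have V: "dgmet (q p) (- H p *\<^sub>R \<nu> p, 1) (\<nu> p) (\<nu> p) = - H p * X p - 2 * K p"
    by (subst dgmet_split[OF q_in[OF p]], subst dgmet_smult[OF q_in[OF p]]) (simp add: K X_def)
  have "((\<lambda>p. gmet (q p) (\<nu> p) (\<nu> p)) has_derivative (\<lambda>h. 0)) (at p within S)"
    by (rule has_derivative_transform[OF p \<nu>_unit has_derivative_const])
  then have "D S (\<lambda>p. gmet (q p) (\<nu> p) (\<nu> p)) p (0, 1) = 0"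
    by (rule D_eqI[OF thick_S p])
  then have "dgmet (q p) (Df p (0, 1), 1) (\<nu> p) (\<nu> p) + gmet (q p) (D S \<nu> p (0, 1)) (\<nu> p)
      + gmet (q p) (\<nu> p) (D S \<nu> p (0, 1)) = 0"
    using D_eqI[OF thick_S p gmet_along[OF p \<nu>_has_derivative[OF p] \<nu>_has_derivative[OF p]], of "(0, 1)"]
    by simp
  then have n: "gmet (q p) (\<nu> p) (D S \<nu> p (0, 1)) = K p + H p * X p / 2"
    using inner_product_commute[OF gmet_inner[OF q_in[OF p]], of "D S \<nu> p (0, 1)" "\<nu> p"]
    unfolding Dt V by simp
  have "Ht p = - (dgmet (q p) (Df p (0, 1), 1) (Df p (0, 1)) (\<nu> p) + gmet (q p) (DDf p (0, 1) (0, 1)) (\<nu> p)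
      + gmet (q p) (Df p (0, 1)) (D S \<nu> p (0, 1)))"
    unfolding Ht_def H_has_derivative(2)[OF p] by simp
  then show ?thesis
    unfolding Dt by (simp add: g V[simplified] n power2_eq_square algebra_simps)
qed

section \<open>Continuity of the geometric quantities along the track\<close>

lemma continuous_on_q: "continuous_on S q"
  using q_has_derivative by (rule has_derivative_continuous_on)

lemma continuous_on_gg_along:
  "continuous_on S a \<Longrightarrow> continuous_on S b \<Longrightarrow> continuous_on S (\<lambda>p. gmet (q p) (a p) (b p))"
  by (rule continuous_on_bilinear_family[OF gmet_bilinear[OF q_in] smooth_on_continuous[OF gmet_smooth] continuous_on_q q_in])

lemma continuous_on_dG_along:
  "continuous_on S a \<Longrightarrow> continuous_on S b \<Longrightarrow> continuous_on S (\<lambda>p. dgmet (q p) h (a p) (b p))"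
  by (rule continuous_on_bilinear_family[OF dgmet_bilinear[OF q_in] smooth_on_continuous[OF dgmet_smooth] continuous_on_q q_in])

lemma continuous_on_\<nu>: "continuous_on S \<nu>"
  using \<nu>_smooth by (rule smooth_on_continuous)

lemma continuous_on_H: "continuous_on S H"
  unfolding H_def
  by (intro continuous_intros continuous_on_gg_along continuous_on_\<nu> smooth_on_continuous[OF Df_smooth])

lemma continuous_on_K: "continuous_on S K"
  unfolding K_def Ric_def by (intro continuous_intros continuous_on_dG_along continuous_on_\<nu>) simp

text \<open>Here the direction of differentiation moves with \<open>p\<close> too; expanding it in
  coordinates leaves \<open>dgmet\<close> in constant directions.\<close>

lemma continuous_on_X: "continuous_on S X"
proof -
  have "continuous_on S (\<lambda>p. \<Sum>b\<in>Basis. (\<nu> p \<bullet> b) * dgmet (q p) (b, 0) (\<nu> p) (\<nu> p))"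
    by (intro continuous_intros continuous_on_dG_along continuous_on_\<nu>)
  moreover have "X p = (\<Sum>b\<in>Basis. (\<nu> p \<bullet> b) * dgmet (q p) (b, 0) (\<nu> p) (\<nu> p))" if "p \<in> S" for p
  proof -
    have "linear (\<lambda>y. dgmet (q p) (y, 0) (\<nu> p) (\<nu> p))"
      using linear_compose[OF _ dgmet_linear[OF q_in[OF that], of "\<nu> p" "\<nu> p"], of "\<lambda>y. (y, 0)"]
      by (simp add: o_def linear_iff)
    from linear_expand[OF this, of "\<nu> p"] show ?thesis by (simp add: X_def)
  qed
  ultimately show ?thesis by (simp cong: continuous_on_cong)
qed

text \<open>\<open>acceleration\<close> is solved for \<open>Ht\<close>, which is then expressed by
  a second derivative of the smooth map \<open>f\<close> and by quantities already known to be
  continuous.\<close>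

lemma continuous_on_Ht: "continuous_on S Ht"
proof -
  have "smooth_on S (\<lambda>p. DDf p (0, 1) (0, 1))"
    unfolding DDf_def by (intro smooth_on_D Df_smooth)
  then have "continuous_on S (\<lambda>p. - gmet (q p) (DDf p (0, 1) (0, 1)) (\<nu> p) - H p * K p - (H p)\<^sup>2 * X p / 2)"
    by (intro continuous_intros continuous_on_gg_along continuous_on_\<nu> continuous_on_H continuous_on_K
        continuous_on_X smooth_on_continuous) simp_all
  then show ?thesis by (simp add: acceleration cong: continuous_on_cong)
qed

end

section \<open>The space-time track\<close>

context chart_flow begin

text \<open>The coefficient \<phi> itself, not its square root. Writing it with
  \<open>scalar_curvature\<close> makes \<open>stmet\<close> agree with
  \<open>spacetime_metric\<close> at all arguments, whereas \<open>scal\<close> is identified with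
  the scalar curvature on \<Omega> only.\<close>

definition lapse :: "real \<Rightarrow> 'e \<times> real \<Rightarrow> real" where
  "lapse N p = N / (2 * snd p ^ 3) + scalar_curvature U (G (snd p)) (fst p) / snd p + DIM('e) / (2 * (snd p)\<^sup>2)"

definition dlapse :: "real \<Rightarrow> 'e \<times> real \<Rightarrow> 'e \<times> real \<Rightarrow> real" where
  "dlapse N p h = - 3 * N * snd h / (2 * snd p ^ 4) + D \<Omega> scal p h / snd p - snd h * scal p / (snd p)\<^sup>2
     - real (DIM('e)) * snd h / snd p ^ 3"

definition stmet :: "real \<Rightarrow> 'e \<times> real \<Rightarrow> 'e \<times> real \<Rightarrow> 'e \<times> real \<Rightarrow> real" where
  "stmet N p V W = gmet p (fst V) (fst W) / snd p + lapse N p * (snd V * snd W)"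

definition dstmet :: "real \<Rightarrow> 'e \<times> real \<Rightarrow> 'e \<times> real \<Rightarrow> 'e \<times> real \<Rightarrow> 'e \<times> real \<Rightarrow> real" where
  "dstmet N p h V W = dgmet p h (fst V) (fst W) / snd p - snd h * gmet p (fst V) (fst W) / (snd p)\<^sup>2
     + dlapse N p h * (snd V * snd W)"

lemma lapse_eq: "p \<in> \<Omega> \<Longrightarrow> lapse N p = N / (2 * snd p ^ 3) + scal p / snd p + DIM('e) / (2 * (snd p)\<^sup>2)"
  using scalar_curvature_eq_scal[of "fst p" "snd p"] by (simp add: lapse_def)

lemma lapse_has_derivative:
  assumes p: "p \<in> \<Omega>" shows "(lapse N has_derivative dlapse N p) (at p within \<Omega>)"
proof (rule has_derivative_transform[OF p lapse_eq])
  have t: "snd p > 0" using p by auto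
  have "((\<lambda>p. N / (2 * snd p ^ 3) + scal p / snd p + DIM('e) / (2 * (snd p)\<^sup>2)) has_derivative
    (\<lambda>h. - N * (2 * (3 * snd h * (snd p)\<^sup>2)) / (2 * snd p ^ 3)\<^sup>2
       + (D \<Omega> scal p h * snd p - scal p * snd h) / (snd p * snd p)
       - real (DIM('e)) * (2 * (2 * snd h * snd p)) / (2 * (snd p)\<^sup>2)\<^sup>2)) (at p within \<Omega>)"
    using t by (auto intro!: derivative_eq_intros scal_has_derivative p
        simp: power2_eq_square field_simps fun_eq_iff)
  moreover have "- N * (2 * (3 * snd h * (snd p)\<^sup>2)) / (2 * snd p ^ 3)\<^sup>2
       + (D \<Omega> scal p h * snd p - scal p * snd h) / (snd p * snd p)
       - real (DIM('e)) * (2 * (2 * snd h * snd p)) / (2 * (snd p)\<^sup>2)\<^sup>2 = dlapse N p h" for h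
    using t by (simp add: dlapse_def field_simps power2_eq_square power3_eq_cube power4_eq_xxxx)
  ultimately show "((\<lambda>p. N / (2 * snd p ^ 3) + scal p / snd p + DIM('e) / (2 * (snd p)\<^sup>2)) has_derivative
    dlapse N p) (at p within \<Omega>)" by simp
qed

lemma stmet_has_derivative:
  assumes p: "p \<in> \<Omega>" shows "((\<lambda>p. stmet N p V W) has_derivative (\<lambda>h. dstmet N p h V W)) (at p within \<Omega>)"
proof -
  have t: "snd p > 0" using p by auto
  have "((\<lambda>p. gmet p (fst V) (fst W) / snd p) has_derivative
      (\<lambda>h. (dgmet p h (fst V) (fst W) * snd p - gmet p (fst V) (fst W) * snd h) / (snd p * snd p))) (at p within \<Omega>)"
    using t by (intro has_derivative_divide' gmet_has_derivative p has_derivative_snd has_derivative_ident) simp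
  moreover have "((\<lambda>p. lapse N p * (snd V * snd W)) has_derivative (\<lambda>h. dlapse N p h * (snd V * snd W))) (at p within \<Omega>)"
    by (intro has_derivative_mult_left lapse_has_derivative p)
  ultimately have "((\<lambda>p. stmet N p V W) has_derivative
      (\<lambda>h. (dgmet p h (fst V) (fst W) * snd p - gmet p (fst V) (fst W) * snd h) / (snd p * snd p)
        + dlapse N p h * (snd V * snd W))) (at p within \<Omega>)"
    unfolding stmet_def by (rule has_derivative_add)
  moreover have "(dgmet p h (fst V) (fst W) * snd p - gmet p (fst V) (fst W) * snd h) / (snd p * snd p)
        + dlapse N p h * (snd V * snd W) = dstmet N p h V W" for h
    using t by (simp add: dstmet_def power2_eq_square diff_divide_distrib mult.commute)
  ultimately show ?thesis by simp
qed

lemma stmet_inner: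
  assumes p: "p \<in> \<Omega>" and pos: "lapse N p > 0" shows "inner_product (stmet N p)"
  unfolding inner_product_def
proof (intro conjI allI impI)
  note B = gmet_inner[OF p] and bil = gmet_bilinear[OF p]
  have t: "snd p > 0" using p by auto
  show "bilinear (stmet N p)"
    unfolding bilinear_def stmet_def
    by (auto intro!: linearI simp: bilinear_simps[OF bil] algebra_simps add_divide_distrib)
  show "stmet N p V W = stmet N p W V" for V W
    using inner_product_commute[OF B, of "fst V" "fst W"] by (simp add: stmet_def mult.commute)
  show "stmet N p V V > 0" if "V \<noteq> 0" for V
  proof (cases "fst V = 0")
    case True
    then have "snd V \<noteq> 0" using that by (simp add: prod_eq_iff)
    then have "lapse N p * (snd V * snd V) > 0" using pos by (simp add: mult_pos_pos power2_eq_square[symmetric])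
    then show ?thesis using True by (simp add: stmet_def bilinear_simps[OF bil])
  next
    case False
    then have "gmet p (fst V) (fst V) / snd p > 0" using inner_product_pos[OF B] t by simp
    moreover have "lapse N p * (snd V * snd V) \<ge> 0" using pos by simp
    ultimately show ?thesis unfolding stmet_def by (rule add_pos_nonneg)
  qed
qed

end

lemma bilinear_scale:
  fixes h :: "'a::real_vector \<Rightarrow> 'b::real_vector \<Rightarrow> real"
  assumes "bilinear h" shows "bilinear (\<lambda>u v. c * h u v)"
  unfolding bilinear_def
  by (intro conjI allI linearI) (simp_all add: bilinear_simps[OF assms] algebra_simps)

lemma bilinear_add:
  fixes g h :: "'a::real_vector \<Rightarrow> 'b::real_vector \<Rightarrow> real"
  assumes "bilinear g" "bilinear h" shows "bilinear (\<lambda>u v. g u v + h u v)"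
  unfolding bilinear_def
  by (intro conjI allI linearI)
    (simp_all add: bilinear_simps[OF assms(1)] bilinear_simps[OF assms(2)] algebra_simps)

section \<open>Unit normal, second fundamental form and mean curvature of the track\<close>

context track_flow begin

definition scal_nu :: "'d \<times> real \<Rightarrow> real" where "scal_nu p = D \<Omega> scal (q p) (\<nu> p, 0)"
definition scal_t :: "'d \<times> real \<Rightarrow> real" where "scal_t p = D \<Omega> scal (q p) (0, 1)"

text \<open>The unit normal of the track is \<open>(nu_x *\<^sub>R \<nu>, nu_t)\<close>.\<close>

definition nu_x :: "real \<Rightarrow> 'd \<times> real \<Rightarrow> real" where
  "nu_x N p = sqrt (snd p / (1 + (H p)\<^sup>2 / (snd p * lapse N (q p))))"
definition nu_t :: "real \<Rightarrow> 'd \<times> real \<Rightarrow> real" where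
  "nu_t N p = nu_x N p * H p / (snd p * lapse N (q p))"

lemma nu_x_pos: "p \<in> S \<Longrightarrow> lapse N (q p) > 0 \<Longrightarrow> nu_x N p > 0"
  and nu_x_sq: "p \<in> S \<Longrightarrow> lapse N (q p) > 0 \<Longrightarrow> (nu_x N p)\<^sup>2 * (1 + (H p)\<^sup>2 / (snd p * lapse N (q p))) = snd p"
proof -
  assume p: "p \<in> S" and l: "lapse N (q p) > 0"
  have t: "snd p > 0" using S_sub[OF p] by auto
  have "1 + (H p)\<^sup>2 / (snd p * lapse N (q p)) > 0" using t l by (intro add_pos_nonneg) auto
  then show "nu_x N p > 0" "(nu_x N p)\<^sup>2 * (1 + (H p)\<^sup>2 / (snd p * lapse N (q p))) = snd p"
    using t by (simp_all add: nu_x_def)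
qed

lemma snd_q[simp]: "snd (q p) = snd p" by (simp add: q_def)

lemma gmet_\<nu>_combination:
  assumes p: "p \<in> S"
  shows "gmet (q p) (Df p (u, s)) z = gmet (q p) (A p u) z - s * H p * gmet (q p) (\<nu> p) z"
  using bilinear_simps[OF gmet_bilinear[OF q_in[OF p]]] by (simp add: Df_eq[OF p])

text \<open>Orthogonality to the spatial tangent vectors makes the spatial part a multiple of \<nu>,
  orthogonality to \<open>(- H p *\<^sub>R \<nu> p, 1)\<close> fixes the ratio of the two
  components, unit length fixes them up to sign, and the side condition picks the sign.\<close>

lemma track_normal_unique:
  assumes p: "p \<in> S" and pos: "lapse N (q p) > 0"
  shows "unit_normal_at (stmet N) S q p n \<and> stmet N (q p) n (\<nu> p, 0) > 0 \<longleftrightarrow> n = (nu_x N p *\<^sub>R \<nu> p, nu_t N p)"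
proof -
  note g = bilinear_simps[OF gmet_bilinear[OF q_in[OF p]]]
  note unit = \<nu>_unit[OF p] and nor = \<nu>_normal[OF p] \<nu>_normal'[OF p]
  have t: "snd p > 0" using S_sub[OF p] by auto
  let ?t = "snd p" and ?l = "lapse N (q p)"
  note sq = nu_x_sq[OF p pos] and apos = nu_x_pos[OF p pos]
  have un: "unit_normal_at (stmet N) S q p n \<longleftrightarrow> gmet (q p) (fst n) (fst n) / ?t + ?l * (snd n)\<^sup>2 = 1 \<and>
     (\<forall>u s. (gmet (q p) (A p u) (fst n) - s * H p * gmet (q p) (\<nu> p) (fst n)) / ?t + ?l * (s * snd n) = 0)" for n
    unfolding unit_normal_at_def by (simp add: D_q[OF p] stmet_def gmet_\<nu>_combination[OF p] power2_eq_square)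
  show ?thesis
  proof
    assume n: "n = (nu_x N p *\<^sub>R \<nu> p, nu_t N p)"
    have "(nu_x N p)\<^sup>2 / ?t + ?l * (nu_t N p)\<^sup>2 = (nu_x N p)\<^sup>2 * (1 + (H p)\<^sup>2 / (?t * ?l)) / ?t"
      using t pos by (simp add: nu_t_def field_simps power2_eq_square)
    also have "\<dots> = 1" using t by (simp add: sq)
    finally have 1: "(nu_x N p)\<^sup>2 / ?t + ?l * (nu_t N p)\<^sup>2 = 1" .
    have 2: "?l * nu_t N p = nu_x N p * H p / ?t" using t pos by (simp add: nu_t_def)
    have "(- s * H p * nu_x N p) / ?t + ?l * (s * nu_t N p) = 0" for s
    proof -
      have "?l * (s * nu_t N p) = s * (?l * nu_t N p)" by simp
      then show ?thesis unfolding 2 by simp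
    qed
    then show "unit_normal_at (stmet N) S q p n \<and> stmet N (q p) n (\<nu> p, 0) > 0"
      unfolding un using 1 apos t by (simp add: n g unit nor stmet_def power2_eq_square)
  next
    assume a: "unit_normal_at (stmet N) S q p n \<and> stmet N (q p) n (\<nu> p, 0) > 0"
    let ?m = "gmet (q p) (fst n) (\<nu> p)"
    have c: "gmet (q p) (\<nu> p) (fst n) = ?m" by (rule inner_product_commute[OF gmet_inner[OF q_in[OF p]]])
    have n1: "gmet (q p) (fst n) (fst n) / ?t + ?l * (snd n)\<^sup>2 = 1"
      and n2: "\<And>u s. (gmet (q p) (A p u) (fst n) - s * H p * ?m) / ?t + ?l * (s * snd n) = 0"
      using a unfolding un c by blast+
    have n3: "?m > 0" using a t by (simp add: stmet_def zero_less_divide_iff)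
    obtain u where u: "fst n - ?m *\<^sub>R \<nu> p = A p u"
      using hyperplane_decomp[OF gmet_inner[OF q_in[OF p]] linear_A[OF p] inj_A[OF p] dim unit nor(1)] .
    \<comment> \<open>The tangential part \<open>A p u\<close> of \<open>fst n\<close> turns out
      orthogonal to itself and hence zero.\<close>
    have "gmet (q p) (A p u) (fst n) = 0" using n2[of u 0] t by simp
    then have "gmet (q p) (A p u) (fst n - ?m *\<^sub>R \<nu> p) = 0" by (simp add: g nor)
    then have "A p u = 0" using inner_product_pos[OF gmet_inner[OF q_in[OF p]], of "A p u"] unfolding u by force
    then have z: "fst n = ?m *\<^sub>R \<nu> p" using u by simp
    have "?l * snd n = ?m * H p / ?t" using n2[of 0 1] linear_0[OF linear_A[OF p]] t by (simp add: g field_simps)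
    then have s: "snd n = ?m * H p / (?t * ?l)" using pos t by (simp add: field_simps)
    have gn: "gmet (q p) (fst n) (fst n) = ?m\<^sup>2"
    proof -
      have "gmet (q p) (fst n) (fst n) = gmet (q p) (?m *\<^sub>R \<nu> p) (?m *\<^sub>R \<nu> p)" using z by metis
      then show ?thesis by (simp add: g unit power2_eq_square)
    qed
    have "?m\<^sup>2 * (1 + (H p)\<^sup>2 / (?t * ?l)) = ?t * (?m\<^sup>2 / ?t + ?l * (snd n)\<^sup>2)"
      unfolding s using t pos by (simp add: field_simps power2_eq_square)
    also have "\<dots> = (nu_x N p)\<^sup>2 * (1 + (H p)\<^sup>2 / (?t * ?l))"
      using n1 unfolding gn by (simp add: sq)
    finally have "?m\<^sup>2 = (nu_x N p)\<^sup>2"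
      using t pos add_pos_nonneg[of 1 "(H p)\<^sup>2 / (?t * ?l)"] by simp
    then have "?m = nu_x N p" using n3 apos by (simp add: power2_eq_iff_nonneg)
    then show "n = (nu_x N p *\<^sub>R \<nu> p, nu_t N p)" using z s by (simp add: prod_eq_iff nu_t_def)
  qed
qed

text \<open>The time component of the track is linear, so its second derivative is purely spatial;
  the remaining terms are the Koszul formula for \<open>stmet\<close>, which has to be an inner
  product on all of \<Omega>. Bilinearity is taken from the form with Christoffel symbols, before
  the Koszul expansion.\<close>

lemma spacetime_sff:
  assumes p: "p \<in> S" and pos: "\<forall>x\<in>\<Omega>. lapse N x > 0"
  shows "second_fundamental_form \<Omega> (stmet N) S q n p V W =
    - gmet (q p) (DDf p W V) (fst n) / snd p
    - (dstmet N (q p) (Df p V, snd V) (Df p W, snd W) n + dstmet N (q p) (Df p W, snd W) (Df p V, snd V) n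
       - dstmet N (q p) n (Df p V, snd V) (Df p W, snd W)) / 2"
    and "bilinear (second_fundamental_form \<Omega> (stmet N) S q n p)"
proof -
  have inn: "inner_product (stmet N x)" if "x \<in> \<Omega>" for x using that bspec[OF pos that] by (rule stmet_inner)
  note diff = differentiableI[OF stmet_has_derivative[OF q_in[OF p]]]
  have D1: "D S (\<lambda>y. D S q y h) p k = (DDf p h k, 0)" for h k
  proof (rule D_eqI[OF thick_S p])
    have "((\<lambda>y. (Df y h, snd h)) has_derivative (\<lambda>k. (DDf p h k, 0))) (at p within S)"
      by (intro has_derivative_Pair Df_has_derivative p has_derivative_const)
    then show "((\<lambda>y. D S q y h) has_derivative (\<lambda>k. (DDf p h k, 0))) (at p within S)"
      by (rule has_derivative_transform[OF p, rotated]) (rule D_q)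
  qed
  have D2: "D \<Omega> (\<lambda>x. stmet N x V W) (q p) h = dstmet N (q p) h V W" for V W h
    by (rule D_eqI[OF thick_\<Omega> q_in[OF p] stmet_has_derivative[OF q_in[OF p]]])
  note s = bilinear_simps[OF inner_product_bilinear[OF inn[OF q_in[OF p]]]]
  note C = bilinear_christoffel[OF thick_\<Omega> q_in[OF p] inn diff]
  show "second_fundamental_form \<Omega> (stmet N) S q n p V W =
    - gmet (q p) (DDf p W V) (fst n) / snd p
    - (dstmet N (q p) (Df p V, snd V) (Df p W, snd W) n + dstmet N (q p) (Df p W, snd W) (Df p V, snd V) n
       - dstmet N (q p) n (Df p V, snd V) (Df p W, snd W)) / 2"
    unfolding second_fundamental_form_def cov_deriv_along_def D1 D_q[OF p]
    by (simp add: s christoffel_pairing[OF thick_\<Omega> q_in[OF p] inn diff] D2 del: diff_divide_distrib)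
      (simp add: stmet_def)
  have lin: "linear (\<lambda>V. (Df p V, snd V))"
    using has_derivative_linear[OF q_has_derivative[OF p]] .
  have b1: "bilinear (\<lambda>V W. stmet N (q p) (DDf p W V, 0) n)"
    using bilinear_simps[OF DDf_bilinear[OF p]] bilinear_simps[OF gmet_bilinear[OF q_in[OF p]]]
    unfolding bilinear_def stmet_def by (auto intro!: linearI simp: add_divide_distrib)
  have "bilinear (\<lambda>V W. stmet N (q p) (christoffel \<Omega> (stmet N) (q p) V W) n)"
    unfolding bilinear_def by (intro conjI allI linearI) (simp_all add: bilinear_simps[OF C] s)
  from bilinear_pullback[OF this lin]
  have b2: "bilinear (\<lambda>V W. stmet N (q p) (christoffel \<Omega> (stmet N) (q p) (Df p V, snd V) (Df p W, snd W)) n)" .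
  have "second_fundamental_form \<Omega> (stmet N) S q n p = (\<lambda>V W. - (stmet N (q p) (DDf p W V, 0) n
      + stmet N (q p) (christoffel \<Omega> (stmet N) (q p) (Df p V, snd V) (Df p W, snd W)) n))"
    unfolding second_fundamental_form_def cov_deriv_along_def D1 D_q[OF p] s ..
  then show "bilinear (second_fundamental_form \<Omega> (stmet N) S q n p)"
    using bilinear_scale[OF bilinear_add[OF b1 b2], of "- 1"] by simp
qed

lemma Df_time': "p \<in> S \<Longrightarrow> Df p (0, 1) = - H p *\<^sub>R \<nu> p"
  using Df_time(2)[of "fst p" "snd p"] by simp

text \<open>The spatial component of the normal gives the second fundamental form of the slice
  divided by \<open>t\<close>. The time component contributes \<open>b\<close> times half the time
  derivative of \<open>gmet / t\<close>, which the Ricci flow turns into \<open>Ric\<close> and the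
  metric itself.\<close>

lemma spacetime_sff_spatial:
  assumes p: "p \<in> S" and pos: "\<forall>x\<in>\<Omega>. lapse N x > 0"
  shows "second_fundamental_form \<Omega> (stmet N) S q (a *\<^sub>R \<nu> p, b) p (u, 0) (v, 0) =
    a / snd p * sff p u v
    - b * (Ric (q p) (A p u) (A p v) / snd p + gmet (q p) (A p u) (A p v) / (2 * (snd p)\<^sup>2))"
proof -
  have t: "snd p > 0" using S_sub[OF p] by auto
  note g = bilinear_simps[OF gmet_bilinear[OF q_in[OF p]]] bilinear_simps[OF dgmet_bilinear[OF q_in[OF p]]]
  have n: "dgmet (q p) (a *\<^sub>R \<nu> p, b) x y = a * dgmet (q p) (\<nu> p, 0) x y - 2 * b * Ric (q p) x y" for x y
    by (subst dgmet_split[OF q_in[OF p]]) (simp add: dgmet_smult[OF q_in[OF p]] Ric_def)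
  show ?thesis
    unfolding spacetime_sff(1)[OF p pos] A_def[symmetric]
    using t by (simp add: dstmet_def sff_def n g field_simps power2_eq_square)
qed

text \<open>The second fundamental form of the track on the vector with coordinates
  \<open>(0, 1)\<close>, whose image is \<open>(- H p *\<^sub>R \<nu> p, 1)\<close>. The
  contributions of \<open>X\<close> have cancelled, and \<open>dlapse N (q p) (0, 1)\<close>,
  multiplied by \<open>nu_t\<close>, is the only factor that grows with \<open>N\<close>.\<close>

definition sff_tt :: "real \<Rightarrow> 'd \<times> real \<Rightarrow> real" where
  "sff_tt N p = - (nu_x N p / snd p * (- Ht p - H p * K p) + nu_x N p * (2 * H p * K p / snd p + H p / (snd p)\<^sup>2)
     + nu_t N p * (- H p * scal_nu p / snd p + dlapse N (q p) (0, 1) / 2)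
     + nu_t N p * ((H p)\<^sup>2 * K p / snd p + (H p)\<^sup>2 / (2 * (snd p)\<^sup>2))
     - nu_x N p * scal_nu p / (2 * snd p))"

lemma spacetime_sff_time:
  assumes p: "p \<in> S" and pos: "\<forall>x\<in>\<Omega>. lapse N x > 0"
  shows "second_fundamental_form \<Omega> (stmet N) S q (nu_x N p *\<^sub>R \<nu> p, nu_t N p) p (0, 1) (0, 1) = sff_tt N p"
proof -
  have t: "snd p > 0" using S_sub[OF p] by auto
  note g = bilinear_simps[OF gmet_bilinear[OF q_in[OF p]]] bilinear_simps[OF dgmet_bilinear[OF q_in[OF p]]] \<nu>_unit[OF p]
  have n: "dgmet (q p) (c *\<^sub>R \<nu> p, b) (\<nu> p) (\<nu> p) = c * X p - 2 * b * K p" for c b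
    by (subst dgmet_split[OF q_in[OF p]]) (simp add: dgmet_smult[OF q_in[OF p]] Ric_def K_def X_def)
  have lin: "linear (D \<Omega> scal (q p))" using has_derivative_linear[OF scal_has_derivative[OF q_in[OF p]]] .
  have l: "D \<Omega> scal (q p) (c *\<^sub>R \<nu> p, b) = c * scal_nu p + b * scal_t p" for c b
    using linear_add[OF lin, of "c *\<^sub>R (\<nu> p, 0)" "b *\<^sub>R (0, 1)"]
    unfolding linear_cmul[OF lin] by (simp add: scal_nu_def scal_t_def)
  have dl: "dlapse N (q p) (c *\<^sub>R \<nu> p, b) = c * scal_nu p / snd p + b * dlapse N (q p) (0, 1)" for c b
    using t l[of 0 1] by (simp add: dlapse_def l field_simps)
  have n1: "dgmet (q p) (- (H p *\<^sub>R \<nu> p), 1) (\<nu> p) (\<nu> p) = - (H p * X p) - 2 * K p"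
    using n[of "- H p" 1] by simp
  have dl1: "dlapse N (q p) (- (H p *\<^sub>R \<nu> p), 1) = - (H p * scal_nu p / snd p) + dlapse N (q p) (0, 1)"
    using dl[of "- H p" 1] by simp
  show ?thesis
    unfolding spacetime_sff(1)[OF p pos] Df_time'[OF p] sff_tt_def
    using t by (simp add: dstmet_def g acceleration[OF p] n dl n1 dl1) (simp add: field_simps power2_eq_square)
qed

definition track_lapse :: "real \<Rightarrow> 'd \<times> real \<Rightarrow> real" where
  "track_lapse N p = (H p)\<^sup>2 / snd p + lapse N (q p)"

lemma spacetime_mean_curvature:
  assumes p: "p \<in> S" and pos: "\<forall>x\<in>\<Omega>. lapse N x > 0"
  shows "mean_curvature \<Omega> (stmet N) S q (nu_x N p *\<^sub>R \<nu> p, nu_t N p) p =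
    nu_x N p * H p - nu_t N p * (scal (q p) - K p) - nu_t N p * DIM('d) / (2 * snd p) + sff_tt N p / track_lapse N p"
proof -
  have t: "snd p > 0" using S_sub[OF p] by auto
  let ?gM = "\<lambda>u v. gmet (q p) (A p u) (A p v)"
  let ?h = "second_fundamental_form \<Omega> (stmet N) S q (nu_x N p *\<^sub>R \<nu> p, nu_t N p) p"
  note g = bilinear_simps[OF gmet_bilinear[OF q_in[OF p]]]
  have ip: "inner_product ?gM"
    using gmet_inner[OF q_in[OF p]] linear_A[OF p] inj_A[OF p] by (rule inner_product_pullback)
  have track_lapse: "track_lapse N p > 0" using t bspec[OF pos q_in[OF p]] by (simp add: track_lapse_def add_nonneg_pos)
  \<comment> \<open>There are no mixed terms because the motion is normal: the image of
    \<open>(0, 1)\<close> is orthogonal to the spatial tangent vectors.\<close>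
  have "induced_metric (stmet N) S q p = (\<lambda>(u, \<alpha>) (v, \<beta>). ?gM u v / snd p + track_lapse N p * (\<alpha> * \<beta>))"
    using t by (intro ext) (auto simp: induced_metric_def D_q[OF p] stmet_def Df_eq[OF p] track_lapse_def g
      \<nu>_unit[OF p] \<nu>_normal[OF p] \<nu>_normal'[OF p] field_simps power2_eq_square)
  then have 1: "mean_curvature \<Omega> (stmet N) S q (nu_x N p *\<^sub>R \<nu> p, nu_t N p) p
      = snd p * metric_trace ?gM (\<lambda>u v. ?h (u, 0) (v, 0)) + ?h (0, 1) (0, 1) / track_lapse N p"
    unfolding mean_curvature_def using metric_trace_product[OF ip spacetime_sff(2)[OF p pos] t track_lapse] by simp
  have 2: "metric_trace ?gM (\<lambda>u v. ?h (u, 0) (v, 0)) =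
    nu_x N p / snd p * H p - nu_t N p / snd p * (scal (q p) - K p) - nu_t N p / (2 * (snd p)\<^sup>2) * DIM('d)"
  proof -
    let ?R = "\<lambda>u v. Ric (q p) (A p u) (A p v)"
    have bR: "bilinear ?R" using Ric_bilinear[OF q_in[OF p]] linear_A[OF p] by (rule bilinear_pullback)
    note bs = bilinear_scale[OF sff_bilinear[OF p]] bilinear_scale[OF bR]
      bilinear_scale[OF inner_product_bilinear[OF ip]]
    note bs2 = bilinear_add[OF bs(2,3)]
    have "(\<lambda>u v. ?h (u, 0) (v, 0)) = (\<lambda>u v. nu_x N p / snd p * sff p u v
        + (- nu_t N p / snd p * ?R u v + - nu_t N p / (2 * (snd p)\<^sup>2) * ?gM u v))"
      by (intro ext) (simp add: spacetime_sff_spatial[OF p pos] algebra_simps)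
    then have "metric_trace ?gM (\<lambda>u v. ?h (u, 0) (v, 0)) = nu_x N p / snd p * metric_trace ?gM (sff p)
        + (- nu_t N p / snd p * metric_trace ?gM ?R + - nu_t N p / (2 * (snd p)\<^sup>2) * metric_trace ?gM ?gM)"
      by (simp only: metric_trace_add[OF ip bs(1) bs2] metric_trace_add[OF ip bs(2,3)]
          metric_trace_scale[OF ip sff_bilinear[OF p]] metric_trace_scale[OF ip bR]
          metric_trace_scale[OF ip inner_product_bilinear[OF ip]])
    then show ?thesis
      using metric_trace_hypersurface[OF gmet_inner[OF q_in[OF p]] Ric_bilinear[OF q_in[OF p]]
          linear_A[OF p] inj_A[OF p] dim \<nu>_unit[OF p] \<nu>_normal[OF p]]
      by (simp add: trace_sff[OF p] metric_trace_self[OF ip] scal_def K_def)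
  qed
  show ?thesis
    unfolding 1 2 spacetime_sff_time[OF p pos] using t by (simp add: field_simps power2_eq_square)
qed

lemma spacetime_potential_deriv:
  assumes "p \<in> \<Omega>" shows "D \<Omega> (spacetime_potential N) p h = snd h * N / (2 * (snd p)\<^sup>2)"
proof (rule D_eqI[OF thick_\<Omega> assms])
  have t: "snd p > 0" using assms by auto
  have "((\<lambda>p. - N / (2 * snd p)) has_derivative (\<lambda>h. snd h * N / (2 * (snd p)\<^sup>2))) (at p within \<Omega>)"
    using t by (auto intro!: derivative_eq_intros simp: field_simps power2_eq_square fun_eq_iff)
  then show "(spacetime_potential N has_derivative (\<lambda>h. snd h * N / (2 * (snd p)\<^sup>2))) (at p within \<Omega>)"
    by (simp add: spacetime_potential_def[abs_def] case_prod_unfold)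
qed

lemma defect_formula:
  assumes p: "p \<in> S" and pos: "\<forall>x\<in>\<Omega>. lapse N x > 0"
  defines "n \<equiv> (THE n. unit_normal_at (stmet N) S q p n \<and> stmet N (q p) n (\<nu> p, 0) > 0)"
  shows "mean_curvature \<Omega> (stmet N) S q n p - D \<Omega> (spacetime_potential N) (q p) n =
    nu_t N p * (K p + 1 / (2 * snd p)) + sff_tt N p / track_lapse N p"
proof -
  have t: "snd p > 0" using S_sub[OF p] by auto
  note l = bspec[OF pos q_in[OF p]]
  have n: "n = (nu_x N p *\<^sub>R \<nu> p, nu_t N p)"
    unfolding n_def track_normal_unique[OF p l] by simp
  have "nu_x N p * H p = nu_t N p * snd p * lapse N (q p)" using t l by (simp add: nu_t_def)
  also have "\<dots> = nu_t N p * (N / (2 * (snd p)\<^sup>2) + scal (q p) + DIM('e) / (2 * snd p))"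
    using t unfolding lapse_eq[OF q_in[OF p]] by (simp add: field_simps power2_eq_square power3_eq_cube)
  finally have aH: "nu_x N p * H p = nu_t N p * (N / (2 * (snd p)\<^sup>2) + scal (q p) + DIM('e) / (2 * snd p))" .
  show ?thesis
    unfolding n spacetime_mean_curvature[OF p pos] spacetime_potential_deriv[OF q_in[OF p]] aH
    \<comment> \<open>By \<open>dim\<close> the multiples \<open>DIM('e) / (2 * snd p)\<close> and
      \<open>DIM('d) / (2 * snd p)\<close> of \<open>nu_t\<close> differ by the term
      \<open>1 / (2 * snd p)\<close> of the result.\<close>
    using t by (simp add: dim field_simps)
qed

end

section \<open>Estimates and invariance\<close>

text \<open>As introduction rules these decompose an expression along its syntax and assemble its
  bound from bounds on the atoms.\<close>

lemma
  fixes x y X Y :: real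
  assumes "\<bar>x\<bar> \<le> X"
  shows abs_add_le: "\<bar>y\<bar> \<le> Y \<Longrightarrow> \<bar>x + y\<bar> \<le> X + Y"
    and abs_diff_le: "\<bar>y\<bar> \<le> Y \<Longrightarrow> \<bar>x - y\<bar> \<le> X + Y"
    and abs_mult_le: "\<bar>y\<bar> \<le> Y \<Longrightarrow> \<bar>x * y\<bar> \<le> X * Y"
    and abs_minus_le: "\<bar>- x\<bar> \<le> X"
  using assms by (auto simp: abs_mult intro: mult_mono)

text \<open>Only the independence of \<open>N\<close> matters; the expression records the termwise bound.\<close>

definition defect_const :: "real \<Rightarrow> real \<Rightarrow> real \<Rightarrow> real" where
  "defect_const N\<^sub>0 B m = (4 * (B * B) * (B * B)) * (B + 1 / 2 * B) + (4 * (B * (B * B))) * (B * B * (B + B * B) + B * (2 * B * B * B + B * (B * B))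
       + (1 / N\<^sub>0 * (4 * (B * B) * (B * B))) * (B * B * B)
       + (1 / N\<^sub>0 * (4 * (B * B) * (B * B))) * (B * B * B * B + 1 / 2 * (B * B * (B * B))) + 1 / 2 * (B * B * B))
     + (4 * (B * B) * (B * B)) * (1 / 2 * (4 * (B * (B * B)) * (3 / 2 * (B * B * (B * B)) + 1 / N\<^sub>0 * (B * B + B * (B * B) + m * (B * B * B)))))"

text \<open>From \<open>N / (4 * t ^ 3) \<le> \<phi>\<close> and \<open>\<phi> \<le> \<psi>\<close>
  the quotients \<open>N / (t * \<phi>)\<close> and \<open>N / \<psi>\<close> are bounded, hence so
  is \<open>N * b\<close>. The quantity \<open>d\<close> grows with \<open>N\<close> but enters only
  through \<open>(N * b) * (d / \<psi>)\<close>. Elsewhere \<open>b\<close> is \<open>1 / N\<close>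
  times \<open>N * b\<close>, which brings in \<open>1 / N\<^sub>0\<close>.\<close>

lemma defect_bound:
  fixes N t H K R r \<tau> H' \<phi> m :: real
  assumes N\<^sub>0: "N\<^sub>0 > 0" and B: "B \<ge> 1" and m: "m \<ge> 0"
    and N: "N \<ge> N\<^sub>0" and t: "0 < t" "t \<le> B" "1 / t \<le> B" and H: "\<bar>H\<bar> \<le> B" and K: "\<bar>K\<bar> \<le> B" and R: "\<bar>R\<bar> \<le> B"
    and r: "\<bar>r\<bar> \<le> B" and \<tau>: "\<bar>\<tau>\<bar> \<le> B" and H': "\<bar>H'\<bar> \<le> B" and \<phi>: "N / (4 * t ^ 3) \<le> \<phi>"
  defines "a \<equiv> sqrt (t / (1 + H\<^sup>2 / (t * \<phi>)))"
  defines "b \<equiv> a * H / (t * \<phi>)"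
  defines "d \<equiv> - 3 * N / (2 * t ^ 4) + \<tau> / t - R / t\<^sup>2 - m / t ^ 3"
  defines "\<psi> \<equiv> H\<^sup>2 / t + \<phi>"
  shows "N * \<bar>b * (K + 1 / (2 * t)) + - (a / t * (- H' - H * K) + a * (2 * H * K / t + H / t\<^sup>2)
       + b * (- H * r / t + d / 2) + b * (H\<^sup>2 * K / t + H\<^sup>2 / (2 * t\<^sup>2)) - a * r / (2 * t)) / \<psi>\<bar>
    \<le> defect_const N\<^sub>0 B m"
proof -
  \<comment> \<open>Multiplication by \<open>s\<close> replaces division by \<open>t\<close>, as the
    rules for absolute values of products require.\<close>
  define s where "s = 1 / t"
  have Np: "N > 0" using N N\<^sub>0 by simp
  have \<phi>p: "\<phi> > 0" using \<phi> Np t by (smt (verit) divide_pos_pos zero_less_power)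
  have \<psi>: "\<phi> \<le> \<psi>" "\<psi> > 0" using t \<phi>p by (simp_all add: \<psi>_def add_nonneg_pos)
  have s: "\<bar>s\<bar> \<le> B" using t by (simp add: s_def)
  have a: "\<bar>a\<bar> \<le> B"
  proof -
    have "1 + H\<^sup>2 / (t * \<phi>) \<ge> 1" using t \<phi>p by simp
    then have "t / (1 + H\<^sup>2 / (t * \<phi>)) \<le> t / 1" using t by (intro divide_left_mono) auto
    \<comment> \<open>The square is taken so that the root below returns \<open>B\<close>;
      \<open>t \<le> B \<le> B\<^sup>2\<close> holds because \<open>B \<ge> 1\<close>.\<close>
    also have "\<dots> \<le> B\<^sup>2" using t B self_le_power[of B 2] by simp
    finally have "a \<le> sqrt (B\<^sup>2)" unfolding a_def by (rule real_sqrt_le_mono)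
    moreover have "0 \<le> 1 + H\<^sup>2 / (t * \<phi>)" using t \<phi>p by (intro add_nonneg_nonneg) auto
    then have "a \<ge> 0" unfolding a_def using t by simp
    ultimately show ?thesis using B by simp
  qed
  have N\<phi>: "N \<le> 4 * t ^ 3 * \<phi>" using \<phi> t by (simp add: field_simps)
  have N\<psi>: "N \<le> 4 * t ^ 3 * \<psi>"
    using N\<phi> mult_left_mono[OF \<psi>(1), of "4 * t ^ 3"] zero_less_power[OF t(1), of 3] by linarith
  have y1: "\<bar>N / (t * \<phi>)\<bar> \<le> 4 * (B * B)"
  proof -
    have "N / (t * \<phi>) \<le> 4 * (t * t)" using N\<phi> t \<phi>p by (simp add: field_simps power3_eq_cube)
    also have "\<dots> \<le> 4 * (B * B)" using t by (intro mult_left_mono mult_mono) auto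
    finally show ?thesis using Np t \<phi>p by simp
  qed
  have y2: "\<bar>N / \<psi>\<bar> \<le> 4 * (B * (B * B))"
  proof -
    have "N / \<psi> \<le> 4 * (t * (t * t))" using N\<psi> \<psi> by (simp add: field_simps power3_eq_cube)
    also have "\<dots> \<le> 4 * (B * (B * B))" using t by (intro mult_left_mono mult_mono) auto
    finally show ?thesis using Np \<psi> by simp
  qed
  have iN: "\<bar>1 / N\<bar> \<le> 1 / N\<^sub>0" using N N\<^sub>0 by (simp add: frac_le)
  have Nb: "N * b = N / (t * \<phi>) * (a * H)" by (simp add: b_def)
  have x1: "\<bar>N * b\<bar> \<le> 4 * (B * B) * (B * B)" unfolding Nb by (intro abs_mult_le y1 a H)
  have x2: "\<bar>b\<bar> \<le> 1 / N\<^sub>0 * (4 * (B * B) * (B * B))"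
    using abs_mult_le[OF iN x1] Np by simp
  \<comment> \<open>Factoring \<open>N\<close> out of \<open>d\<close> leaves a leading term
    independent of \<open>N\<close>, while every other term acquires a factor
    \<open>1 / N\<close>.\<close>
  have d\<psi>: "d / \<psi> = (N / \<psi>) * (- 3 / 2 * (s * s * (s * s)) + 1 / N * (\<tau> * s - R * (s * s) - m * (s * s * s)))"
    using Np \<psi> t by (simp add: d_def s_def field_simps power2_eq_square power3_eq_cube power4_eq_xxxx)
  have m': "\<bar>m\<bar> \<le> m" and c: "\<bar>- 3 / 2 :: real\<bar> \<le> 3 / 2" and c2: "\<bar>2 :: real\<bar> \<le> 2" and c3: "\<bar>1 / 2 :: real\<bar> \<le> 1 / 2"
    using m by simp_all
  have x3: "\<bar>d / \<psi>\<bar> \<le> 4 * (B * (B * B)) * (3 / 2 * (B * B * (B * B)) + 1 / N\<^sub>0 * (B * B + B * (B * B) + m * (B * B * B)))"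
    unfolding d\<psi> by (intro abs_mult_le abs_add_le abs_diff_le y2 s \<tau> R m' c iN)
  \<comment> \<open>Grouped so that nothing unbounded stands alone: each \<open>N\<close> is paired
    with \<open>b\<close> or with \<open>1 / \<psi>\<close>, and \<open>d\<close> with
    \<open>1 / \<psi>\<close>.\<close>
  have E: "N * (b * (K + 1 / (2 * t)) + - (a / t * (- H' - H * K) + a * (2 * H * K / t + H / t\<^sup>2)
       + b * (- H * r / t + d / 2) + b * (H\<^sup>2 * K / t + H\<^sup>2 / (2 * t\<^sup>2)) - a * r / (2 * t)) / \<psi>)
    = (N * b) * (K + 1 / 2 * s) - (N / \<psi>) * (a * s * (- H' - H * K) + a * (2 * H * K * s + H * (s * s))
       - b * (H * r * s) + b * (H * H * K * s + 1 / 2 * (H * H * (s * s))) - 1 / 2 * (a * r * s))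
     - (N * b) * (1 / 2 * (d / \<psi>))"
    using t \<psi> by (simp add: s_def field_simps power2_eq_square)
  have "\<bar>N * (b * (K + 1 / (2 * t)) + - (a / t * (- H' - H * K) + a * (2 * H * K / t + H / t\<^sup>2)
       + b * (- H * r / t + d / 2) + b * (H\<^sup>2 * K / t + H\<^sup>2 / (2 * t\<^sup>2)) - a * r / (2 * t)) / \<psi>)\<bar>
    \<le> (4 * (B * B) * (B * B)) * (B + 1 / 2 * B) + (4 * (B * (B * B))) * (B * B * (B + B * B) + B * (2 * B * B * B + B * (B * B))
       + (1 / N\<^sub>0 * (4 * (B * B) * (B * B))) * (B * B * B)
       + (1 / N\<^sub>0 * (4 * (B * B) * (B * B))) * (B * B * B * B + 1 / 2 * (B * B * (B * B))) + 1 / 2 * (B * B * B))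
     + (4 * (B * B) * (B * B)) * (1 / 2 * (4 * (B * (B * B)) * (3 / 2 * (B * B * (B * B)) + 1 / N\<^sub>0 * (B * B + B * (B * B) + m * (B * B * B)))))"
    unfolding E by (intro abs_mult_le abs_add_le abs_diff_le abs_minus_le x1 x2 x3 y2 s a H K r H' c2 c3)
  then show ?thesis
    unfolding defect_const_def using Np by (simp only: abs_mult abs_of_pos)
qed

section \<open>Invariance under changes of charts\<close>

locale chart_pair = A: chart_flow U T G + B: chart_flow U' T G'
  for U :: "'e::euclidean_space set" and T :: real and G :: "real \<Rightarrow> 'e \<Rightarrow> 'e \<Rightarrow> 'e \<Rightarrow> real"
    and U' :: "'e set" and G' :: "real \<Rightarrow> 'e \<Rightarrow> 'e \<Rightarrow> 'e \<Rightarrow> real" +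
  fixes V :: "'e set" and \<tau> :: "'e \<Rightarrow> 'e" and \<tau>' :: "'e \<Rightarrow> 'e \<Rightarrow> 'e"
  assumes open_V: "open V" and V_sub: "V \<subseteq> U" and \<tau>_in: "\<And>y. y \<in> V \<Longrightarrow> \<tau> y \<in> U'"
    and \<tau>_deriv: "\<And>y. y \<in> V \<Longrightarrow> (\<tau> has_derivative \<tau>' y) (at y)"
    and G_pull: "\<And>t y u v. t \<in> {0<..T} \<Longrightarrow> y \<in> V \<Longrightarrow> G t y u v = G' t (\<tau> y) (\<tau>' y u) (\<tau>' y v)"
begin

lemma gmet_pull: "t \<in> {0<..T} \<Longrightarrow> y \<in> V \<Longrightarrow> A.gmet (y, t) u v = B.gmet (\<tau> y, t) (\<tau>' y u) (\<tau>' y v)"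
  by (simp add: A.gmet_def B.gmet_def G_pull)

lemma \<tau>'_linear: "y \<in> V \<Longrightarrow> linear (\<tau>' y)"
  using \<tau>_deriv has_derivative_linear by blast

text \<open>A vector in the kernel would have length zero in the pulled-back metric, which is
  definite; the inverse transition is not involved.\<close>

lemma \<tau>'_inj:
  assumes t: "t \<in> {0<..T}" and y: "y \<in> V" shows "inj (\<tau>' y)"
  unfolding linear_injective_0[OF \<tau>'_linear[OF y]]
proof (intro allI impI)
  fix u assume u: "\<tau>' y u = 0"
  have \<Omega>: "(y, t) \<in> A.\<Omega>" "(\<tau> y, t) \<in> B.\<Omega>" using t y V_sub \<tau>_in by auto
  have "A.gmet (y, t) u u = 0"
    using gmet_pull[OF t y, of u u] by (simp add: u bilinear_simps[OF B.gmet_bilinear[OF \<Omega>(2)]])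
  then show "u = 0" using inner_product_pos[OF A.gmet_inner[OF \<Omega>(1)], of u] by fastforce
qed

text \<open>The transition \<tau> does not depend on time, so the transformation law of the metric
  may be differentiated in time at a fixed point and no derivative of \<open>\<tau>'\<close>
  appears.\<close>

lemma Ric_pull:
  assumes t: "t \<in> {0<..T}" and y: "y \<in> V"
  shows "A.Ric (y, t) u v = B.Ric (\<tau> y, t) (\<tau>' y u) (\<tau>' y v)"
proof -
  have \<Omega>: "(y, s) \<in> A.\<Omega>" "(\<tau> y, s) \<in> B.\<Omega>" if "s \<in> {0<..T}" for s using that y V_sub \<tau>_in by auto
  have sl: "{s. (y, s) \<in> A.\<Omega>} = {0<..T}" "{s. (\<tau> y, s) \<in> B.\<Omega>} = {0<..T}" using y V_sub \<tau>_in by auto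
  have 1: "((\<lambda>s. A.gmet (y, s) u v) has_derivative (\<lambda>s. A.dgmet (y, t) (0, s) u v)) (at t within {0<..T})"
    using has_derivative_slice_snd[OF A.gmet_has_derivative[OF \<Omega>(1)[OF t]]] unfolding sl .
  have "((\<lambda>s. B.gmet (\<tau> y, s) (\<tau>' y u) (\<tau>' y v)) has_derivative (\<lambda>s. B.dgmet (\<tau> y, t) (0, s) (\<tau>' y u) (\<tau>' y v)))
      (at t within {0<..T})"
    using has_derivative_slice_snd[OF B.gmet_has_derivative[OF \<Omega>(2)[OF t]]] unfolding sl .
  from has_derivative_transform[OF t gmet_pull[OF _ y] this]
  have 2: "((\<lambda>s. A.gmet (y, s) u v) has_derivative (\<lambda>s. B.dgmet (\<tau> y, t) (0, s) (\<tau>' y u) (\<tau>' y v)))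
      (at t within {0<..T})" .
  show ?thesis
    using D_eqI[OF thick_greaterThanAtMost t 1, of 1] D_eqI[OF thick_greaterThanAtMost t 2, of 1]
    by (simp add: A.Ric_def B.Ric_def)
qed

lemma scal_pull:
  assumes t: "t \<in> {0<..T}" and y: "y \<in> V" shows "A.scal (y, t) = B.scal (\<tau> y, t)"
proof -
  have \<Omega>: "(\<tau> y, t) \<in> B.\<Omega>" using t y \<tau>_in by auto
  have "bij (\<tau>' y)"
    using \<tau>'_inj[OF t y] linear_injective_imp_surjective[OF \<tau>'_linear[OF y]] by (simp add: bij_def)
  from metric_trace_pullback_iso[OF B.gmet_inner[OF \<Omega>] B.Ric_bilinear[OF \<Omega>] \<tau>'_linear[OF y] this]
  show ?thesis
    unfolding A.scal_def B.scal_def gmet_pull[OF t y, abs_def, symmetric] Ric_pull[OF t y, abs_def, symmetric]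
    by simp
qed

text \<open>On \<open>V \<times> {0<..T}\<close>, which is thick, \<open>A.scal\<close> is
  \<open>B.scal\<close> composed with \<tau> in space and the identity in time; chain rule and
  uniqueness of the derivative give the claim.\<close>

lemma D_scal_pull:
  assumes t: "t \<in> {0<..T}" and y: "y \<in> V"
  shows "D A.\<Omega> A.scal (y, t) (u, s) = D B.\<Omega> B.scal (\<tau> y, t) (\<tau>' y u, s)"
proof -
  let ?\<Theta> = "V \<times> {0<..T}"
  have \<Omega>: "(y, t) \<in> A.\<Omega>" "(\<tau> y, t) \<in> B.\<Omega>" "(y, t) \<in> ?\<Theta>" using t y V_sub \<tau>_in by auto
  have thick: "thick ?\<Theta>"
    using open_V by (intro thick_openin_halfspace[of T])
      (auto simp: openin_open intro!: exI[of _ "V \<times> UNIV"] open_Times)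
  have 1: "(A.scal has_derivative D A.\<Omega> A.scal (y, t)) (at (y, t) within ?\<Theta>)"
    using V_sub by (intro has_derivative_subset[OF A.scal_has_derivative[OF \<Omega>(1)]]) auto
  have "((\<lambda>p. \<tau> (fst p)) has_derivative (\<lambda>h. \<tau>' y (fst h))) (at (y, t) within ?\<Theta>)"
    by (rule has_derivative_compose[where f = fst and g = \<tau>])
      (use \<tau>_deriv[OF y] in \<open>auto intro!: derivative_eq_intros\<close>)
  then have "((\<lambda>p. (\<tau> (fst p), snd p)) has_derivative (\<lambda>h. (\<tau>' y (fst h), snd h))) (at (y, t) within ?\<Theta>)"
    by (intro has_derivative_Pair has_derivative_snd has_derivative_ident)
  then have 2: "((\<lambda>p. B.scal (\<tau> (fst p), snd p)) has_derivative (\<lambda>h. D B.\<Omega> B.scal (\<tau> y, t) (\<tau>' y (fst h), snd h)))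
      (at (y, t) within ?\<Theta>)"
    by (rule has_derivative_chain_within[where U = B.\<Omega>])
      (use \<tau>_in B.scal_has_derivative[OF \<Omega>(2)] in auto)
  have "A.scal p = B.scal (\<tau> (fst p), snd p)" if "p \<in> ?\<Theta>" for p
    using scal_pull[of "snd p" "fst p"] that by auto
  from D_eqI[OF thick \<Omega>(3) has_derivative_transform[OF \<Omega>(3) this 2], of "(u, s)"] D_eqI[OF thick \<Omega>(3) 1, of "(u, s)"]
  show ?thesis by simp
qed

end

text \<open>\<xi> and \<xi>' stand for the coordinates of one point of \<open>M\<close> in two
  charts. Comparing along the single time line through it suffices: the derivatives of the flow that
  matter are time derivatives at a fixed point of \<open>M\<close>, and \<open>Ric\<close> and
  \<open>scal\<close> are compared in the ambient charts.\<close>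

locale track_pair = chart_pair U T G U' G' V \<tau> \<tau>' + A: track_flow U T G S f \<nu> + B: track_flow U' T G' S' f' \<nu>'
  for U :: "'e::euclidean_space set" and T :: real and G :: "real \<Rightarrow> 'e \<Rightarrow> 'e \<Rightarrow> 'e \<Rightarrow> real"
    and U' :: "'e set" and G' :: "real \<Rightarrow> 'e \<Rightarrow> 'e \<Rightarrow> 'e \<Rightarrow> real"
    and V :: "'e set" and \<tau> :: "'e \<Rightarrow> 'e" and \<tau>' :: "'e \<Rightarrow> 'e \<Rightarrow> 'e"
    and S :: "('d::euclidean_space \<times> real) set" and f :: "'d \<times> real \<Rightarrow> 'e" and \<nu> :: "'d \<times> real \<Rightarrow> 'e"
    and S' :: "('d \<times> real) set" and f' :: "'d \<times> real \<Rightarrow> 'e" and \<nu>' :: "'d \<times> real \<Rightarrow> 'e" +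
  fixes \<xi> \<xi>' :: 'd
  assumes f_V: "\<And>s. (\<xi>, s) \<in> S \<Longrightarrow> (\<xi>', s) \<in> S' \<Longrightarrow> f (\<xi>, s) \<in> V"
    and f'_eq: "\<And>s. (\<xi>, s) \<in> S \<Longrightarrow> (\<xi>', s) \<in> S' \<Longrightarrow> f' (\<xi>', s) = \<tau> (f (\<xi>, s))"
    and \<nu>'_eq: "\<And>s. (\<xi>, s) \<in> S \<Longrightarrow> (\<xi>', s) \<in> S' \<Longrightarrow> \<nu>' (\<xi>', s) = \<tau>' (f (\<xi>, s)) (\<nu> (\<xi>, s))"
begin

lemma at_within_common:
  assumes "(\<xi>, t) \<in> S" "(\<xi>', t) \<in> S'"
  shows "at t within {s. (\<xi>, s) \<in> S \<and> (\<xi>', s) \<in> S'} = at t within {0<..T}"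
proof -
  obtain W where W: "open W" "S = (UNIV \<times> {0<..T}) \<inter> W" using A.S_open by (auto simp: openin_open)
  obtain W' where W': "open W'" "S' = (UNIV \<times> {0<..T}) \<inter> W'" using B.S_open by (auto simp: openin_open)
  have "open ((\<lambda>s. (\<xi>, s)) -` W \<inter> (\<lambda>s. (\<xi>', s)) -` W')"
    by (intro open_Int open_vimage W W' continuous_intros)
  then show ?thesis
    by (rule at_within_nhd[rotated]) (use assms W W' in auto)
qed

text \<open>The functions agree only while both pairs of charts cover the moving point, but this is
  so for all times of \<open>{0<..T}\<close> near \<open>t\<close>.\<close>

lemma time_derivatives_eq:
  assumes t: "(\<xi>, t) \<in> S" "(\<xi>', t) \<in> S'"
    and h: "(h has_derivative h') (at t within {0<..T})" "(k has_derivative k') (at t within {0<..T})"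
    and eq: "\<And>s. (\<xi>, s) \<in> S \<Longrightarrow> (\<xi>', s) \<in> S' \<Longrightarrow> h s = k s"
  shows "h' s = k' s"
proof -
  have t': "t \<in> {0<..T}" using A.S_sub[OF t(1)] by simp
  have "(k has_derivative k') (at t within {s. (\<xi>, s) \<in> S \<and> (\<xi>', s) \<in> S'})"
    unfolding at_within_common[OF t] by (rule h)
  then have "(h has_derivative k') (at t within {s. (\<xi>, s) \<in> S \<and> (\<xi>', s) \<in> S'})"
    by (rule has_derivative_transform[rotated 2]) (use t eq in auto)
  then have "(h has_derivative k') (at t within {0<..T})"
    unfolding at_within_common[OF t] .
  then show ?thesis
    using D_eqI[OF thick_greaterThanAtMost t' h(1), of s] D_eqI[OF thick_greaterThanAtMost t', of h k' s] by simp
qed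

lemma q_eq: "(\<xi>, t) \<in> S \<Longrightarrow> (\<xi>', t) \<in> S' \<Longrightarrow> A.q (\<xi>, t) = (f (\<xi>, t), t) \<and> B.q (\<xi>', t) = (\<tau> (f (\<xi>, t)), t)"
  by (simp add: A.q_def B.q_def f'_eq)

text \<open>\<open>\<tau>'\<close> carries one velocity to the other and one normal to the other. As
  both velocities are \<open>- H\<close> times their normals and \<open>\<nu>'\<close> is nonzero,
  the factors coincide.\<close>

lemma H_eq:
  assumes t: "(\<xi>, t) \<in> S" "(\<xi>', t) \<in> S'" shows "A.H (\<xi>, t) = B.H (\<xi>', t)"
proof -
  let ?y = "f (\<xi>, t)"
  note lin = \<tau>'_linear[OF f_V[OF t]]
  have "((\<lambda>s. f (\<xi>, s)) has_derivative (\<lambda>s. A.Df (\<xi>, t) (0, s))) (at t within {0<..T})"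
    by (rule A.time_has_derivative[OF A.f_has_derivative[OF t(1)] t(1)])
  then have 1: "((\<lambda>s. \<tau> (f (\<xi>, s))) has_derivative (\<lambda>s. \<tau>' ?y (A.Df (\<xi>, t) (0, s)))) (at t within {0<..T})"
    by (rule has_derivative_compose[where g = \<tau>]) (rule \<tau>_deriv[OF f_V[OF t]])
  have 2: "((\<lambda>s. f' (\<xi>', s)) has_derivative (\<lambda>s. B.Df (\<xi>', t) (0, s))) (at t within {0<..T})"
    by (rule B.time_has_derivative[OF B.f_has_derivative[OF t(2)] t(2)])
  have "\<tau>' ?y (A.Df (\<xi>, t) (0, 1)) = B.Df (\<xi>', t) (0, 1)"
    using time_derivatives_eq[OF t 2 1, of 1] f'_eq by simp
  then have "A.H (\<xi>, t) *\<^sub>R \<nu>' (\<xi>', t) = B.H (\<xi>', t) *\<^sub>R \<nu>' (\<xi>', t)"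
    unfolding A.Df_time'[OF t(1)] B.Df_time'[OF t(2)] linear_cmul[OF lin] \<nu>'_eq[OF t, symmetric] by simp
  moreover have "\<nu>' (\<xi>', t) \<noteq> 0"
    using B.\<nu>_unit[OF t(2)] bilinear_simps[OF B.gmet_bilinear[OF B.q_in[OF t(2)]]] by auto
  ultimately show ?thesis by simp
qed

lemma Ht_eq:
  assumes t: "(\<xi>, t) \<in> S" "(\<xi>', t) \<in> S'" shows "A.Ht (\<xi>, t) = B.Ht (\<xi>', t)"
  unfolding A.Ht_def B.Ht_def
  by (rule time_derivatives_eq[OF t A.time_has_derivative[OF A.H_has_derivative(1)[OF t(1)] t(1)]
        B.time_has_derivative[OF B.H_has_derivative(1)[OF t(2)] t(2)] H_eq])

lemma K_eq:
  assumes t: "(\<xi>, t) \<in> S" "(\<xi>', t) \<in> S'" shows "A.K (\<xi>, t) = B.K (\<xi>', t)"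
proof -
  have "t \<in> {0<..T}" using A.S_sub[OF t(1)] by simp
  from Ric_pull[OF this f_V[OF t]] show ?thesis
    by (simp add: A.K_def B.K_def q_eq[OF t] \<nu>'_eq[OF t])
qed

lemma scal_eq:
  assumes t: "(\<xi>, t) \<in> S" "(\<xi>', t) \<in> S'"
  shows "A.scal (A.q (\<xi>, t)) = B.scal (B.q (\<xi>', t))" "A.scal_nu (\<xi>, t) = B.scal_nu (\<xi>', t)" "A.scal_t (\<xi>, t) = B.scal_t (\<xi>', t)"
proof -
  have t': "t \<in> {0<..T}" using A.S_sub[OF t(1)] by simp
  show "A.scal (A.q (\<xi>, t)) = B.scal (B.q (\<xi>', t))" "A.scal_nu (\<xi>, t) = B.scal_nu (\<xi>', t)" "A.scal_t (\<xi>, t) = B.scal_t (\<xi>', t)"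
    using scal_pull[OF t' f_V[OF t]] D_scal_pull[OF t' f_V[OF t]] linear_0[OF \<tau>'_linear[OF f_V[OF t]]]
    by (simp_all add: A.scal_nu_def B.scal_nu_def A.scal_t_def B.scal_t_def q_eq[OF t] \<nu>'_eq[OF t])
qed

end

context track_flow begin

text \<open>A single continuous and invariant function that dominates the quantities which
  \<open>defect_bound\<close> requires to be bounded along the track.\<close>

definition scale :: "'d \<times> real \<Rightarrow> real" where
  "scale p = \<bar>H p\<bar> + \<bar>K p\<bar> + \<bar>scal (q p)\<bar> + \<bar>scal_nu p\<bar> + \<bar>scal_t p\<bar> + \<bar>Ht p\<bar> + 1 / snd p"

lemma continuous_on_scale: "continuous_on S scale"
proof -
  have q: "q ` S \<subseteq> \<Omega>" using q_in by (rule image_subsetI)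
  have D: "continuous_on S (\<lambda>p. D \<Omega> scal (q p) h)" for h
    by (rule continuous_on_compose2[OF continuous_on_D_scal continuous_on_q q])
  have "continuous_on S (\<lambda>p. \<Sum>b\<in>Basis. (\<nu> p \<bullet> b) * D \<Omega> scal (q p) (b, 0))"
    by (intro continuous_intros D continuous_on_\<nu>)
  moreover have "scal_nu p = (\<Sum>b\<in>Basis. (\<nu> p \<bullet> b) * D \<Omega> scal (q p) (b, 0))" if "p \<in> S" for p
  proof -
    have "linear (\<lambda>y. D \<Omega> scal (q p) (y, 0))"
      using linear_compose[OF _ has_derivative_linear[OF scal_has_derivative[OF q_in[OF that]]], of "\<lambda>y. (y, 0)"]
      by (simp add: o_def linear_iff)
    from linear_expand[OF this, of "\<nu> p"] show ?thesis by (simp add: scal_nu_def)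
  qed
  ultimately have scal_nu: "continuous_on S scal_nu" by (simp cong: continuous_on_cong)
  have scal_t: "continuous_on S scal_t" unfolding scal_t_def[abs_def] by (rule D)
  have "continuous_on S (\<lambda>p. scal (q p))"
    by (rule continuous_on_compose2[OF continuous_on_scal continuous_on_q q])
  moreover have "\<forall>p\<in>S. snd p \<noteq> 0" using S_sub by fastforce
  ultimately show ?thesis
    unfolding scale_def[abs_def]
    by (intro continuous_intros continuous_on_H continuous_on_K continuous_on_Ht scal_nu scal_t)
qed

end

lemma (in track_pair) scale_eq:
  "(\<xi>, t) \<in> S \<Longrightarrow> (\<xi>', t) \<in> S' \<Longrightarrow> A.scale (\<xi>, t) = B.scale (\<xi>', t)"
  by (simp add: A.scale_def B.scale_def H_eq K_eq Ht_eq scal_eq)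

section \<open>Charts and the topology of a manifold\<close>

lemma
  assumes "smooth_manifold X \<A>" "c \<in> \<A>"
  shows chart_dom_openin: "openin X (chart_dom c)"
    and chart_img_open: "open (chart_img c)"
    and chart_map_continuous: "continuous_map (subtopology X (chart_dom c)) (top_of_set (chart_img c)) (chart_map c)"
    and chart_inv_map: "\<And>x. x \<in> chart_dom c \<Longrightarrow> chart_inv c (chart_map c x) = x"
    and chart_inv_continuous: "continuous_map (top_of_set (chart_img c)) X (chart_inv c)"
proof -
  show o: "openin X (chart_dom c)" "open (chart_img c)"
    using assms by (auto simp: smooth_manifold_def)
  have hm: "homeomorphic_map (subtopology X (chart_dom c)) (top_of_set (chart_img c)) (chart_map c)"
    using assms by (auto simp: smooth_manifold_def)
  then obtain h where h: "homeomorphic_maps (subtopology X (chart_dom c)) (top_of_set (chart_img c)) (chart_map c) h"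
    by (auto simp: homeomorphic_map_maps)
  have ts: "topspace (subtopology X (chart_dom c)) = chart_dom c"
    using openin_subset[OF o(1)] by auto
  show "continuous_map (subtopology X (chart_dom c)) (top_of_set (chart_img c)) (chart_map c)"
    using h by (simp add: homeomorphic_maps_def)
  have hi: "h (chart_map c x) = x" if "x \<in> chart_dom c" for x
    using h that ts by (simp add: homeomorphic_maps_def)
  have inj: "inj_on (chart_map c) (chart_dom c)" by (rule inj_on_inverseI[where g = h]) (rule hi)
  then show inv: "chart_inv c (chart_map c x) = x" if "x \<in> chart_dom c" for x
    using that by (simp add: chart_inv_def)
  have ch: "continuous_map (top_of_set (chart_img c)) X h"
    using h by (auto simp: homeomorphic_maps_def intro: continuous_map_into_fulltopology)
  show "continuous_map (top_of_set (chart_img c)) X (chart_inv c)"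
    by (rule continuous_map_eq[OF ch]) (auto simp: chart_img_def hi inv)
qed

lemma chart_map_in: "x \<in> chart_dom c \<Longrightarrow> chart_map c x \<in> chart_img c"
  by (auto simp: chart_img_def)

lemma prod_topology_euclidean:
  "prod_topology euclidean euclidean = (euclidean :: ('a::topological_space \<times> 'b::topological_space) topology)"
  unfolding topology_eq by (simp add: openin_prod_topology_alt open_prod_def)

lemma open_overlap:
  assumes X: "smooth_manifold X \<A>" and c: "c \<in> \<A>" "c' \<in> \<A>"
  shows "open (overlap c c')"
proof -
  have "overlap c c' = {y \<in> topspace (top_of_set (chart_img c)). chart_inv c y \<in> chart_dom c'}"
    unfolding overlap_def
    by (auto simp: chart_img_def chart_inv_map[OF X c(1)])
  also have "openin (top_of_set (chart_img c)) \<dots>"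
    using chart_inv_continuous[OF X c(1)] chart_dom_openin[OF X c(2)]
    by (rule openin_continuous_map_preimage)
  finally show ?thesis using chart_img_open[OF X c(1)] by (rule openin_open_trans)
qed

section \<open>The flow on the manifolds and bounds common to all charts\<close>

locale mcf_in_ricci_flow =
  fixes M :: "'p topology" and atlM :: "('p, 'd::euclidean_space) chart set"
    and Amb :: "'q topology" and atlO :: "('q, 'e::euclidean_space) chart set"
    and T :: real
    and g :: "('q, 'e) metric_family"
    and F :: "real \<Rightarrow> 'p \<Rightarrow> 'q"
    and \<nu> :: "('p, 'q, 'e) vector_family"
  assumes M: "smooth_manifold M atlM" and Amb: "smooth_manifold Amb atlO"
    and dim: "DIM('e) = DIM('d) + 1" and T: "T > 0"
    and metric: "smooth_metric_family atlO T g"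
    and immersion: "smooth_immersion_family M atlM Amb atlO T F"
    and normal: "smooth_unit_normal_family atlM atlO T g F \<nu>"
    and mcf: "mean_curvature_flow atlM atlO T g F \<nu>"
    and rf: "ricci_flow atlO T g"
begin

abbreviation spacetime where "spacetime \<equiv> prod_topology M (top_of_set {0<..T})"

definition rep where "rep a c = (\<lambda>(\<xi>, t). slice_rep a c (F t) \<xi>)"
definition nrep where "nrep a c = (\<lambda>(\<xi>, t). \<nu> c t (chart_inv a \<xi>))"

lemma F_continuous: "continuous_map spacetime Amb (\<lambda>(x, t). F t x)"
  using immersion by (simp add: smooth_immersion_family_def)

lemma track_dom_slice: "t \<in> {0<..T} \<Longrightarrow> {\<xi>. (\<xi>, t) \<in> track_dom T a c F} = slice_dom a c (F t)"
  by (auto simp: track_dom_def)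

lemma track_dom_iff:
  "(\<xi>, t) \<in> track_dom T a c F \<longleftrightarrow> t \<in> {0<..T} \<and> \<xi> \<in> chart_img a \<and> F t (chart_inv a \<xi>) \<in> chart_dom c"
  by (auto simp: track_dom_def slice_dom_def)

lemma in_track_dom:
  assumes "a \<in> atlM" "x \<in> chart_dom a"
  shows "(chart_map a x, t) \<in> track_dom T a c F \<longleftrightarrow> t \<in> {0<..T} \<and> F t x \<in> chart_dom c"
  using chart_map_in[OF assms(2)] chart_inv_map[OF M assms] by (auto simp: track_dom_iff)

text \<open>The set is the preimage of an open chart domain under \<open>F\<close> composed with
  \<open>chart_inv a\<close> in space and the identity in time; joint continuity of \<open>F\<close>
  in space and time enters here.\<close>

lemma openin_track_dom:
  assumes a: "a \<in> atlM" and c: "c \<in> atlO"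
  shows "openin (top_of_set (UNIV \<times> {0<..T})) (track_dom T a c F)"
proof -
  let ?Z = "top_of_set (chart_img a \<times> {0<..T})"
  have "continuous_map ?Z (top_of_set (chart_img a)) fst" "continuous_map ?Z (top_of_set {0<..T}) snd"
    by (auto simp: continuous_map_iff_continuous2 intro!: continuous_intros)
  then have "continuous_map ?Z spacetime (\<lambda>p. (chart_inv a (fst p), snd p))"
    unfolding continuous_map_paired
    using continuous_map_compose[OF _ chart_inv_continuous[OF M a], of ?Z fst] by (simp add: o_def)
  from continuous_map_compose[OF this F_continuous]
  have "continuous_map ?Z Amb (\<lambda>p. F (snd p) (chart_inv a (fst p)))" by (simp add: o_def)
  then have "openin ?Z {p \<in> topspace ?Z. F (snd p) (chart_inv a (fst p)) \<in> chart_dom c}"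
    using chart_dom_openin[OF Amb c] by (rule openin_continuous_map_preimage)
  also have "{p \<in> topspace ?Z. F (snd p) (chart_inv a (fst p)) \<in> chart_dom c} = track_dom T a c F"
    using track_dom_iff by (auto simp: track_dom_iff)
  finally have "openin ?Z (track_dom T a c F)" .
  moreover have "openin (top_of_set (UNIV \<times> {0<..T})) (chart_img a \<times> {0<..T})"
    using chart_img_open[OF M a]
    by (auto simp: openin_open intro!: exI[of _ "chart_img a \<times> UNIV"] open_Times)
  ultimately show ?thesis by (rule openin_trans)
qed

lemma chart_flow: "c \<in> atlO \<Longrightarrow> chart_flow (chart_img c) T (g c)"
  using chart_img_open[OF Amb] metric rf
  by unfold_locales (auto simp: smooth_metric_family_def ricci_flow_def)

lemma track_flow:
  assumes a: "a \<in> atlM" and c: "c \<in> atlO"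
  shows "track_flow (chart_img c) T (g c) (track_dom T a c F) (rep a c) (nrep a c)"
proof -
  interpret chart_flow "chart_img c" T "g c" using c by (rule chart_flow)
  have rep: "(\<lambda>\<xi>. rep a c (\<xi>, t)) = slice_rep a c (F t)" for t by (simp add: rep_def)
  have sd: "t \<in> {0<..T}" "\<xi> \<in> slice_dom a c (F t)" if "(\<xi>, t) \<in> track_dom T a c F" for \<xi> t
    using that by (auto simp: track_dom_def)
  show ?thesis
  proof unfold_locales
    show "openin (top_of_set (UNIV \<times> {0<..T})) (track_dom T a c F)" using a c by (rule openin_track_dom)
    show "rep a c p \<in> chart_img c" if "p \<in> track_dom T a c F" for p
      using that chart_map_in[of _ c] by (cases p) (auto simp: track_dom_iff rep_def slice_rep_def)
    show "smooth_on (track_dom T a c F) (rep a c)"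
      using immersion a c by (simp add: smooth_immersion_family_def rep_def)
    show "smooth_on (track_dom T a c F) (nrep a c)"
      using normal a c by (simp add: smooth_unit_normal_family_def nrep_def)
    show "DIM('e) = DIM('d) + 1" by (rule dim)
    fix \<xi> t assume p: "(\<xi>, t) \<in> track_dom T a c F"
    note t = sd(1)[OF p] and \<xi> = sd(2)[OF p]
    show "inj (frechet_derivative (\<lambda>\<xi>. rep a c (\<xi>, t)) (at \<xi>))"
      unfolding rep using immersion a c t \<xi> unfolding smooth_immersion_family_def by blast
    show "unit_normal_at (g c t) {\<xi>. (\<xi>, t) \<in> track_dom T a c F} (\<lambda>\<xi>. rep a c (\<xi>, t)) \<xi> (nrep a c (\<xi>, t))"
      unfolding rep track_dom_slice[OF t] nrep_def prod.case
      using normal a c t \<xi> unfolding smooth_unit_normal_family_def by blast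
    have "((\<lambda>s. slice_rep a c (F s) \<xi>) has_vector_derivative
        - mean_curvature (chart_img c) (g c t) (slice_dom a c (F t)) (slice_rep a c (F t))
            (\<nu> c t (chart_inv a \<xi>)) \<xi> *\<^sub>R \<nu> c t (chart_inv a \<xi>)) (at t within {0<..T})"
      using mcf a c t \<xi> unfolding mean_curvature_flow_def by blast
    then show "((\<lambda>s. rep a c (\<xi>, s)) has_vector_derivative
        - mean_curvature (chart_img c) (g c t) {\<xi>. (\<xi>, t) \<in> track_dom T a c F} (\<lambda>\<xi>. rep a c (\<xi>, t))
            (nrep a c (\<xi>, t)) \<xi> *\<^sub>R nrep a c (\<xi>, t)) (at t within {0<..T})"
      unfolding rep track_dom_slice[OF t] nrep_def prod.case by (simp add: rep_def)
  qed
qed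

definition size where
  "size a c = track_flow.scale (chart_img c) T (g c) (track_dom T a c F) (rep a c) (nrep a c)"

text \<open>Any two pairs of charts around the same point form a \<open>track_pair\<close> over the
  overlap of the ambient charts, so a bound found in one pair is valid in every other.\<close>

lemma size_invariant:
  assumes a: "a \<in> atlM" "a' \<in> atlM" and c: "c \<in> atlO" "c' \<in> atlO" and t: "t \<in> {0<..T}"
    and x: "x \<in> chart_dom a" "x \<in> chart_dom a'" "F t x \<in> chart_dom c" "F t x \<in> chart_dom c'"
  shows "size a c (chart_map a x, t) = size a' c' (chart_map a' x, t)"
proof -
  let ?V = "overlap c c'" and ?\<tau> = "transition c c'"
  have Vc: "chart_map c z \<in> ?V" "?\<tau> (chart_map c z) = chart_map c' z"
    if "z \<in> chart_dom c" "z \<in> chart_dom c'" for z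
    using that chart_inv_map[OF Amb c(1)] by (auto simp: overlap_def transition_def)
  have oV: "open ?V" using open_overlap[OF Amb c] .
  note A = track_flow[OF a(1) c(1)] and B = track_flow[OF a(2) c(2)]
  interpret A: track_flow "chart_img c" T "g c" "track_dom T a c F" "rep a c" "nrep a c" by (rule A)
  interpret B: track_flow "chart_img c'" T "g c'" "track_dom T a' c' F" "rep a' c'" "nrep a' c'" by (rule B)
  interpret track_pair "chart_img c" T "g c" "chart_img c'" "g c'" ?V ?\<tau> "\<lambda>y. frechet_derivative ?\<tau> (at y)"
    "track_dom T a c F" "rep a c" "nrep a c" "track_dom T a' c' F" "rep a' c'" "nrep a' c'"
    "chart_map a x" "chart_map a' x"
  proof unfold_locales
    show "open ?V" by (rule oV)
    show "?V \<subseteq> chart_img c" by (auto simp: overlap_def chart_img_def)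
    show "?\<tau> y \<in> chart_img c'" if "y \<in> ?V" for y
      using that Vc(2) chart_map_in[of _ c'] by (auto simp: overlap_def)
    show "(?\<tau> has_derivative frechet_derivative ?\<tau> (at y)) (at y)" if "y \<in> ?V" for y
    proof -
      have "smooth_on ?V ?\<tau>" using Amb c by (simp add: smooth_manifold_def)
      then have "?\<tau> differentiable (at y)"
        using smooth_on_differentiable[OF _ that] at_within_open[OF that oV] by metis
      then show ?thesis by (simp add: frechet_derivative_works)
    qed
    show "g c t y u v = g c' t (?\<tau> y) (frechet_derivative ?\<tau> (at y) u) (frechet_derivative ?\<tau> (at y) v)"
      if "t \<in> {0<..T}" "y \<in> ?V" for t y u v
      using metric c that unfolding smooth_metric_family_def by blast
    fix s assume s: "(chart_map a x, s) \<in> track_dom T a c F" "(chart_map a' x, s) \<in> track_dom T a' c' F"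
    then have s': "s \<in> {0<..T}" "F s x \<in> chart_dom c" "F s x \<in> chart_dom c'"
      using in_track_dom[OF a(1) x(1), of s c] in_track_dom[OF a(2) x(2), of s c'] by auto
    have r: "rep a c (chart_map a x, s) = chart_map c (F s x)" "rep a' c' (chart_map a' x, s) = chart_map c' (F s x)"
      "nrep a c (chart_map a x, s) = \<nu> c s x" "nrep a' c' (chart_map a' x, s) = \<nu> c' s x"
      by (simp_all add: rep_def nrep_def slice_rep_def chart_inv_map[OF M a(1) x(1)] chart_inv_map[OF M a(2) x(2)])
    show "rep a c (chart_map a x, s) \<in> ?V" "rep a' c' (chart_map a' x, s) = ?\<tau> (rep a c (chart_map a x, s))"
      unfolding r using Vc s' by simp_all
    show "nrep a' c' (chart_map a' x, s) = frechet_derivative ?\<tau> (at (rep a c (chart_map a x, s))) (nrep a c (chart_map a x, s))"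
      unfolding r using normal a c s' x unfolding smooth_unit_normal_family_def by blast
  qed
  show ?thesis
    unfolding size_def
    by (rule scale_eq) (use in_track_dom[OF a(1) x(1), of t c] in_track_dom[OF a(2) x(2), of t c'] t x in auto)
qed

text \<open>The atlases may be infinite, so bounds found chart by chart would not yield one
  constant. Near each point of \<open>K\<close> one pair of charts is fixed, continuity bounds
  \<open>size\<close> there, \<open>size_invariant\<close> passes to all other pairs, and
  compactness leaves finitely many neighbourhoods.\<close>

lemma size_locally_bounded:
  assumes K: "compactin spacetime K"
  shows "\<exists>B. \<forall>(x, t)\<in>K. \<forall>a\<in>atlM. \<forall>c\<in>atlO. x \<in> chart_dom a \<longrightarrow> F t x \<in> chart_dom c \<longrightarrow>
    size a c (chart_map a x, t) \<le> B"
proof -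
  define bd where "bd W B \<longleftrightarrow> (\<forall>(x, t)\<in>W. \<forall>a\<in>atlM. \<forall>c\<in>atlO. x \<in> chart_dom a \<longrightarrow> F t x \<in> chart_dom c \<longrightarrow>
    size a c (chart_map a x, t) \<le> B)" for W and B :: real
  define \<U> where "\<U> = {W. openin spacetime W \<and> (\<exists>B. bd W B)}"
  have "\<exists>W\<in>\<U>. p \<in> W" if "p \<in> K" for p
  proof -
    obtain x0 t0 where p: "p = (x0, t0)" by force
    have top: "p \<in> topspace spacetime" using compactin_subset_topspace[OF K] that by blast
    then have x0: "x0 \<in> topspace M" and t0: "t0 \<in> {0<..T}" by (auto simp: p)
    obtain a where a: "a \<in> atlM" "x0 \<in> chart_dom a" using M x0 unfolding smooth_manifold_def by blast
    have "F t0 x0 \<in> topspace Amb"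
      using continuous_map_image_subset_topspace[OF F_continuous] top by (force simp: p)
    then obtain c where c: "c \<in> atlO" "F t0 x0 \<in> chart_dom c" using Amb unfolding smooth_manifold_def by blast
    define W where "W = {p \<in> topspace spacetime. fst p \<in> chart_dom a \<and> F (snd p) (fst p) \<in> chart_dom c}"
    have "openin spacetime ({p \<in> topspace spacetime. (case p of (x, t) \<Rightarrow> F t x) \<in> chart_dom c}
        \<inter> {p \<in> topspace spacetime. fst p \<in> chart_dom a})"
      by (intro openin_Int openin_continuous_map_preimage[OF F_continuous chart_dom_openin[OF Amb c(1)]]
          openin_continuous_map_preimage[OF continuous_map_fst chart_dom_openin[OF M a(1)]])
    also have "({p \<in> topspace spacetime. (case p of (x, t) \<Rightarrow> F t x) \<in> chart_dom c}
        \<inter> {p \<in> topspace spacetime. fst p \<in> chart_dom a}) = W"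
      by (auto simp: W_def)
    finally have oW: "openin spacetime W" .
    have tW: "topspace (subtopology spacetime W) = W" using openin_subset[OF oW] by auto
    have "continuous_map (subtopology spacetime W) (subtopology M (chart_dom a)) fst"
      by (intro continuous_map_into_subtopology continuous_map_from_subtopology continuous_map_fst)
        (auto simp: W_def)
    from continuous_map_compose[OF this chart_map_continuous[OF M a(1)]]
    have 1: "continuous_map (subtopology spacetime W) euclidean (\<lambda>p. chart_map a (fst p))"
      by (auto simp: o_def intro: continuous_map_into_fulltopology)
    have 2: "continuous_map (subtopology spacetime W) euclidean snd"
      by (intro continuous_map_from_subtopology continuous_map_into_fulltopology[OF continuous_map_snd])
    have "continuous_map (subtopology spacetime W) (top_of_set (track_dom T a c F)) (\<lambda>p. (chart_map a (fst p), snd p))"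
    proof (rule continuous_map_into_subtopology)
      show "continuous_map (subtopology spacetime W) euclidean (\<lambda>p. (chart_map a (fst p), snd p))"
        using continuous_map_pairedI[OF 1 2] unfolding prod_topology_euclidean .
      show "(\<lambda>p. (chart_map a (fst p), snd p)) \<in> topspace (subtopology spacetime W) \<rightarrow> track_dom T a c F"
        unfolding tW using in_track_dom[OF a(1), of _ _ c] by (auto simp: W_def)
    qed
    moreover have "continuous_map (top_of_set (track_dom T a c F)) euclideanreal (size a c)"
      unfolding size_def using track_flow.continuous_on_scale[OF track_flow[OF a(1) c(1)]] by simp
    ultimately have "continuous_map (subtopology spacetime W) euclideanreal (size a c \<circ> (\<lambda>p. (chart_map a (fst p), snd p)))"
      by (rule continuous_map_compose)
    \<comment> \<open>The margin \<open>1\<close> in the strict inequality makes this sublevel set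
      an open neighbourhood of \<open>p\<close>.\<close>
    then have "openin (subtopology spacetime W) {p \<in> topspace (subtopology spacetime W).
        (size a c \<circ> (\<lambda>p. (chart_map a (fst p), snd p))) p \<in> {..< size a c (chart_map a x0, t0) + 1}}"
      by (rule openin_continuous_map_preimage) simp
    then have "openin spacetime {p \<in> W. size a c (chart_map a (fst p), snd p) < size a c (chart_map a x0, t0) + 1}"
      unfolding tW using openin_trans_full[OF _ oW] by simp
    moreover have "bd {p \<in> W. size a c (chart_map a (fst p), snd p) < size a c (chart_map a x0, t0) + 1}
        (size a c (chart_map a x0, t0) + 1)"
      unfolding bd_def
    proof (clarsimp)
      fix x t a' c' assume xt: "(x, t) \<in> W" "size a c (chart_map a x, t) < size a c (chart_map a x0, t0) + 1"
        and a': "a' \<in> atlM" "x \<in> chart_dom a'" and c': "c' \<in> atlO" "F t x \<in> chart_dom c'"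
      then show "size a' c' (chart_map a' x, t) \<le> size a c (chart_map a x0, t0) + 1"
        using size_invariant[OF a(1) a'(1) c(1) c'(1), of t x] by (auto simp: W_def)
    qed
    moreover have "p \<in> W" using top a c by (simp add: W_def p)
    ultimately show ?thesis
      by (intro bexI[of _ "{p \<in> W. size a c (chart_map a (fst p), snd p) < size a c (chart_map a x0, t0) + 1}"])
        (auto simp: \<U>_def p)
  qed
  then have "K \<subseteq> \<Union>\<U>" by blast
  moreover have "\<forall>W\<in>\<U>. openin spacetime W" by (simp add: \<U>_def)
  ultimately obtain \<F> where \<F>: "finite \<F>" "\<F> \<subseteq> \<U>" "K \<subseteq> \<Union>\<F>" using K unfolding compactin_def by meson
  have "\<exists>B. \<forall>W\<in>\<F>. bd W B"
    using \<F>(1,2)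
  proof (induction \<F>)
    case (insert W \<F>)
    then obtain B B' where "\<forall>W\<in>\<F>. bd W B" "bd W B'" by (auto simp: \<U>_def)
    then have "\<forall>W\<in>insert W \<F>. bd W (max B B')" unfolding bd_def by fastforce
    then show ?case by blast
  qed simp
  then obtain B where B: "\<forall>W\<in>\<F>. bd W B" by blast
  have "bd K B"
    unfolding bd_def
  proof
    fix p assume "p \<in> K"
    then obtain W where W: "W \<in> \<F>" "p \<in> W" using \<F>(3) by blast
    show "case p of (x, t) \<Rightarrow> \<forall>a\<in>atlM. \<forall>c\<in>atlO. x \<in> chart_dom a \<longrightarrow> F t x \<in> chart_dom c \<longrightarrow>
        size a c (chart_map a x, t) \<le> B"
      using bspec[OF B W(1)] W(2) unfolding bd_def by (rule bspec)
  qed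
  then show ?thesis unfolding bd_def by (rule exI)
qed

lemma spacetime_metric_eq: "c \<in> atlO \<Longrightarrow> spacetime_metric g N c = chart_flow.stmet (chart_img c) (g c) N"
proof -
  assume "c \<in> atlO"
  then interpret chart_flow "chart_img c" T "g c" by (rule chart_flow)
  show ?thesis
    by (intro ext) (auto simp: spacetime_metric_def stmet_def lapse_def gmet_def)
qed

lemma soliton_defect_eq:
  assumes a: "a \<in> atlM" and c: "c \<in> atlO" and p: "p \<in> track_dom T a c F"
    and pos: "\<forall>x\<in>chart_img c \<times> {0<..T}. chart_flow.lapse (chart_img c) (g c) N x > 0"
  shows "soliton_defect T g F \<nu> N a c p =
    track_flow.nu_t (chart_img c) (g c) (track_dom T a c F) (rep a c) (nrep a c) N p *
      (track_flow.K (chart_img c) T (g c) (rep a c) (nrep a c) p + 1 / (2 * snd p)) +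
    track_flow.sff_tt (chart_img c) T (g c) (track_dom T a c F) (rep a c) (nrep a c) N p /
      track_flow.track_lapse (chart_img c) (g c) (track_dom T a c F) (rep a c) (nrep a c) N p"
proof -
  interpret track_flow "chart_img c" T "g c" "track_dom T a c F" "rep a c" "nrep a c"
    using a c by (rule track_flow)
  have q: "track_rep a c F = q" by (rule ext) (simp only: track_rep_def q_def, simp add: rep_def split_beta)
  have n: "track_normal T g F \<nu> N a c p =
      (THE n. unit_normal_at (stmet N) (track_dom T a c F) q p n \<and> stmet N (q p) n (nrep a c p, 0) > 0)"
    unfolding track_normal_def q spacetime_metric_eq[OF c] nrep_def by (cases p) simp
  show ?thesis
    unfolding soliton_defect_def Let_def n q spacetime_metric_eq[OF c] spacetime_dom_def
    by (rule defect_formula[OF p pos])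
qed

end

theorem theorem3p2:
  fixes M :: "'p topology" and atlM :: "('p, 'd::euclidean_space) chart set"
    and Amb :: "'q topology" and atlO :: "('q, 'e::euclidean_space) chart set"
    and T :: real
    and g :: "('q, 'e) metric_family"
    and F :: "real \<Rightarrow> 'p \<Rightarrow> 'q"
    and \<nu> :: "('p, 'q, 'e) vector_family"
  assumes "smooth_manifold M atlM"
    and "smooth_manifold Amb atlO"
    and "DIM('e) = DIM('d) + 1"
    and "T > 0"
    and "smooth_metric_family atlO T g"
    and "smooth_immersion_family M atlM Amb atlO T F"
    and "smooth_unit_normal_family atlM atlO T g F \<nu>"
    and "mean_curvature_flow atlM atlO T g F \<nu>"
    and "ricci_flow atlO T g"
    and "uniformly_bounded_curvature atlO T g"
    and "uniformly_bounded_second_fundamental_form atlM atlO T g F \<nu>"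
  shows "\<exists>N\<^sub>0>0.
    (\<forall>N\<ge>N\<^sub>0. \<forall>c\<in>atlO. \<forall>q\<in>spacetime_dom T c. inner_product (spacetime_metric g N c q)) \<and>
    (\<forall>K. compactin (prod_topology M (top_of_set {0<..T})) K \<longrightarrow>
      (\<exists>C. \<forall>N\<ge>N\<^sub>0. \<forall>(x, t)\<in>K. \<forall>a\<in>atlM. \<forall>c\<in>atlO.
        x \<in> chart_dom a \<longrightarrow> F t x \<in> chart_dom c \<longrightarrow>
        N * \<bar>soliton_defect T g F \<nu> N a c (chart_map a x, t)\<bar> \<le> C))"
proof -
  interpret mcf_in_ricci_flow M atlM Amb atlO T g F \<nu>
    using assms by unfold_locales
  obtain C where C: "\<And>c t y u v w z. c \<in> atlO \<Longrightarrow> t \<in> {0<..T} \<Longrightarrow> y \<in> chart_img c \<Longrightarrow>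
      \<bar>g c t y (riemann (chart_img c) (g c t) y u v w) z\<bar>
        \<le> C * sqrt (g c t y u u) * sqrt (g c t y v v) * sqrt (g c t y w w) * sqrt (g c t y z z)"
    using assms(10) unfolding uniformly_bounded_curvature_def by blast
  \<comment> \<open>\<open>R\<close> bounds the scalar curvature through \<open>scal_bound\<close>;
    the absolute value is there because the sign of \<open>C\<close> is unknown. The threshold
    \<open>4 * R * T\<^sup>2\<close> lets one half of \<open>N / (2 * t ^ 3)\<close> absorb
    \<open>R / t\<close> for all \<open>t \<le> T\<close>, and the \<open>+ 1\<close> makes it
    positive even if \<open>R = 0\<close>.\<close>
  define R where "R = \<bar>DIM('e) * (DIM('e) * C)\<bar>"
  define N\<^sub>0 where "N\<^sub>0 = 4 * R * T\<^sup>2 + 1"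
  have R: "R \<ge> 0" by (simp add: R_def)
  have N0: "N\<^sub>0 > 0" using R by (simp add: N\<^sub>0_def add_nonneg_pos)
  have lapse: "N / (4 * t ^ 3) \<le> chart_flow.lapse (chart_img c) (g c) N (y, t)"
    if N: "N \<ge> N\<^sub>0" and c: "c \<in> atlO" and t: "t \<in> {0<..T}" and y: "y \<in> chart_img c" for N c t y
  proof -
    interpret chart_flow "chart_img c" T "g c" using c by (rule chart_flow)
    have p: "(y, t) \<in> \<Omega>" using t y by simp
    have "\<bar>scal (y, t)\<bar> \<le> R"
      using scal_bound[OF p C[OF c t y]] unfolding R_def by linarith
    then have s: "- R \<le> scal (y, t)" by simp
    have "4 * R * t\<^sup>2 \<le> 4 * R * T\<^sup>2" using t R by (intro mult_left_mono power_mono) auto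
    then have "4 * R * t\<^sup>2 \<le> N" using N by (simp add: N\<^sub>0_def)
    then have "R / t \<le> N / (4 * t ^ 3)" using t by (simp add: field_simps power2_eq_square power3_eq_cube)
    moreover have "- R / t \<le> scal (y, t) / t" using t s by (intro divide_right_mono) auto
    moreover have "N / (2 * t ^ 3) = N / (4 * t ^ 3) + N / (4 * t ^ 3)" by simp
    moreover have "DIM('e) / (2 * t\<^sup>2) \<ge> 0" by simp
    ultimately show ?thesis unfolding lapse_eq[OF p] fst_conv snd_conv by linarith
  qed
  have pos: "\<forall>x\<in>chart_img c \<times> {0<..T}. chart_flow.lapse (chart_img c) (g c) N x > 0"
    if N: "N \<ge> N\<^sub>0" and c: "c \<in> atlO" for N c
  proof
    fix x assume "x \<in> chart_img c \<times> {0<..T}"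
    then obtain y t where x: "x = (y, t)" "y \<in> chart_img c" "t \<in> {0<..T}" by auto
    have "0 < N / (4 * t ^ 3)" using N N0 x by simp
    also have "\<dots> \<le> chart_flow.lapse (chart_img c) (g c) N x" unfolding x(1) by (rule lapse[OF N c x(3,2)])
    finally show "chart_flow.lapse (chart_img c) (g c) N x > 0" .
  qed
  show ?thesis
  proof (rule exI[of _ N\<^sub>0], intro conjI allI impI ballI N0)
    fix N c q assume N: "N \<ge> N\<^sub>0" and c: "c \<in> atlO" and q: "q \<in> spacetime_dom T c"
    interpret chart_flow "chart_img c" T "g c" using c by (rule chart_flow)
    show "inner_product (spacetime_metric g N c q)"
      unfolding spacetime_metric_eq[OF c] using q pos[OF N c]
      by (intro stmet_inner) (auto simp: spacetime_dom_def)
  next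
    fix Q assume Q: "compactin (prod_topology M (top_of_set {0<..T})) Q"
    obtain B0 where B0: "\<And>x t a c. (x, t) \<in> Q \<Longrightarrow> a \<in> atlM \<Longrightarrow> c \<in> atlO \<Longrightarrow> x \<in> chart_dom a \<Longrightarrow>
        F t x \<in> chart_dom c \<Longrightarrow> size a c (chart_map a x, t) \<le> B0"
      using size_locally_bounded[OF Q] by blast
    \<comment> \<open>\<open>T\<close> bounds the time, \<open>B0\<close> bounds \<open>size\<close>
      on \<open>Q\<close> in all charts, and \<open>1\<close> is the lower bound that
      \<open>defect_bound\<close> asks for.\<close>
    define B where "B = max 1 (max T B0)"
    have B: "B \<ge> 1" "T \<le> B" "B0 \<le> B" by (simp_all add: B_def)
    show "\<exists>C. \<forall>N\<ge>N\<^sub>0. \<forall>(x, t)\<in>Q. \<forall>a\<in>atlM. \<forall>c\<in>atlO.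
        x \<in> chart_dom a \<longrightarrow> F t x \<in> chart_dom c \<longrightarrow>
        N * \<bar>soliton_defect T g F \<nu> N a c (chart_map a x, t)\<bar> \<le> C"
    proof (rule exI[of _ "defect_const N\<^sub>0 B (DIM('e))"], clarify)
      fix N x t a c
      assume N: "N \<ge> N\<^sub>0" and xt: "(x, t) \<in> Q" and a: "a \<in> atlM" and c: "c \<in> atlO"
        and x: "x \<in> chart_dom a" and Fx: "F t x \<in> chart_dom c"
      have t: "t \<in> {0<..T}" using compactin_subset_topspace[OF Q] xt by auto
      let ?p = "(chart_map a x, t)"
      have p: "?p \<in> track_dom T a c F" using in_track_dom[OF a x, of t c] t Fx by simp
      interpret track_flow "chart_img c" T "g c" "track_dom T a c F" "rep a c" "nrep a c"
        using a c by (rule track_flow)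
      have "scale ?p \<le> B" using B0[OF xt a c x Fx] B by (simp add: size_def)
      then have sc: "\<bar>H ?p\<bar> + \<bar>K ?p\<bar> + \<bar>scal (q ?p)\<bar> + \<bar>scal_nu ?p\<bar> + \<bar>scal_t ?p\<bar> + \<bar>Ht ?p\<bar> + 1 / t \<le> B"
        by (simp add: scale_def)
      have tp: "1 / t > 0" "0 < t" "t \<le> B" using t B by auto
      \<comment> \<open>All summands of \<open>scale\<close> are nonnegative, so the bound on the
        sum holds for each of them.\<close>
      have bounds: "1 / t \<le> B" "\<bar>H ?p\<bar> \<le> B" "\<bar>K ?p\<bar> \<le> B" "\<bar>scal (q ?p)\<bar> \<le> B" "\<bar>scal_nu ?p\<bar> \<le> B" "\<bar>scal_t ?p\<bar> \<le> B" "\<bar>Ht ?p\<bar> \<le> B"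
        using sc tp(1) by linarith+
      have "N / (4 * t ^ 3) \<le> lapse N (q ?p)"
        using lapse[OF N c t, of "fst (q ?p)"] q_in[OF p] by (simp add: q_def)
      from defect_bound[OF N0 B(1) of_nat_0_le_iff N tp(2,3) bounds this, of "DIM('e)"]
      show "N * \<bar>soliton_defect T g F \<nu> N a c ?p\<bar> \<le> defect_const N\<^sub>0 B (DIM('e))"
        unfolding soliton_defect_eq[OF a c p pos[OF N c]] nu_t_def nu_x_def sff_tt_def track_lapse_def dlapse_def scal_t_def
        by simp
    qed
  qed
qed

end
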